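(* The monoid ${\cal M}_{\sf bd}^{\sf P}={\cal RM}^{\sf P}/\!\equiv_{\sf bd}$ has exactly two non-zero ${\cal D}$-classes, namely $$D_1=\{[f]_{\sf bd} : [f]_{\sf bd}\ \text{contains some } f\neq 0 \text{ such that } {\sf imC}(f) \text{ is finite}\}$$ and $$D_2=\{[f]_{\sf bd} : [f]_{\sf bd}\ \text{contains some } f \text{ such that } {\sf imC}(f) \text{ is infinite}\}.$$
   Context: Let $A=\{0,1\}$, and let $A^*$ be the set of all finite words over $A$ (including the empty word), $|x|$ the length of $x$. "Function" means partial function; ${\sf Dom}(f)$, ${\sf Im}(f)$ are domain and image. For words $v,w$: $v \parallel_{\sf pref} w$ means that one of $v,w$ is a prefix of the other. A prefix code is a set $P\subset A^*$ in which no two distinct elements are prefix-comparable. A right ideal is a set $R\subseteq A^*$ with $RA^*=R$; every right ideal $R$ equals $PA^*$ for a unique prefix code $P$. A function $f:A^*\to A^*$ is polynomially balanced iff there is a polynomial $p$ such that $|f(x)|\le p(|x|)$ and $|x|\le p(|f(x)|)$ for all $x\in{\sf Dom}(f)$. ${\sf fP}$ is the monoid of all polynomially balanced partial functions $A^*\to A^*$ computable by deterministic Turing machines in polynomial time. A right-ideal morphism is a partial function $h:A^*\to A^*$ such that ${\sf Dom}(h)$ is a right ideal and $h(xw)=h(x)\,w$ for all $x\in{\sf Dom}(h)$, $w\in A^*$; then ${\sf Im}(h)$ is also a right ideal. ${\sf domC}(h)$ and ${\sf imC}(h)$ are the prefix codes that generate ${\sf Dom}(h)$, respectively ${\sf Im}(h)$,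 as right ideals. ${\cal RM}^{\sf P}$ is the monoid (under composition) of all $f\in{\sf fP}$ that are right-ideal morphisms; $0$ denotes the empty map. For $L_1,L_2\subseteq A^*$: $L_1\equiv_{\sf end}L_2$ iff $L_1A^*$ and $L_2A^*$ intersect (i.e., meet in a nonempty set) the same right ideals of $A^*$. For prefix codes $P_1,P_2$: $P_1\equiv_{\sf bd}P_2$ iff $P_1\equiv_{\sf end}P_2$ and there is a total function $\beta:{\mathbb N}\to{\mathbb N}$ such that for all $x_1\in P_1$, $x_2\in P_2$ with $x_1\parallel_{\sf pref}x_2$: $|x_1|\le\beta(|x_2|)$ and $|x_2|\le\beta(|x_1|)$. For right-ideal morphisms: $f\equiv_{\sf bd}g$ iff ${\sf domC}(f)\equiv_{\sf bd}{\sf domC}(g)$ and $f,g$ agree on ${\sf Dom}(f)\cap{\sf Dom}(g)$. This is a congruence on ${\cal RM}^{\sf P}$; $[f]_{\sf bd}=\{g\in{\cal RM}^{\sf P}:g\equiv_{\sf bd}f\}$, and ${\cal M}_{\sf bd}^{\sf P}$ is the quotient monoid. In a monoid $M$: $t\le_{\cal L}s$ iff $t=ms$ for some $m\in M$; $v\le_{\cal R}u$ iff $v=un$ for some $n\in M$; $\equiv_{\cal L},\equiv_{\cal R}$ are the corresponding equivalence relations; $x\equiv_{\cal D}y$ iff there is $z\in M$ with $x\equiv_{\cal R}z\equiv_{\cal L}y$. The ${\cal D}$-classes are the $\equiv_{\cal D}$-classes; a non-zero ${\cal D}$-class is one other than that of the zero $[0]_{\sf bd}$. *)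

theory Defs
  imports
    "HOL-Library.Sublist"
    "HOL-Computational_Algebra.Polynomial"
    "HOL-Algebra.Group"
begin

section \<open>Words, right ideals and prefix codes\<close>

text \<open>The alphabet \<open>{0,1}\<close> is \<^typ>\<open>bool\<close> and partial functions are maps.\<close>

type_synonym word = "bool list"

definition pref_comparable :: "word \<Rightarrow> word \<Rightarrow> bool" where
  "pref_comparable v w \<longleftrightarrow> prefix v w \<or> prefix w v"

definition prefix_code :: "word set \<Rightarrow> bool" where
  "prefix_code P \<longleftrightarrow> (\<forall>x\<in>P. \<forall>y\<in>P. pref_comparable x y \<longrightarrow> x = y)"

definition ideal_gen :: "word set \<Rightarrow> word set" where
  "ideal_gen L = {x @ w | x w. x \<in> L}"

definition right_ideal :: "word set \<Rightarrow> bool" where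
  "right_ideal R \<longleftrightarrow> ideal_gen R = R"

lemma ex1_prefix_code:
  assumes "right_ideal R"
  shows "\<exists>!P. prefix_code P \<and> ideal_gen P = R"
proof
  let ?P = "{x \<in> R. \<forall>y\<in>R. prefix y x \<longrightarrow> y = x}"
  have R: "x @ w \<in> R" if "x \<in> R" for x w
    using assms that unfolding right_ideal_def ideal_gen_def by blast
  have "\<exists>y\<in>?P. prefix y x" if "x \<in> R" for x
    using that
  proof (induction "length x" arbitrary: x rule: less_induct)
    case less
    show ?case
    proof (cases "x \<in> ?P")
      case False
      then obtain y where "y \<in> R" "strict_prefix y x"
        using less.prems by (auto simp: strict_prefix_def)
      with less.hyps[of y] show ?thesis
        by (meson prefix_length_less prefix_order.less_imp_le prefix_order.trans)
    qed auto
  qed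
  then have "ideal_gen ?P = R"
    unfolding ideal_gen_def using R by (auto simp: prefix_def)
  moreover have "prefix_code ?P"
    unfolding prefix_code_def pref_comparable_def by blast
  ultimately show "prefix_code ?P \<and> ideal_gen ?P = R" by simp
  fix P assume P: "prefix_code P \<and> ideal_gen P = R"
  have gen: "x \<in> R \<longleftrightarrow> (\<exists>p\<in>P. prefix p x)" for x
    using P unfolding ideal_gen_def prefix_def by auto
  have code: "x = y" if "x \<in> P" "y \<in> P" "prefix x y" for x y
    using P that unfolding prefix_code_def pref_comparable_def by blast
  show "P = ?P"
  proof (intro equalityI subsetI)
    fix x assume x: "x \<in> P"
    have "y = x" if y: "y \<in> R" "prefix y x" for y
    proof -
      obtain p where p: "p \<in> P" "prefix p y" using y gen by blast
      then have "p = x" using code x y(2) prefix_order.trans by blast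
      with p y show ?thesis by (simp add: prefix_order.antisym)
    qed
    moreover have "x \<in> R" using x gen by blast
    ultimately show "x \<in> ?P" by simp
  next
    fix x assume x: "x \<in> ?P"
    then obtain p where p: "p \<in> P" "prefix p x" using gen by blast
    then have "p \<in> R" using gen by blast
    with x p show "x \<in> P" by auto
  qed
qed

text \<open>Only meaningful if \<open>R\<close> is a right ideal, by the preceding lemma.\<close>

definition code_of :: "word set \<Rightarrow> word set" where
  "code_of R = (THE P. prefix_code P \<and> ideal_gen P = R)"

definition end_equiv :: "word set \<Rightarrow> word set \<Rightarrow> bool" where
  "end_equiv L\<^sub>1 L\<^sub>2 \<longleftrightarrow>
     (\<forall>R. right_ideal R \<longrightarrow> (ideal_gen L\<^sub>1 \<inter> R \<noteq> {} \<longleftrightarrow> ideal_gen L\<^sub>2 \<inter> R \<noteq> {}))"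

definition bd_equiv_code :: "word set \<Rightarrow> word set \<Rightarrow> bool" where
  "bd_equiv_code P\<^sub>1 P\<^sub>2 \<longleftrightarrow> end_equiv P\<^sub>1 P\<^sub>2 \<and>
     (\<exists>\<beta> :: nat \<Rightarrow> nat. \<forall>x\<^sub>1\<in>P\<^sub>1. \<forall>x\<^sub>2\<in>P\<^sub>2. pref_comparable x\<^sub>1 x\<^sub>2 \<longrightarrow>
        length x\<^sub>1 \<le> \<beta> (length x\<^sub>2) \<and> length x\<^sub>2 \<le> \<beta> (length x\<^sub>1))"


section \<open>Deterministic multi-tape Turing machines\<close>

text \<open>
  States and tape symbols are initial segments of the naturals. State 0 is the initial state, and
  1 and 2 are the two halting states (accept, reject). Symbol 0 is the blank, 1 and 2 encode the
  letters. Tapes are infinite in both directions. Tape 0 initially holds the input, starting at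
  cell 0; tape 1 holds the output at the end.
\<close>

datatype move = Left | Stay | Right

record dtm =
  tapes :: nat
  states :: nat
  symbols :: nat
  trans :: "nat \<Rightarrow> nat list \<Rightarrow> nat \<times> (nat \<times> move) list"

definition wf_dtm :: "dtm \<Rightarrow> bool" where
  "wf_dtm M \<longleftrightarrow> tapes M \<ge> 2 \<and> states M \<ge> 3 \<and> symbols M \<ge> 3 \<and>
     (\<forall>q ss. q < states M \<longrightarrow> length ss = tapes M \<longrightarrow> set ss \<subseteq> {..<symbols M} \<longrightarrow>
        fst (trans M q ss) < states M \<and>
        length (snd (trans M q ss)) = tapes M \<and>
        fst ` set (snd (trans M q ss)) \<subseteq> {..<symbols M})"

text \<open>A tape consists of its contents and its head position.\<close>

type_synonym tape = "(int \<Rightarrow> nat) \<times> int"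
type_synonym config = "nat \<times> tape list"

fun move_head :: "move \<Rightarrow> int \<Rightarrow> int" where
  "move_head Left h = h - 1"
| "move_head Stay h = h"
| "move_head Right h = h + 1"

fun act :: "nat \<times> move \<Rightarrow> tape \<Rightarrow> tape" where
  "act (s, d) (t, h) = (t(h := s), move_head d h)"

fun step :: "dtm \<Rightarrow> config \<Rightarrow> config" where
  "step M (q, ts) =
     (if q = 1 \<or> q = 2 then (q, ts)
      else case trans M q (map (\<lambda>(t, h). t h) ts) of (q', as) \<Rightarrow> (q', map2 act as ts))"

definition word_tape :: "word \<Rightarrow> int \<Rightarrow> nat" where
  "word_tape x i =
     (if 0 \<le> i \<and> i < int (length x) then (if x ! nat i then 2 else 1) else 0)"

definition init :: "dtm \<Rightarrow> word \<Rightarrow> config" where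
  "init M x = (0, (word_tape x, 0) # replicate (tapes M - 1) (word_tape [], 0))"

text \<open>
  A partial function is computed by a machine that halts on every input within the time bound,
  rejecting exactly the inputs outside of the domain. Halting configurations are fixed points of
  \<^const>\<open>step\<close>, so it suffices to look at the configuration after all available steps.
\<close>

definition computes_in_time :: "dtm \<Rightarrow> (word \<rightharpoonup> word) \<Rightarrow> (nat \<Rightarrow> nat) \<Rightarrow> bool" where
  "computes_in_time M f T \<longleftrightarrow>
     (\<forall>x. case (step M ^^ T (length x)) (init M x) of (q, ts) \<Rightarrow>
        (case f x of Some y \<Rightarrow> q = 1 \<and> fst (ts ! 1) = word_tape y | None \<Rightarrow> q = 2))"

definition poly_time :: "(word \<rightharpoonup> word) \<Rightarrow> bool" where
  "poly_time f \<longleftrightarrow> (\<exists>M (p :: nat poly). wf_dtm M \<and> computes_in_time M f (poly p))"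

definition poly_balanced :: "(word \<rightharpoonup> word) \<Rightarrow> bool" where
  "poly_balanced f \<longleftrightarrow> (\<exists>p :: nat poly. \<forall>x y. f x = Some y \<longrightarrow>
     length y \<le> poly p (length x) \<and> length x \<le> poly p (length y))"

definition fP :: "(word \<rightharpoonup> word) set" where
  "fP = {f. poly_balanced f \<and> poly_time f}"


section \<open>Right-ideal morphisms and bounded end-equivalence\<close>

definition ideal_morphism :: "(word \<rightharpoonup> word) \<Rightarrow> bool" where
  "ideal_morphism h \<longleftrightarrow> right_ideal (dom h) \<and>
     (\<forall>x\<in>dom h. \<forall>w. h (x @ w) = Some (the (h x) @ w))"

definition domC :: "(word \<rightharpoonup> word) \<Rightarrow> word set" where
  "domC h = code_of (dom h)"

definition imC :: "(word \<rightharpoonup> word) \<Rightarrow> word set" where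
  "imC h = code_of (ran h)"

definition RMP :: "(word \<rightharpoonup> word) monoid" where
  "RMP = \<lparr>carrier = {f \<in> fP. ideal_morphism f}, mult = (\<circ>\<^sub>m), one = Some\<rparr>"

definition bd_equiv :: "(word \<rightharpoonup> word) \<Rightarrow> (word \<rightharpoonup> word) \<Rightarrow> bool" where
  "bd_equiv f g \<longleftrightarrow> bd_equiv_code (domC f) (domC g) \<and> (\<forall>x \<in> dom f \<inter> dom g. f x = g x)"

definition bd_class :: "(word \<rightharpoonup> word) \<Rightarrow> (word \<rightharpoonup> word) set" where
  "bd_class f = {g \<in> carrier RMP. bd_equiv g f}"

text \<open>
  Since \<^const>\<open>bd_equiv\<close> is a congruence on \<^const>\<open>RMP\<close>, the union in the product ranges over copies
  of one and the same class.
\<close>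

definition MbdP :: "(word \<rightharpoonup> word) set monoid" where
  "MbdP = \<lparr>carrier = bd_class ` carrier RMP,
           mult = (\<lambda>X Y. \<Union>f\<in>X. \<Union>g\<in>Y. bd_class (f \<otimes>\<^bsub>RMP\<^esub> g)),
           one = bd_class \<one>\<^bsub>RMP\<^esub>\<rparr>"


section \<open>Green's relations\<close>

definition L_le :: "('a, 'b) monoid_scheme \<Rightarrow> 'a \<Rightarrow> 'a \<Rightarrow> bool" where
  "L_le M t s \<longleftrightarrow> (\<exists>m\<in>carrier M. t = m \<otimes>\<^bsub>M\<^esub> s)"

definition R_le :: "('a, 'b) monoid_scheme \<Rightarrow> 'a \<Rightarrow> 'a \<Rightarrow> bool" where
  "R_le M v u \<longleftrightarrow> (\<exists>n\<in>carrier M. v = u \<otimes>\<^bsub>M\<^esub> n)"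

definition L_equiv :: "('a, 'b) monoid_scheme \<Rightarrow> 'a \<Rightarrow> 'a \<Rightarrow> bool" where
  "L_equiv M x y \<longleftrightarrow> L_le M x y \<and> L_le M y x"

definition R_equiv :: "('a, 'b) monoid_scheme \<Rightarrow> 'a \<Rightarrow> 'a \<Rightarrow> bool" where
  "R_equiv M x y \<longleftrightarrow> R_le M x y \<and> R_le M y x"

definition D_equiv :: "('a, 'b) monoid_scheme \<Rightarrow> 'a \<Rightarrow> 'a \<Rightarrow> bool" where
  "D_equiv M x y \<longleftrightarrow> (\<exists>z\<in>carrier M. R_equiv M x z \<and> L_equiv M z y)"

definition D_class :: "('a, 'b) monoid_scheme \<Rightarrow> 'a \<Rightarrow> 'a set" where
  "D_class M x = {y \<in> carrier M. D_equiv M x y}"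

definition D_classes :: "('a, 'b) monoid_scheme \<Rightarrow> 'a set set" where
  "D_classes M = D_class M ` carrier M"

end

theory Submission
  imports Defs "HOL-Library.Nat_Bijection"
begin

text \<open>
  Bounded equivalence forgets complexity. A morphism \<open>h\<close> may be restricted to the words \<open>x w\<close> with \<open>x\<close>
  in its domain code and \<open>w\<close> as long as one likes in terms of \<open>x\<close>, without leaving its class. If \<open>h\<close> is
  computable with decidable domain, then taking \<open>w\<close> longer than the running time on \<open>x\<close> puts the restriction
  into polynomial time, and makes it polynomially balanced (\<open>padding\<close>). Products of classes may be
  computed with arbitrary representatives (\<open>bd_equiv_comp\<close>), so a relation between classes in the
  orders \<open>\<le>\<^sub>L\<close> and \<open>\<le>\<^sub>R\<close> need only be witnessed by a computable ideal morphism (\<open>L_leI\<close>, \<open>R_leI\<close>).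

  Given \<open>f\<close> and \<open>g\<close>, choose prefix codes \<open>Y\<close> and \<open>Z\<close> inside the images of \<open>f\<close> and \<open>g\<close> that generate these
  images up to padding, with computable right inverses of \<open>f\<close> on \<open>Y\<close> and of \<open>g\<close> on \<open>Z\<close>, and a bijection \<open>\<tau>\<close>
  from \<open>Y\<close> to \<open>Z\<close> that is computable in both directions. All of these extend to right-ideal morphisms, and
  \<open>z = \<tau>\<inverse> g\<close> has the image of \<open>f\<close> and the kernel of \<open>g\<close>; hence \<open>f\<close> is R-equivalent to \<open>z\<close>, which is
  L-equivalent to \<open>g\<close> (\<open>D_equivI\<close>). If both image codes are finite and nonempty, then \<open>Y\<close> and \<open>Z\<close> are made
  equally large by replacing words \<open>y\<close> with \<open>y0\<close> and \<open>y1\<close>, and all maps are finite tables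
  (\<open>D_equiv_finite\<close>). If both are infinite, then \<open>\<tau>\<close> matches the words of equal rank in two decidable
  codes (\<open>D_equiv_infinite\<close>).

  Conversely, finiteness of the image code depends only on the D-class (\<open>D_equiv_finite_imC\<close>).
  R-equivalent morphisms have images that contain one another up to padding; and if \<open>f\<close> and \<open>g\<close> are
  L-equivalent, then \<open>g\<close> is \<open>h' f\<close> up to equivalence, where \<open>h'\<close> is defined on nearly all of the image of \<open>f\<close>,
  so that finitely many words generate the image of \<open>h' f\<close> if finitely many generate that of \<open>f\<close>.

  Computability is developed through counter programs, which are easy to run on a Turing machine: a
  counter is a tape whose head position is the value. The functions on the naturals that they compute are
  closed under composition, primitive recursion and minimisation, and this suffices to simulate the
  machines of the given polynomial-time functions arithmetically (\<open>fP_computable\<close>).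
\<close>

section \<open>Counter programs\<close>

text \<open>
  Programs act on counters. In addition they read a stream of letters (the instruction \<open>Read r\<close> adds the next
  letter to counter \<open>r\<close>) and write letters to an output word.
\<close>

datatype com = Inc nat | Dec nat | Read nat | Out nat
  | Seq com com (infixr ";;" 60) | Cond nat com com | While nat com

text \<open>
  The counters, the number of letters read, and the output so far.
\<close>

type_synonym store = "(nat \<Rightarrow> nat) \<times> nat \<times> word"

text \<open>
  Small steps on a list of pending commands, each of which inspects or changes the store in one place only,
  so that a Turing machine can follow step by step.
\<close>

fun exec1 :: "(nat \<Rightarrow> bool) \<Rightarrow> com list \<times> store \<Rightarrow> com list \<times> store" where
  "exec1 s ([], st) = ([], st)"
| "exec1 s (Inc r # k, (\<sigma>, p, u)) = (k, (\<sigma>(r := Suc (\<sigma> r)), p, u))"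
| "exec1 s (Dec r # k, (\<sigma>, p, u)) = (k, (\<sigma>(r := \<sigma> r - 1), p, u))"
| "exec1 s (Read r # k, (\<sigma>, p, u)) = (k, (\<sigma>(r := \<sigma> r + of_bool (s p)), Suc p, u))"
| "exec1 s (Out r # k, (\<sigma>, p, u)) = (k, (\<sigma>, p, u @ [\<sigma> r \<noteq> 0]))"
| "exec1 s (Seq a b # k, st) = (a # b # k, st)"
| "exec1 s (Cond r a b # k, st) = ((if fst st r \<noteq> 0 then a else b) # k, st)"
| "exec1 s (While r a # k, st) = (if fst st r \<noteq> 0 then a # While r a # k else k, st)"

text \<open>
  Quantifying over the pending commands makes \<^term>\<open>runs\<close> compositional for sequencing and loops.
\<close>

definition runs :: "(nat \<Rightarrow> bool) \<Rightarrow> com \<Rightarrow> store \<Rightarrow> store \<Rightarrow> bool" where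
  "runs s c st st' \<longleftrightarrow> (\<forall>k. \<exists>n. (exec1 s ^^ n) (c # k, st) = (k, st'))"

lemma runs_step: "(\<And>k. exec1 s (c # k, st) = (k, st')) \<Longrightarrow> runs s c st st'"
  unfolding runs_def by (metis funpow_0 funpow_simps_right(2) comp_apply One_nat_def)

lemma runs_trans_step:
  assumes "\<And>k. exec1 s (c # k, st) = (c' # k, st')" "runs s c' st' st''"
  shows "runs s c st st''"
  unfolding runs_def
proof
  fix k
  obtain n where "(exec1 s ^^ n) (c' # k, st') = (k, st'')"
    using assms(2) unfolding runs_def by blast
  then have "(exec1 s ^^ Suc n) (c # k, st) = (k, st'')"
    by (simp only: funpow_Suc_right comp_apply assms(1))
  then show "\<exists>n. (exec1 s ^^ n) (c # k, st) = (k, st'')" by blast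
qed

lemma runs_two:
  assumes "\<And>k. exec1 s (c # k, st) = (a # b # k, st)" "runs s a st st1" "runs s b st1 st2"
  shows "runs s c st st2"
  unfolding runs_def
proof
  fix k
  obtain n where n: "(exec1 s ^^ n) (a # b # k, st) = (b # k, st1)"
    using assms(2) unfolding runs_def by blast
  obtain m where m: "(exec1 s ^^ m) (b # k, st1) = (k, st2)"
    using assms(3) unfolding runs_def by blast
  have "(exec1 s ^^ (m + Suc n)) (c # k, st) = (k, st2)"
    by (simp only: funpow_add funpow_Suc_right comp_apply assms(1) n m)
  then show "\<exists>n. (exec1 s ^^ n) (c # k, st) = (k, st2)" by blast
qed

lemma runs_Seq: "runs s a st st1 \<Longrightarrow> runs s b st1 st2 \<Longrightarrow> runs s (a ;; b) st st2"
  by (rule runs_two[of s _ st a b]) auto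

lemma runs_Cond: "runs s (if fst st r \<noteq> 0 then a else b) st st' \<Longrightarrow> runs s (Cond r a b) st st'"
  by (rule runs_trans_step[rotated], assumption) simp

lemma runs_While_0: "fst st r = 0 \<Longrightarrow> runs s (While r a) st st"
  by (rule runs_step) simp

lemma runs_While_Suc:
  "fst st r \<noteq> 0 \<Longrightarrow> runs s a st st1 \<Longrightarrow> runs s (While r a) st1 st2 \<Longrightarrow> runs s (While r a) st st2"
  by (rule runs_two[of s _ st a "While r a"]) auto

definition creg :: "com \<Rightarrow> (nat \<Rightarrow> nat) \<Rightarrow> (nat \<Rightarrow> nat) \<Rightarrow> bool" where
  "creg c \<sigma> \<sigma>' \<longleftrightarrow> (\<forall>s p u. runs s c (\<sigma>, p, u) (\<sigma>', p, u))"

lemma creg_Inc: "\<sigma>' = \<sigma>(r := Suc (\<sigma> r)) \<Longrightarrow> creg (Inc r) \<sigma> \<sigma>'"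
  unfolding creg_def by (auto intro: runs_step)
lemma creg_Dec: "\<sigma>' = \<sigma>(r := \<sigma> r - 1) \<Longrightarrow> creg (Dec r) \<sigma> \<sigma>'"
  unfolding creg_def by (auto intro: runs_step)
lemma creg_Seq: "creg a \<sigma> \<sigma>1 \<Longrightarrow> creg b \<sigma>1 \<sigma>2 \<Longrightarrow> creg (a ;; b) \<sigma> \<sigma>2"
  unfolding creg_def by (blast intro: runs_Seq)
lemma creg_Cond: "creg (if \<sigma> r \<noteq> 0 then a else b) \<sigma> \<sigma>' \<Longrightarrow> creg (Cond r a b) \<sigma> \<sigma>'"
  unfolding creg_def by (auto intro!: runs_Cond)
lemma creg_While_0: "\<sigma> r = 0 \<Longrightarrow> creg (While r a) \<sigma> \<sigma>"
  unfolding creg_def by (auto intro: runs_While_0)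
lemma creg_While_Suc:
  "\<sigma> r \<noteq> 0 \<Longrightarrow> creg a \<sigma> \<sigma>1 \<Longrightarrow> creg (While r a) \<sigma>1 \<sigma>2 \<Longrightarrow> creg (While r a) \<sigma> \<sigma>2"
  unfolding creg_def by (metis runs_While_Suc fst_conv)

definition clear :: "nat \<Rightarrow> com" where
  "clear a = While a (Dec a)"

lemma creg_clear: "\<sigma>' = \<sigma>(a := 0) \<Longrightarrow> creg (clear a) \<sigma> \<sigma>'"
proof (induction "\<sigma> a" arbitrary: \<sigma>)
  case 0
  then have "\<sigma>' = \<sigma>" by (simp add: fun_upd_idem)
  then show ?case unfolding clear_def using 0 creg_While_0 by simp
next
  case (Suc n)
  have "creg (clear a) (\<sigma>(a := \<sigma> a - 1)) \<sigma>'"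
    by (rule Suc.hyps(1)) (use Suc.hyps(2)[symmetric] Suc.prems in auto)
  then show ?case unfolding clear_def
    by - (rule creg_While_Suc[OF _ creg_Dec[OF refl]], use Suc.hyps(2) in simp, assumption)
qed

definition add2 :: "nat \<Rightarrow> nat \<Rightarrow> nat \<Rightarrow> com" where
  "add2 a b c = While a (Dec a ;; Inc b ;; Inc c)"

lemma creg_add2:
  assumes "distinct [a, b, c]" "\<sigma>' = \<sigma>(a := 0, b := \<sigma> b + \<sigma> a, c := \<sigma> c + \<sigma> a)"
  shows "creg (add2 a b c) \<sigma> \<sigma>'"
  using assms
proof (induction "\<sigma> a" arbitrary: \<sigma>)
  case 0
  then have "\<sigma>' = \<sigma>" by (simp add: fun_upd_idem)
  then show ?case unfolding add2_def using 0 creg_While_0 by simp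
next
  case (Suc n)
  let ?\<sigma> = "\<sigma>(a := \<sigma> a - 1, b := Suc (\<sigma> b), c := Suc (\<sigma> c))"
  have "creg (add2 a b c) ?\<sigma> \<sigma>'"
    by (rule Suc.hyps(1)) (use Suc.hyps(2)[symmetric] Suc.prems in \<open>auto simp: fun_eq_iff\<close>)
  moreover have "creg (Dec a ;; Inc b ;; Inc c) \<sigma> ?\<sigma>"
    by (intro creg_Seq[OF creg_Dec[OF refl]] creg_Seq[OF creg_Inc[OF refl]] creg_Inc)
      (use Suc.prems(1) in \<open>auto simp: fun_eq_iff\<close>)
  ultimately show ?case unfolding add2_def
    by - (rule creg_While_Suc, use Suc.hyps(2) in simp, assumption, assumption)
qed

definition move :: "nat \<Rightarrow> nat \<Rightarrow> com" where
  "move a b = While a (Dec a ;; Inc b)"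

lemma creg_move:
  assumes "a \<noteq> b" "\<sigma>' = \<sigma>(a := 0, b := \<sigma> b + \<sigma> a)"
  shows "creg (move a b) \<sigma> \<sigma>'"
  using assms
proof (induction "\<sigma> a" arbitrary: \<sigma>)
  case 0
  then have "\<sigma>' = \<sigma>" by (simp add: fun_upd_idem)
  then show ?case unfolding move_def using 0 creg_While_0 by simp
next
  case (Suc n)
  let ?\<sigma> = "\<sigma>(a := \<sigma> a - 1, b := Suc (\<sigma> b))"
  have "creg (move a b) ?\<sigma> \<sigma>'"
    by (rule Suc.hyps(1)) (use Suc.hyps(2)[symmetric] Suc.prems in \<open>auto simp: fun_eq_iff\<close>)
  moreover have "creg (Dec a ;; Inc b) \<sigma> ?\<sigma>"
    by (intro creg_Seq[OF creg_Dec[OF refl]] creg_Inc)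
      (use Suc.prems(1) in \<open>auto simp: fun_eq_iff\<close>)
  ultimately show ?case unfolding move_def
    by - (rule creg_While_Suc, use Suc.hyps(2) in simp, assumption, assumption)
qed

definition copy :: "nat \<Rightarrow> nat \<Rightarrow> nat \<Rightarrow> com" where
  "copy a b t = clear b ;; clear t ;; add2 a b t ;; move t a"

lemma creg_copy:
  assumes "distinct [a, b, t]" "\<sigma>' = \<sigma>(b := \<sigma> a, t := 0)"
  shows "creg (copy a b t) \<sigma> \<sigma>'"
  unfolding copy_def
  by (intro creg_Seq[OF creg_clear[OF refl]] creg_Seq[OF creg_add2[OF assms(1) refl]] creg_move)
    (use assms in \<open>auto simp: fun_eq_iff\<close>)

section \<open>Functions computed by counter programs\<close>

abbreviation pr :: "nat \<Rightarrow> nat \<Rightarrow> nat" where "pr a b \<equiv> prod_encode (a, b)"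
abbreviation p1 :: "nat \<Rightarrow> nat" where "p1 x \<equiv> fst (prod_decode x)"
abbreviation p2 :: "nat \<Rightarrow> nat" where "p2 x \<equiv> snd (prod_decode x)"

text \<open>
  A program that works upwards from register \<open>a\<close>: input and result are in \<open>a\<close>, lower registers survive, and
  higher ones are scratch space. Asking for such a program for every \<open>a\<close> makes fresh registers available
  wherever programs are combined.
\<close>

definition implements :: "nat \<Rightarrow> com \<Rightarrow> (nat \<Rightarrow> nat) \<Rightarrow> bool" where
  "implements a c F \<longleftrightarrow> (\<forall>\<sigma>. \<exists>\<sigma>'. creg c \<sigma> \<sigma>' \<and> \<sigma>' a = F (\<sigma> a) \<and> (\<forall>r<a. \<sigma>' r = \<sigma> r))"

definition computable :: "(nat \<Rightarrow> nat) \<Rightarrow> bool" where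
  "computable F \<longleftrightarrow> (\<forall>a. \<exists>c. implements a c F)"

lemma computableE: assumes "computable F" obtains c where "implements a c F"
  using assms unfolding computable_def by blast

lemma implementsD:
  "implements a c F \<Longrightarrow> \<exists>\<sigma>'. creg c \<sigma> \<sigma>' \<and> \<sigma>' a = F (\<sigma> a) \<and> (\<forall>r<a. \<sigma>' r = \<sigma> r)"
  unfolding implements_def by blast

lemma computableI:
  assumes "\<And>a. \<exists>c. \<forall>\<sigma>. \<exists>\<sigma>'. creg c \<sigma> \<sigma>' \<and> \<sigma>' a = F (\<sigma> a) \<and> (\<forall>r<a. \<sigma>' r = \<sigma> r)"
  shows "computable F"
  using assms unfolding computable_def implements_def by blast

lemma computableI_exact:
  assumes "\<And>a \<sigma>. creg (c a) \<sigma> (\<sigma>(a := F (\<sigma> a)))"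
  shows "computable F"
proof (rule computableI, intro exI allI)
  fix a \<sigma>
  show "creg (c a) \<sigma> (\<sigma>(a := F (\<sigma> a))) \<and> (\<sigma>(a := F (\<sigma> a))) a = F (\<sigma> a) \<and>
      (\<forall>r<a. (\<sigma>(a := F (\<sigma> a))) r = \<sigma> r)"
    using assms by simp
qed

lemma computable_zero: "computable (\<lambda>_. 0)"
  by (rule computableI_exact[where c = clear]) (rule creg_clear[OF refl])

lemma computable_Suc_fun: "computable Suc"
  by (rule computableI_exact[where c = Inc]) (rule creg_Inc[OF refl])

lemma computable_id: "computable (\<lambda>x. x)"
  by (rule computableI_exact[where c = "\<lambda>a. Inc a ;; Dec a"]) (rule creg_Seq[OF creg_Inc[OF refl] creg_Dec], simp)

lemma computable_comp: assumes "computable F" "computable G" shows "computable (\<lambda>x. F (G x))"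
proof (rule computableI)
  fix a :: nat
  obtain c where c: "implements a c F" using assms(1) by (rule computableE)
  obtain d where d: "implements a d G" using assms(2) by (rule computableE)
  have "\<exists>\<sigma>'. creg (d ;; c) \<sigma> \<sigma>' \<and> \<sigma>' a = F (G (\<sigma> a)) \<and> (\<forall>r<a. \<sigma>' r = \<sigma> r)" for \<sigma>
  proof -
    obtain \<sigma>1 where 1: "creg d \<sigma> \<sigma>1" "\<sigma>1 a = G (\<sigma> a)" "\<And>r. r < a \<Longrightarrow> \<sigma>1 r = \<sigma> r"
      using implementsD[OF d] by blast
    obtain \<sigma>2 where 2: "creg c \<sigma>1 \<sigma>2" "\<sigma>2 a = F (\<sigma>1 a)" "\<And>r. r < a \<Longrightarrow> \<sigma>2 r = \<sigma>1 r"
      using implementsD[OF c] by blast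
    show ?thesis using creg_Seq[OF 1(1) 2(1)] 1 2 by auto
  qed
  then show "\<exists>c. \<forall>\<sigma>. \<exists>\<sigma>'. creg c \<sigma> \<sigma>' \<and> \<sigma>' a = F (G (\<sigma> a)) \<and> (\<forall>r<a. \<sigma>' r = \<sigma> r)"
    by blast
qed

text \<open>
  This follows the formula \<open>triangle (b + c) + b\<close> of \<^const>\<open>prod_encode\<close>: the loop adds up the triangular
  number by decreasing \<open>c\<close> from \<open>b + c\<close> to 0.
\<close>

definition pairing :: "nat \<Rightarrow> nat \<Rightarrow> nat \<Rightarrow> com" where
  "pairing a b c = clear a ;; add2 b c a ;;
     While c (Dec c ;; Inc a ;; move c b ;; add2 b c a)"

lemma creg_pairing:
  assumes d: "distinct [a, b, c]"
  shows "creg (pairing a b c) \<sigma> (\<sigma>(a := pr (\<sigma> b) (\<sigma> c), b := 0, c := 0))"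
proof -
  have loop: "creg (While c (Dec c ;; Inc a ;; move c b ;; add2 b c a)) \<sigma> \<sigma>'"
    if "\<sigma> b = 0" "\<sigma>' = \<sigma>(a := \<sigma> a + triangle (\<sigma> c), c := 0)" for \<sigma> \<sigma>'
    using that
  proof (induction "\<sigma> c" arbitrary: \<sigma>)
    case 0
    then have "\<sigma>' = \<sigma>" by (simp add: fun_upd_idem)
    then show ?case using 0 creg_While_0 by simp
  next
    case (Suc n)
    let ?\<sigma> = "\<sigma>(c := n, a := \<sigma> a + Suc n)"
    have "creg (Dec c ;; Inc a ;; move c b ;; add2 b c a) \<sigma> ?\<sigma>"
      by (intro creg_Seq[OF creg_Dec[OF refl]] creg_Seq[OF creg_Inc[OF refl]]
          creg_Seq[OF creg_move[OF _ refl]] creg_add2)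
        (use Suc.hyps(2)[symmetric] Suc.prems d in \<open>auto simp: fun_eq_iff\<close>)
    moreover have "creg (While c (Dec c ;; Inc a ;; move c b ;; add2 b c a)) ?\<sigma> \<sigma>'"
      by (rule Suc.hyps(1)) (use Suc.hyps(2)[symmetric] Suc.prems d in \<open>auto simp: fun_eq_iff\<close>)
    ultimately show ?case by - (rule creg_While_Suc, use Suc.hyps(2) in simp, assumption, assumption)
  qed
  show ?thesis unfolding pairing_def
    by (intro creg_Seq[OF creg_clear[OF refl]] creg_Seq[OF creg_add2[OF _ refl]] loop)
      (use d in \<open>auto simp: fun_eq_iff prod_encode_def add.commute\<close>)
qed

lemma computable_pr: assumes "computable F" "computable G" shows "computable (\<lambda>x. pr (F x) (G x))"
proof (rule computableI)
  fix a :: nat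
  obtain f where f: "implements (a + 1) f F" using assms(1) by (rule computableE)
  obtain g where g: "implements (a + 2) g G" using assms(2) by (rule computableE)
  let ?c = "copy a (a + 1) (a + 2) ;; f ;; copy a (a + 2) (a + 3) ;; g ;; pairing a (a + 1) (a + 2)"
  have "\<exists>\<sigma>'. creg ?c \<sigma> \<sigma>' \<and> \<sigma>' a = pr (F (\<sigma> a)) (G (\<sigma> a)) \<and> (\<forall>r<a. \<sigma>' r = \<sigma> r)" for \<sigma>
  proof -
    let ?s0 = "\<sigma>(a + 1 := \<sigma> a, a + 2 := 0)"
    obtain s1 where 1: "creg f ?s0 s1" "s1 (a + 1) = F (?s0 (a + 1))" "\<And>r. r < a + 1 \<Longrightarrow> s1 r = ?s0 r"
      using implementsD[OF f] by blast
    let ?s2 = "s1(a + 2 := s1 a, a + 3 := 0)"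
    obtain s3 where 3: "creg g ?s2 s3" "s3 (a + 2) = G (?s2 (a + 2))" "\<And>r. r < a + 2 \<Longrightarrow> s3 r = ?s2 r"
      using implementsD[OF g] by blast
    have c: "creg ?c \<sigma> (s3(a := pr (s3 (a + 1)) (s3 (a + 2)), a + 1 := 0, a + 2 := 0))"
      by (rule creg_Seq[OF creg_copy[OF _ refl] creg_Seq[OF 1(1) creg_Seq[OF creg_copy[OF _ refl] creg_Seq[OF 3(1) creg_pairing]]]])
        auto
    show ?thesis
      by (rule exI, rule conjI[OF c]) (use 1(2,3) 3(2,3) in auto)
  qed
  then show "\<exists>c. \<forall>\<sigma>. \<exists>\<sigma>'. creg c \<sigma> \<sigma>' \<and> \<sigma>' a = pr (F (\<sigma> a)) (G (\<sigma> a)) \<and> (\<forall>r<a. \<sigma>' r = \<sigma> r)"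
    by blast
qed

text \<open>
  Counting up through the pairs in the order of their codes, one step for each unit of \<open>a\<close>.
\<close>

definition unpairing :: "nat \<Rightarrow> nat \<Rightarrow> nat \<Rightarrow> com" where
  "unpairing a b c = clear b ;; clear c ;;
     While a (Dec a ;; Cond c (Inc b ;; Dec c) (Inc c ;; move b c))"

lemma creg_unpairing:
  assumes d: "distinct [a, b, c]"
  shows "creg (unpairing a b c) \<sigma> (\<sigma>(a := 0, b := p1 (\<sigma> a), c := p2 (\<sigma> a)))"
proof -
  let ?body = "Dec a ;; Cond c (Inc b ;; Dec c) (Inc c ;; move b c)"
  have loop: "creg (While a ?body) \<sigma> \<sigma>'"
    if "n = \<sigma> a" "(x, y) = prod_decode (pr (\<sigma> b) (\<sigma> c) + \<sigma> a)" "\<sigma>' = \<sigma>(a := 0, b := x, c := y)" for \<sigma> \<sigma>' n x y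
    using that
  proof (induction n arbitrary: \<sigma>)
    case 0
    then have "\<sigma>' = \<sigma>" by (auto simp: fun_eq_iff)
    then show ?case using creg_While_0[of \<sigma> a] 0(1) by simp
  next
    case (Suc n)
    let ?\<sigma> = "if \<sigma> c = 0 then \<sigma>(a := n, b := 0, c := Suc (\<sigma> b)) else \<sigma>(a := n, b := Suc (\<sigma> b), c := \<sigma> c - 1)"
    have "creg ?body \<sigma> ?\<sigma>"
    proof (cases "\<sigma> c = 0")
      case True
      then show ?thesis
        using d Suc.prems by (intro creg_Seq[OF creg_Dec[OF refl]] creg_Cond)
          (auto intro!: creg_Seq[OF creg_Inc[OF refl] creg_move] simp: fun_eq_iff)
    next
      case False
      then show ?thesis
        using d Suc.prems by (intro creg_Seq[OF creg_Dec[OF refl]] creg_Cond)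
          (auto intro!: creg_Seq[OF creg_Inc[OF refl] creg_Dec] simp: fun_eq_iff)
    qed
    moreover have "creg (While a ?body) ?\<sigma> \<sigma>'"
    proof (rule Suc.IH)
      have "pr (\<sigma> b) (\<sigma> c) + \<sigma> a = pr (?\<sigma> b) (?\<sigma> c) + ?\<sigma> a"
        using d Suc.prems(1) by (cases "\<sigma> c") (auto simp: prod_encode_def simp flip: Suc.prems(1))
      then show "(x, y) = prod_decode (pr (?\<sigma> b) (?\<sigma> c) + ?\<sigma> a)"
        using Suc.prems by simp
    qed (use Suc.prems d in \<open>auto simp: fun_eq_iff\<close>)
    ultimately show ?case by - (rule creg_While_Suc, use Suc.prems in simp, assumption, assumption)
  qed
  show ?thesis unfolding unpairing_def
    by (intro creg_Seq[OF creg_clear[OF refl]] loop[OF refl, where x = "p1 (\<sigma> a)" and y = "p2 (\<sigma> a)"])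
      (use d in \<open>auto simp: fun_eq_iff prod_encode_def\<close>)
qed

lemma computable_p1_fun: "computable p1"
proof (rule computableI, intro exI allI)
  fix a \<sigma>
  show "creg (unpairing a (a + 1) (a + 2) ;; move (a + 1) a) \<sigma> (\<sigma>(a := p1 (\<sigma> a), a + 1 := 0, a + 2 := p2 (\<sigma> a))) \<and>
    (\<sigma>(a := p1 (\<sigma> a), a + 1 := 0, a + 2 := p2 (\<sigma> a))) a = p1 (\<sigma> a) \<and>
    (\<forall>r<a. (\<sigma>(a := p1 (\<sigma> a), a + 1 := 0, a + 2 := p2 (\<sigma> a))) r = \<sigma> r)"
    by (auto intro!: creg_Seq[OF creg_unpairing creg_move] simp: fun_eq_iff)
qed

lemma computable_p2_fun: "computable p2"
proof (rule computableI, intro exI allI)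
  fix a \<sigma>
  show "creg (unpairing a (a + 1) (a + 2) ;; move (a + 2) a) \<sigma> (\<sigma>(a := p2 (\<sigma> a), a + 1 := p1 (\<sigma> a), a + 2 := 0)) \<and>
    (\<sigma>(a := p2 (\<sigma> a), a + 1 := p1 (\<sigma> a), a + 2 := 0)) a = p2 (\<sigma> a) \<and>
    (\<forall>r<a. (\<sigma>(a := p2 (\<sigma> a), a + 1 := p1 (\<sigma> a), a + 2 := 0)) r = \<sigma> r)"
    by (auto intro!: creg_Seq[OF creg_unpairing creg_move] simp: fun_eq_iff)
qed

lemma computable_iter_fun: assumes "computable F" shows "computable (\<lambda>x. (F ^^ p1 x) (p2 x))"
proof (rule computableI)
  fix a :: nat
  obtain f where f: "implements (a + 2) f F" using assms(1) by (rule computableE)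
  let ?b = "a + 1" let ?c = "a + 2"
  let ?loop = "While ?b (Dec ?b ;; f)"
  have loop: "\<exists>\<sigma>'. creg ?loop \<sigma> \<sigma>' \<and> \<sigma>' ?c = (F ^^ n) (\<sigma> ?c) \<and> (\<forall>r<a. \<sigma>' r = \<sigma> r) \<and> \<sigma>' a = \<sigma> a"
    if "n = \<sigma> ?b" for \<sigma> n
    using that
  proof (induction n arbitrary: \<sigma>)
    case 0
    then show ?case using creg_While_0[of \<sigma> ?b] by force
  next
    case (Suc n)
    let ?s0 = "\<sigma>(?b := \<sigma> ?b - 1)"
    obtain s1 where 1: "creg f ?s0 s1" "s1 ?c = F (?s0 ?c)" "\<And>r. r < ?c \<Longrightarrow> s1 r = ?s0 r"
      using implementsD[OF f] by blast
    have n: "n = s1 ?b" using 1(3)[of ?b] Suc.prems by simp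
    from Suc.IH[of s1, OF n] obtain s2 where
      2: "creg ?loop s1 s2" "s2 ?c = (F ^^ n) (s1 ?c)" "\<forall>r<a. s2 r = s1 r" "s2 a = s1 a" by blast
    have "creg ?loop \<sigma> s2"
      by (rule creg_While_Suc[OF _ creg_Seq[OF creg_Dec[OF refl] 1(1)] 2(1)]) (use Suc.prems in auto)
    moreover have "s2 ?c = (F ^^ Suc n) (\<sigma> ?c)" using 1(2) 2(2) by (simp add: funpow_swap1)
    ultimately show ?case using 1(3) 2(3,4) by (intro exI[of _ s2]) auto
  qed
  let ?C = "unpairing a ?b ?c ;; ?loop ;; move ?c a"
  have "\<exists>\<sigma>'. creg ?C \<sigma> \<sigma>' \<and> \<sigma>' a = (F ^^ p1 (\<sigma> a)) (p2 (\<sigma> a)) \<and> (\<forall>r<a. \<sigma>' r = \<sigma> r)" for \<sigma>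
  proof -
    let ?s0 = "\<sigma>(a := 0, ?b := p1 (\<sigma> a), ?c := p2 (\<sigma> a))"
    obtain s1 where 1: "creg ?loop ?s0 s1" "s1 ?c = (F ^^ (?s0 ?b)) (?s0 ?c)" "\<forall>r<a. s1 r = ?s0 r" "s1 a = ?s0 a"
      using loop[OF refl, of ?s0] by blast
    have "creg ?C \<sigma> (s1(?c := 0, a := s1 a + s1 ?c))"
      by (rule creg_Seq[OF creg_unpairing creg_Seq[OF 1(1) creg_move]]) auto
    then show ?thesis using 1 by (intro exI[of _ "s1(?c := 0, a := s1 a + s1 ?c)"]) auto
  qed
  then show "\<exists>c. \<forall>\<sigma>. \<exists>\<sigma>'. creg c \<sigma> \<sigma>' \<and> \<sigma>' a = (F ^^ p1 (\<sigma> a)) (p2 (\<sigma> a)) \<and> (\<forall>r<a. \<sigma>' r = \<sigma> r)"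
    by blast
qed

text \<open>
  Termination is required only from the start values \<open>S x\<close>; this is what makes minimisation an instance,
  where the loop from \<open>(i, x)\<close> need not stop if \<open>i\<close> is past the last witness.
\<close>

lemma computable_while:
  assumes "computable F" "computable G" "computable S" and halts: "\<And>x. \<exists>n. F ((G ^^ n) (S x)) = 0"
  shows "computable (\<lambda>x. (G ^^ (LEAST n. F ((G ^^ n) (S x)) = 0)) (S x))"
proof (rule computableI)
  fix a :: nat
  let ?b = "a + 1"
  obtain f where f: "implements ?b f F" using assms(1) by (rule computableE)
  obtain g where g: "implements a g G" using assms(2) by (rule computableE)
  obtain h where h: "implements a h S" using assms(3) by (rule computableE)
  let ?test = "copy a ?b (a + 2) ;; f"
  let ?loop = "While ?b (g ;; ?test)"
  have test: "\<exists>\<sigma>'. creg ?test \<sigma> \<sigma>' \<and> \<sigma>' ?b = F (\<sigma> a) \<and> (\<forall>r\<le>a. \<sigma>' r = \<sigma> r)" for \<sigma>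
  proof -
    let ?s0 = "\<sigma>(?b := \<sigma> a, a + 2 := 0)"
    obtain s1 where 1: "creg f ?s0 s1" "s1 ?b = F (?s0 ?b)" "\<And>r. r < ?b \<Longrightarrow> s1 r = ?s0 r"
      using implementsD[OF f] by blast
    have "creg ?test \<sigma> s1" by (rule creg_Seq[OF creg_copy 1(1)]) auto
    then show ?thesis using 1(2,3) by (intro exI[of _ s1]) auto
  qed
  have loop: "\<exists>\<sigma>'. creg ?loop \<sigma> \<sigma>' \<and> \<sigma>' a = (G ^^ n) y \<and> (\<forall>r<a. \<sigma>' r = \<sigma> r)"
    if "\<sigma> ?b = F y" "\<sigma> a = y" "F ((G ^^ n) y) = 0" "\<forall>m<n. F ((G ^^ m) y) \<noteq> 0" for \<sigma> n y
    using that
  proof (induction n arbitrary: \<sigma> y)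
    case 0
    then show ?case using creg_While_0[of \<sigma> ?b] by force
  next
    case (Suc n)
    obtain s1 where 1: "creg g \<sigma> s1" "s1 a = G (\<sigma> a)" "\<And>r. r < a \<Longrightarrow> s1 r = \<sigma> r"
      using implementsD[OF g] by blast
    obtain s2 where 2: "creg ?test s1 s2" "s2 ?b = F (s1 a)" "\<forall>r\<le>a. s2 r = s1 r"
      using test by blast
    have "\<exists>\<sigma>'. creg ?loop s2 \<sigma>' \<and> \<sigma>' a = (G ^^ n) (G y) \<and> (\<forall>r<a. \<sigma>' r = s2 r)"
    proof (rule Suc.IH)
      show "\<forall>m<n. F ((G ^^ m) (G y)) \<noteq> 0"
      proof (intro allI impI)
        fix m assume "m < n"
        then show "F ((G ^^ m) (G y)) \<noteq> 0" using Suc.prems(4)[rule_format, of "Suc m"] by (simp add: funpow_swap1)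
      qed
    qed (use 1 2 Suc.prems in \<open>auto simp: funpow_swap1\<close>)
    then obtain s3 where 3: "creg ?loop s2 s3" "s3 a = (G ^^ n) (G y)" "\<forall>r<a. s3 r = s2 r" by blast
    have "\<sigma> ?b \<noteq> 0" using Suc.prems(1) Suc.prems(4)[rule_format, of 0] by simp
    then have "creg ?loop \<sigma> s3" by (rule creg_While_Suc[OF _ creg_Seq[OF 1(1) 2(1)] 3(1)])
    then show ?case using 1 2 3 by (intro exI[of _ s3]) (auto simp: funpow_swap1)
  qed
  let ?C = "h ;; ?test ;; ?loop"
  let ?n = "\<lambda>x. LEAST n. F ((G ^^ n) (S x)) = 0"
  have "\<exists>\<sigma>'. creg ?C \<sigma> \<sigma>' \<and> \<sigma>' a = (G ^^ ?n (\<sigma> a)) (S (\<sigma> a)) \<and> (\<forall>r<a. \<sigma>' r = \<sigma> r)" for \<sigma>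
  proof -
    obtain s1 where 1: "creg h \<sigma> s1" "s1 a = S (\<sigma> a)" "\<And>r. r < a \<Longrightarrow> s1 r = \<sigma> r"
      using implementsD[OF h] by blast
    obtain s2 where 2: "creg ?test s1 s2" "s2 ?b = F (s1 a)" "\<forall>r\<le>a. s2 r = s1 r"
      using test by blast
    have "\<exists>\<sigma>'. creg ?loop s2 \<sigma>' \<and> \<sigma>' a = (G ^^ ?n (\<sigma> a)) (S (\<sigma> a)) \<and> (\<forall>r<a. \<sigma>' r = s2 r)"
    proof (rule loop)
      show "F ((G ^^ ?n (\<sigma> a)) (S (\<sigma> a))) = 0" by (rule LeastI_ex) (rule halts)
    qed (use 1 2 in \<open>auto dest: not_less_Least\<close>)
    then obtain s3 where 3: "creg ?loop s2 s3" "s3 a = (G ^^ ?n (\<sigma> a)) (S (\<sigma> a))" "\<forall>r<a. s3 r = s2 r" by blast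
    have "creg ?C \<sigma> s3" by (rule creg_Seq[OF 1(1) creg_Seq[OF 2(1) 3(1)]])
    then show ?thesis using 1 2 3 by (intro exI[of _ s3]) auto
  qed
  then show "\<exists>c. \<forall>\<sigma>. \<exists>\<sigma>'. creg c \<sigma> \<sigma>' \<and> \<sigma>' a = (G ^^ ?n (\<sigma> a)) (S (\<sigma> a)) \<and> (\<forall>r<a. \<sigma>' r = \<sigma> r)"
    by blast
qed

section \<open>Closure properties of the computable functions\<close>

lemma computable_const: "computable (\<lambda>_. n)"
proof (induction n)
  case 0
  show ?case by (rule computable_zero)
next
  case (Suc n)
  show ?case using computable_comp[OF computable_Suc_fun Suc] .
qed

lemma computable_Suc: "computable F \<Longrightarrow> computable (\<lambda>x. Suc (F x))"
  by (rule computable_comp[OF computable_Suc_fun])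

lemma computable_p1: "computable F \<Longrightarrow> computable (\<lambda>x. p1 (F x))"
  by (rule computable_comp[OF computable_p1_fun])

lemma computable_p2: "computable F \<Longrightarrow> computable (\<lambda>x. p2 (F x))"
  by (rule computable_comp[OF computable_p2_fun])

text \<open>
  An iteration on triples that carry the index, the current value and the parameter.
\<close>

lemma computable_rec:
  assumes "computable N" "computable G" and H: "computable (\<lambda>y. H (p1 y) (p1 (p2 y)) (p2 (p2 y)))"
  shows "computable (\<lambda>x. rec_nat (G x) (\<lambda>i r. H i r x) (N x))"
proof -
  let ?S = "\<lambda>y. pr (Suc (p1 y)) (pr (H (p1 y) (p1 (p2 y)) (p2 (p2 y))) (p2 (p2 y)))"
  let ?I = "\<lambda>x. pr (N x) (pr 0 (pr (G x) x))"
  have it: "(?S ^^ n) (pr 0 (pr (G x) x)) = pr n (pr (rec_nat (G x) (\<lambda>i r. H i r x) n) x)" for n x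
    by (induction n) auto
  have S: "computable ?S"
    by (intro computable_pr computable_Suc computable_p1 computable_p2 computable_id H)
  have I: "computable ?I"
    by (intro computable_pr computable_const computable_id assms)
  have "computable (\<lambda>x. p1 (p2 ((?S ^^ p1 (?I x)) (p2 (?I x)))))"
    by (rule computable_p1, rule computable_p2, rule computable_comp[OF computable_iter_fun[OF S] I])
  then show ?thesis by (simp add: it)
qed

lemma computable_add: assumes "computable A" "computable B" shows "computable (\<lambda>x. A x + B x)"
proof -
  have "a + b = rec_nat b (\<lambda>i r. Suc r) a" for a b :: nat
    by (induction a) auto
  then show ?thesis
    by (simp only:) (intro computable_rec assms computable_Suc computable_p1 computable_p2 computable_id)
qed

lemma computable_mult: assumes "computable A" "computable B" shows "computable (\<lambda>x. A x * B x)"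
proof -
  have "a * b = rec_nat 0 (\<lambda>i r. r + b) a" for a b :: nat
    by (induction a) auto
  then show ?thesis
    by (simp only:)
      (intro computable_rec[where H = "\<lambda>i r x. r + B x"] assms(1) computable_const computable_add computable_p1 computable_p2 computable_id computable_comp[OF assms(2)])
qed

lemma computable_power: assumes "computable A" "computable B" shows "computable (\<lambda>x. A x ^ B x)"
proof -
  have "a ^ b = rec_nat 1 (\<lambda>i r. r * a) b" for a b :: nat
    by (induction b) auto
  then show ?thesis
    by (simp only:)
      (intro computable_rec[where H = "\<lambda>i r x. r * A x"] assms(2) computable_const computable_mult computable_p1 computable_p2 computable_id computable_comp[OF assms(1)])
qed

lemma computable_diff: assumes "computable A" "computable B" shows "computable (\<lambda>x. A x - B x)"
proof -
  have pred: "computable (\<lambda>x. F x - 1)" if "computable F" for F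
  proof -
    have "a - 1 = rec_nat 0 (\<lambda>i r. i) a" for a :: nat
      by (cases a) auto
    then show ?thesis
      by (simp only:) (intro computable_rec that computable_const computable_p1 computable_id)
  qed
  have "a - b = rec_nat a (\<lambda>i r. r - 1) b" for a b :: nat
    by (induction b) auto
  then have "(\<lambda>x. A x - B x) = (\<lambda>x. rec_nat (A x) (\<lambda>i r. r - 1) (B x))"
    by (rule ext)
  moreover have "computable (\<lambda>x. rec_nat (A x) (\<lambda>i r. r - 1) (B x))"
    by (intro computable_rec assms pred computable_p1 computable_p2 computable_id)
  ultimately show ?thesis by (simp only:)
qed

abbreviation decidable :: "(nat \<Rightarrow> bool) \<Rightarrow> bool" where
  "decidable P \<equiv> computable (\<lambda>x. of_bool (P x))"

lemma computable_if: assumes "decidable P" "computable A" "computable B" shows "computable (\<lambda>x. if P x then A x else B x)"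
proof -
  have "(if p then a else b) = of_bool p * a + (1 - of_bool p) * b" for p and a b :: nat by simp
  then show ?thesis
    by (simp only:) (intro computable_add computable_mult computable_diff computable_const assms)
qed

lemma decidable_not: assumes "decidable P" shows "decidable (\<lambda>x. \<not> P x)"
proof -
  have "of_bool (\<not> p) = 1 - (of_bool p :: nat)" for p by simp
  then show ?thesis by (simp only:) (intro computable_diff computable_const assms)
qed

lemma decidable_conj: assumes "decidable P" "decidable Q" shows "decidable (\<lambda>x. P x \<and> Q x)"
proof -
  have "of_bool (p \<and> q) = of_bool p * (of_bool q :: nat)" for p q by simp
  then show ?thesis by (simp only:) (intro computable_mult assms)
qed

lemma decidable_disj: assumes "decidable P" "decidable Q" shows "decidable (\<lambda>x. P x \<or> Q x)"
  using decidable_not[OF decidable_conj[OF decidable_not[OF assms(1)] decidable_not[OF assms(2)]]] by (simp only: de_Morgan_conj not_not)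

lemma decidable_le: assumes "computable A" "computable B" shows "decidable (\<lambda>x. A x \<le> B x)"
proof -
  have "of_bool (a \<le> b) = 1 - (a - b)" for a b :: nat by simp
  then show ?thesis by (simp only:) (intro computable_diff computable_const assms)
qed

lemma decidable_less: assumes "computable A" "computable B" shows "decidable (\<lambda>x. A x < B x)"
  using decidable_le[OF computable_Suc[OF assms(1)] assms(2)] by (simp only: Suc_le_eq)

lemma decidable_eq: assumes "computable A" "computable B" shows "decidable (\<lambda>x. A x = B x)"
  using decidable_conj[OF decidable_le[OF assms] decidable_le[OF assms(2,1)]] by (simp only: order_eq_iff)

text \<open>
  Binders are handled by pairing: the predicate is required to be computable as a function of the code of the
  bound variable and the parameter.
\<close>

lemma computable_Least:
  assumes P: "decidable (\<lambda>y. P (p1 y) (p2 y))" and ex: "\<And>x. \<exists>i. P i x"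
  shows "computable (\<lambda>x. LEAST i. P i x)"
proof -
  let ?F = "\<lambda>y. of_bool (\<not> P (p1 y) (p2 y)) :: nat"
  let ?G = "\<lambda>y. pr (Suc (p1 y)) (p2 y)"
  let ?S = "\<lambda>x. pr 0 x"
  have it: "(?G ^^ n) (?S x) = pr n x" for n x
    by (induction n) auto
  have "computable (\<lambda>x. (?G ^^ (LEAST n. ?F ((?G ^^ n) (?S x)) = 0)) (?S x))"
  proof (rule computable_while)
    show "computable ?F" by (rule decidable_not[OF P])
    show "computable ?G" by (intro computable_pr computable_Suc computable_p1 computable_p2 computable_id)
    show "computable ?S" by (intro computable_pr computable_const computable_id)
    show "\<exists>n. ?F ((?G ^^ n) (?S x)) = 0" for x
      using ex[of x] by (simp add: it)
  qed
  from computable_p1[OF this] show ?thesis by (simp add: it)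
qed

lemma decidable_bex:
  assumes "computable N" and P: "decidable (\<lambda>y. P (p1 y) (p2 y))"
  shows "decidable (\<lambda>x. \<exists>i<N x. P i x)"
proof -
  have eq: "(\<exists>i<n. Q i) \<longleftrightarrow> (LEAST i. n \<le> i \<or> Q i) < n" for n :: nat and Q
  proof
    assume "\<exists>i<n. Q i"
    then obtain i where "i < n" "Q i" by blast
    then show "(LEAST i. n \<le> i \<or> Q i) < n"
      using Least_le[of "\<lambda>i. n \<le> i \<or> Q i" i] by simp
  next
    assume l: "(LEAST i. n \<le> i \<or> Q i) < n"
    have "n \<le> (LEAST i. n \<le> i \<or> Q i) \<or> Q (LEAST i. n \<le> i \<or> Q i)"
      by (rule LeastI[of _ n]) simp
    with l show "\<exists>i<n. Q i" by auto
  qed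
  show ?thesis unfolding eq
    by (intro decidable_less computable_Least decidable_disj decidable_le computable_p1 computable_id computable_comp[OF assms(1)] computable_p2 P assms(1)) auto
qed

lemma computable_div: assumes "computable A" "computable B" shows "computable (\<lambda>x. A x div B x)"
proof -
  have eq: "a div b = (LEAST q. b = 0 \<or> a < Suc q * b)" for a b :: nat
  proof (cases "b = 0")
    case False
    show ?thesis
    proof (rule Least_equality[symmetric])
      show "b = 0 \<or> a < Suc (a div b) * b"
        using False dividend_less_div_times[of b a] by (simp add: algebra_simps)
      show "a div b \<le> q" if "b = 0 \<or> a < Suc q * b" for q
        using False that by (simp add: div_less_iff_less_mult flip: less_Suc_eq_le)
    qed
  qed simp
  have ex: "\<exists>q. b = 0 \<or> a < Suc q * b" for a b :: nat
    by (cases b) (auto intro: exI[of _ a])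
  show ?thesis unfolding eq
    by (intro computable_Least decidable_disj decidable_eq decidable_less computable_mult computable_Suc computable_p1 computable_p2 computable_id computable_const
        computable_comp[OF assms(1)] computable_comp[OF assms(2)] ex)
qed

lemma computable_mod: assumes "computable A" "computable B" shows "computable (\<lambda>x. A x mod B x)"
proof -
  have "a mod b = a - (a div b) * b" for a b :: nat
    by (simp add: minus_div_mult_eq_mod)
  then show ?thesis by (simp only:) (intro computable_diff computable_mult computable_div assms)
qed

lemma computable_sum:
  assumes "computable N" "computable (\<lambda>y. F (p1 y) (p2 y))"
  shows "computable (\<lambda>x. \<Sum>i<N x. F i x)"
proof -
  have eq: "(\<Sum>i<n. G i) = rec_nat 0 (\<lambda>i r. r + G i) n" for n and G :: "nat \<Rightarrow> nat"
    by (induction n) auto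
  have "computable (\<lambda>y. F (p1 y) (p2 (p2 y)))"
    using computable_comp[OF assms(2), of "\<lambda>y. pr (p1 y) (p2 (p2 y))"] by (simp add: computable_pr computable_p1 computable_p2 computable_id)
  then show ?thesis unfolding eq
    by (intro computable_rec[where H = "\<lambda>i r x. r + F i x"] assms(1) computable_const computable_add computable_p1 computable_p2 computable_id)
qed

lemmas computable_intros = computable_id computable_const computable_Suc computable_p1 computable_p2 computable_pr computable_add computable_mult computable_power computable_diff computable_div computable_mod
  computable_if decidable_not decidable_conj decidable_disj decidable_le decidable_less decidable_eq

lemma computable_sum_const:
  fixes B :: nat assumes "\<And>a. a < B \<Longrightarrow> computable (H a)" shows "computable (\<lambda>x. \<Sum>a<B. H a x)"
  using assms
proof (induction B)
  case (Suc B)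
  then show ?case by (simp add: computable_add)
qed (simp add: computable_const)

lemma computable_finite_support:
  assumes "finite {n. F n \<noteq> 0}" shows "computable F"
proof -
  obtain B where B: "\<And>n. F n \<noteq> 0 \<Longrightarrow> n < B"
    using assms by (auto simp: finite_nat_set_iff_bounded)
  have "F x = (\<Sum>a<B. of_bool (x = a) * F a)" for x
  proof (cases "x < B")
    case True
    then show ?thesis by (simp add: sum.remove[of _ x])
  next
    case False
    then have "F x = 0" using B by blast
    moreover have "(\<Sum>a<B. of_bool (x = a) * F a) = 0" using False by (intro sum.neutral) auto
    ultimately show ?thesis by simp
  qed
  then have "F = (\<lambda>x. \<Sum>a<B. of_bool (x = a) * F a)" by (rule ext)
  moreover have "computable (\<lambda>x. \<Sum>a<B. of_bool (x = a) * F a)"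
    by (intro computable_sum_const computable_intros)
  ultimately show ?thesis by (rule ssubst[where P = computable])
qed

text \<open>
  Any function at all of boundedly many tuples of values is computable. Transition functions of machines
  enter in this way.
\<close>

lemma computable_table:
  assumes "\<And>F. F \<in> set Fs \<Longrightarrow> computable F \<and> (\<forall>x. F x < B)"
  shows "computable (\<lambda>x. G (map (\<lambda>F. F x) Fs))"
  using assms
proof (induction Fs arbitrary: G)
  case Nil
  show ?case by (simp add: computable_const)
next
  case (Cons F Fs)
  have F: "computable F" "\<And>x. F x < B" using Cons.prems by auto
  have "G (map (\<lambda>F. F x) (F # Fs)) = (\<Sum>a<B. of_bool (F x = a) * G (a # map (\<lambda>F. F x) Fs))" for x
    using F(2)[of x] by (simp add: sum.remove[of _ "F x"])
  moreover have "computable (\<lambda>x. G (a # map (\<lambda>F. F x) Fs))" for a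
    by (rule Cons.IH) (use Cons.prems in auto)
  ultimately show ?case
    by (simp only:) (intro computable_sum_const computable_intros F)
qed

definition tup :: "nat list \<Rightarrow> nat" where
  "tup xs = foldr (\<lambda>a b. pr a b) xs 0"

definition item :: "nat \<Rightarrow> nat \<Rightarrow> nat" where
  "item i c = p1 ((p2 ^^ i) c)"

lemma item_tup: "i < length xs \<Longrightarrow> item i (tup xs) = xs ! i"
proof (induction xs arbitrary: i)
  case (Cons x xs)
  have p2: "p2 (tup (x # xs)) = tup xs" "p1 (tup (x # xs)) = x" by (auto simp: tup_def)
  show ?case
    using Cons p2 by (cases i) (auto simp: item_def funpow_Suc_right simp del: funpow.simps(2))
qed simp

lemma computable_tup: "(\<And>F. F \<in> set Fs \<Longrightarrow> computable F) \<Longrightarrow> computable (\<lambda>x. tup (map (\<lambda>F. F x) Fs))"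
  unfolding tup_def by (induction Fs) (simp_all add: computable_const computable_pr)

lemma computable_item: assumes "computable F" shows "computable (\<lambda>x. item i (F x))"
proof -
  have "computable (\<lambda>x. (p2 ^^ i) (F x))"
    by (induction i) (simp_all add: assms computable_p2)
  then show ?thesis unfolding item_def by (rule computable_p1)
qed

section \<open>Numbering words\<close>

definition snoc_bit :: "nat \<Rightarrow> bool \<Rightarrow> nat" where
  "snoc_bit n b = 2 * n + of_bool b"

text \<open>
  The number with binary digits \<open>1 v\<close>. Prefixes of a word are the quotients of its code by powers of 2, and 0
  is the only number that is not a code, so that it can stand for an undefined value.
\<close>

definition code :: "word \<Rightarrow> nat" where
  "code v = foldl snoc_bit 1 v"

definition val :: "word \<Rightarrow> nat" where
  "val v = foldl snoc_bit 0 v"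

lemma foldl_snoc_bit: "foldl snoc_bit n v = n * 2 ^ length v + val v"
  unfolding val_def by (induction v rule: rev_induct) (auto simp: snoc_bit_def)

lemma val_less: "val v < 2 ^ length v"
  unfolding val_def by (induction v rule: rev_induct) (auto simp: snoc_bit_def)

lemma code_append: "code (a @ u) = code a * 2 ^ length u + val u"
  by (simp add: code_def foldl_snoc_bit)

lemma code_Nil [simp]: "code [] = 1"
  by (simp add: code_def)

lemma code_snoc [simp]: "code (v @ [b]) = 2 * code v + of_bool b"
  by (simp add: code_def snoc_bit_def)

lemma code_bounds: "2 ^ length v \<le> code v" "code v < 2 ^ Suc (length v)"
  using val_less[of v] by (auto simp: code_def foldl_snoc_bit)

lemma code_pos [simp]: "code v \<noteq> 0" "0 < code v"
  using code_bounds(1)[of v] by (auto intro!: gr0I simp del: code_bounds)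

lemma code_prefix_div: "code (a @ u) div 2 ^ length u = code a"
  using val_less[of u] by (simp add: code_append)

lemma code_suffix_mod: "code (a @ u) mod 2 ^ length u = val u"
  using val_less[of u] by (simp add: code_append)

lemma inj_code: "inj code"
proof (rule injI)
  fix v w show "code v = code w \<Longrightarrow> v = w"
  proof (induction v arbitrary: w rule: rev_induct)
    case Nil
    show ?case
    proof (cases w rule: rev_cases)
      case (snoc ys y)
      then show ?thesis using Nil code_pos(2)[of ys] by (cases y) auto
    qed simp
  next
    case (snoc b v)
    show ?case
    proof (cases w rule: rev_cases)
      case Nil
      then show ?thesis using snoc.prems code_pos(2)[of v] by (cases b) auto
    next
      case w: (snoc ys y)
      have *: "2 * code v + of_bool b = 2 * code ys + of_bool y" using snoc.prems w by simp
      then have "b = y" by (cases b; cases y; simp; presburger)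
      with * w snoc.IH[of ys] show ?thesis by simp
    qed
  qed
qed

lemma code_eq [simp]: "code v = code w \<longleftrightarrow> v = w"
  using inj_code by (auto dest: injD)

lemma code_surj: "n > 0 \<Longrightarrow> \<exists>v. code v = n"
proof (induction n rule: less_induct)
  case (less n)
  show ?case
  proof (cases "n = 1")
    case True
    then show ?thesis by (intro exI[of _ "[]"]) simp
  next
    case False
    then have "n div 2 < n" "n div 2 > 0" using less.prems by auto
    then obtain v where "code v = n div 2" using less.IH by blast
    then show ?thesis by (intro exI[of _ "v @ [odd n]"]) simp
  qed
qed

text \<open>
  The function on codes that belongs to a partial function on words. As it is total, its computability
  includes that of the domain.
\<close>

definition hat :: "(word \<rightharpoonup> word) \<Rightarrow> nat \<Rightarrow> nat" where
  "hat h n = (if n = 0 then 0 else case h (the_inv code n) of None \<Rightarrow> 0 | Some y \<Rightarrow> code y)"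

lemma hat_0 [simp]: "hat h 0 = 0"
  by (simp add: hat_def)

lemma hat_code: "hat h (code x) = (case h x of None \<Rightarrow> 0 | Some y \<Rightarrow> code y)"
  by (simp add: hat_def the_inv_f_f[OF inj_code])

lemma hat_eqI:
  assumes "F 0 = 0" "\<And>x. F (code x) = (case h x of None \<Rightarrow> 0 | Some y \<Rightarrow> code y)"
  shows "F = hat h"
proof
  fix n show "F n = hat h n"
  proof (cases "n = 0")
    case False
    then obtain x where "n = code x" using code_surj[of n] by auto
    then show ?thesis using assms(2) by (simp add: hat_code)
  qed (simp add: assms)
qed

lemma hat_comp: "hat (g \<circ>\<^sub>m h) n = hat g (hat h n)"
proof (cases "n = 0")
  case False
  then obtain x where "n = code x" using code_surj[of n] by auto
  then show ?thesis by (simp add: hat_code map_comp_def split: option.split)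
qed simp

definition len :: "nat \<Rightarrow> nat" where
  "len n = (LEAST k. n < 2 ^ Suc k)"

lemma len_code [simp]: "len (code v) = length v"
  unfolding len_def
proof (rule Least_equality)
  show "code v < 2 ^ Suc (length v)" by (rule code_bounds)
  fix k assume "code v < 2 ^ Suc k"
  with code_bounds(1)[of v] have "(2::nat) ^ length v < 2 ^ Suc k" by linarith
  then have "length v < Suc k" by (rule power_less_imp_less_exp[rotated]) simp
  then show "length v \<le> k" by simp
qed

lemma computable_len: assumes "computable F" shows "computable (\<lambda>x. len (F x))"
proof -
  have "computable len"
    unfolding len_def
  proof (intro computable_Least computable_intros)
    show "\<exists>i. x < 2 ^ Suc i" for x :: nat
      by (rule exI[of _ x], rule less_trans[OF less_exp]) simp
  qed
  then show ?thesis by (rule computable_comp) (rule assms)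
qed

lemma code_nth: "i < length v \<Longrightarrow> v ! i \<longleftrightarrow> odd (code v div 2 ^ (length v - 1 - i))"
proof -
  assume i: "i < length v"
  have "v = (take i v @ [v ! i]) @ drop (Suc i) v" using i by (simp add: id_take_nth_drop[symmetric])
  then have "code v div 2 ^ length (drop (Suc i) v) = code (take i v @ [v ! i])"
    by (metis code_prefix_div)
  then show ?thesis by simp
qed

section \<open>Polynomial-time functions are computable\<close>

text \<open>
  A tape is the number whose base \<open>B\<close> digits are the contents of the cells, where the two-sided tape is
  folded by \<^const>\<open>int_encode\<close>. This keeps cells at fixed addresses, and so the output can be read off
  whatever the final head position.
\<close>

definition digit :: "nat \<Rightarrow> nat \<Rightarrow> nat \<Rightarrow> nat" where
  "digit B D i = (D div B ^ i) mod B"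

definition set_digit :: "nat \<Rightarrow> nat \<Rightarrow> nat \<Rightarrow> nat \<Rightarrow> nat" where
  "set_digit B D i s = D - digit B D i * B ^ i + s * B ^ i"

lemma digit_add_low:
  assumes "l < B ^ i" "0 < B"
  shows "digit B (y * B ^ i + l) j = (if j < i then digit B l j else digit B y (j - i))"
proof (cases "j < i")
  case True
  then obtain m where m: "i = j + Suc m" by (metis add_Suc_right less_imp_Suc_add)
  have eq: "y * B ^ i = (y * B ^ m * B) * B ^ j" by (simp add: m power_add)
  have "(y * B ^ i + l) div B ^ j = y * B ^ m * B + l div B ^ j"
    unfolding eq by (rule div_mult_self3) (use assms in simp)
  then show ?thesis using True by (simp add: digit_def)
next
  case False
  then have "B ^ j = B ^ i * B ^ (j - i)" by (simp flip: power_add)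
  then have "(y * B ^ i + l) div B ^ j = (y * B ^ i + l) div B ^ i div B ^ (j - i)"
    by (simp add: div_mult2_eq)
  also have "(y * B ^ i + l) div B ^ i = y" using assms by simp
  finally show ?thesis using False by (simp add: digit_def)
qed

lemma digit_set_digit:
  assumes "s < B"
  shows "digit B (set_digit B D i s) j = (if j = i then s else digit B D j)"
proof -
  define y where "y = D div B ^ i"
  define l where "l = D mod B ^ i"
  have D: "D = y * B ^ i + l" unfolding y_def l_def by (rule div_mult_mod_eq[symmetric])
  have B: "0 < B" using assms by simp
  then have l: "l < B ^ i" by (simp add: l_def)
  have d: "digit B D i = y mod B" by (simp add: digit_def y_def)
  have y: "y * B ^ i = (y div B * B + y mod B) * B ^ i" by (simp only: div_mult_mod_eq)
  have "D = (y div B * B) * B ^ i + (y mod B) * B ^ i + l"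
    by (simp only: D y distrib_right)
  then have S: "set_digit B D i s = (y div B * B + s) * B ^ i + l"
    unfolding set_digit_def d by (simp add: algebra_simps)
  have zero: "digit B (z * B + r) 0 = r" if "r < B" for z r
    using that by (simp add: digit_def)
  have suc: "digit B (z * B + r) (Suc m) = digit B z m" if "r < B" for z r m
    using that digit_add_low[of r B 1 z "Suc m"] by simp
  show ?thesis
  proof (cases "j < i")
    case True
    then show ?thesis unfolding S by (subst D) (simp add: digit_add_low[OF l B])
  next
    case False
    then have "digit B D j = digit B y (j - i)"
      by (subst D) (simp add: digit_add_low[OF l B])
    moreover have "digit B (set_digit B D i s) j = digit B (y div B * B + s) (j - i)"
      unfolding S using False by (simp add: digit_add_low[OF l B])
    moreover have "digit B y (Suc m) = digit B (y div B) m" for m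
      using suc[of "y mod B" "y div B" m] B by simp
    ultimately show ?thesis
      using False zero[OF assms] suc[OF assms]
      by (cases "j - i") auto
  qed
qed

lemma computable_digit: assumes "computable D" "computable I" shows "computable (\<lambda>x. digit B (D x) (I x))"
  unfolding digit_def by (intro computable_intros assms)

lemma computable_set_digit: assumes "computable D" "computable I" "computable S" shows "computable (\<lambda>x. set_digit B (D x) (I x) (S x))"
  unfolding set_digit_def by (intro computable_intros computable_digit assms)

lemma digit_0 [simp]: "digit B 0 i = 0"
  by (simp add: digit_def)

text \<open>
  Beyond the leading digit there are only zeros. Hence the search for the end of the output terminates for
  every number, not only for those that represent tapes.
\<close>

lemma digit_vanishes: "2 \<le> B \<Longrightarrow> \<exists>j. digit B D (2 * j) = 0"
proof -
  assume "2 \<le> B"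
  then have "2 ^ D \<le> B ^ D" by (rule power_mono) simp
  also have "\<dots> \<le> B ^ (2 * D)" using \<open>2 \<le> B\<close> by (intro power_increasing) auto
  finally have "D < B ^ (2 * D)" using less_exp[of D] by linarith
  then show ?thesis by (intro exI[of _ D]) (simp add: digit_def)
qed

fun move_num :: "move \<Rightarrow> nat" where
  "move_num Left = 0" | "move_num Stay = 1" | "move_num Right = 2"

text \<open>
  Moving the head by one cell, in terms of the \<^const>\<open>int_encode\<close> of its position.
\<close>

definition head_num :: "nat \<Rightarrow> nat \<Rightarrow> nat" where
  "head_num d h =
     (if d = 2 then if h mod 2 = 0 then h + 2 else if h = 1 then 0 else h - 2
      else if d = 0 then if h = 0 then 1 else if h mod 2 = 0 then h - 2 else h + 2
      else h)"

lemma head_num: "head_num (move_num d) (int_encode i) = int_encode (move_head d i)"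
proof -
  consider "i \<ge> 1" | "i = 0" | "i = -1" | "i < -1" by linarith
  then show ?thesis
  proof cases
    case 1
    then have "i = int (Suc (nat (i - 1)))" by simp
    then obtain n where "i = int (Suc n)" by blast
    then show ?thesis
      by (cases d) (auto simp: head_num_def int_encode_def sum_encode_def nat_add_distrib)
  next
    case 4
    then have "\<exists>n. i = - int n - 2" by presburger
    then obtain n where "i = - int n - 2" by blast
    then show ?thesis
      by (cases d) (auto simp: head_num_def int_encode_def sum_encode_def nat_add_distrib mod_Suc)
  qed (cases d; simp add: head_num_def int_encode_def sum_encode_def)+
qed

lemma computable_head_num: assumes "computable D" "computable H" shows "computable (\<lambda>x. head_num (D x) (H x))"
  unfolding head_num_def by (intro computable_intros assms)

locale machine =
  fixes M :: dtm
  assumes wf: "wf_dtm M"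
begin

abbreviation "k \<equiv> tapes M"
definition "B = max (states M) (symbols M)"

lemma bounds: "2 \<le> k" "3 \<le> B" "3 \<le> states M" "3 \<le> symbols M" "states M \<le> B" "symbols M \<le> B"
  using wf by (auto simp: wf_dtm_def B_def)

definition tape_num :: "nat \<Rightarrow> nat \<Rightarrow> nat" where "tape_num j c = item (2 * j + 1) c"
definition pos_num :: "nat \<Rightarrow> nat \<Rightarrow> nat" where "pos_num j c = item (2 * j + 2) c"

text \<open>
  The state and the scanned symbols. The state is reduced modulo \<open>B\<close> to bound it for all numbers, as a
  table requires; on representations of configurations nothing changes.
\<close>

definition scanned :: "nat \<Rightarrow> nat list" where
  "scanned c = map (\<lambda>F. F c)
     ((\<lambda>c. item 0 c mod B) # map (\<lambda>j c. digit B (tape_num j c) (pos_num j c)) [0..<k])"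

definition new_state :: "nat list \<Rightarrow> nat" where
  "new_state l = (if hd l = 1 \<or> hd l = 2 then hd l else fst (trans M (hd l) (tl l)))"
definition new_symbol :: "nat \<Rightarrow> nat list \<Rightarrow> nat" where
  "new_symbol j l = (if hd l = 1 \<or> hd l = 2 then tl l ! j else fst (snd (trans M (hd l) (tl l)) ! j))"
definition new_move :: "nat \<Rightarrow> nat list \<Rightarrow> nat" where
  "new_move j l = (if hd l = 1 \<or> hd l = 2 then 1 else move_num (snd (snd (trans M (hd l) (tl l)) ! j)))"

text \<open>
  A configuration is the tuple of the state (component 0) and, for each tape \<open>j\<close>, its contents (component
  \<open>2 j + 1\<close>) and head position (component \<open>2 j + 2\<close>).
\<close>

definition step_num :: "nat \<Rightarrow> nat" where
  "step_num c = tup (map (\<lambda>F. F c) (map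
     (\<lambda>i c. if i = 0 then new_state (scanned c)
       else if odd i then set_digit B (tape_num (i div 2) c) (pos_num (i div 2) c) (new_symbol (i div 2) (scanned c))
       else head_num (new_move (i div 2 - 1) (scanned c)) (pos_num (i div 2 - 1) c))
     [0..<2 * k + 1]))"

lemma computable_scanned: "computable (\<lambda>c. G (scanned c))"
  unfolding scanned_def
proof (rule computable_table[where B = B])
  fix F assume "F \<in> set ((\<lambda>c. item 0 c mod B) # map (\<lambda>j c. digit B (tape_num j c) (pos_num j c)) [0..<k])"
  then show "computable F \<and> (\<forall>x. F x < B)"
    using bounds by (auto simp: tape_num_def pos_num_def digit_def intro!: computable_intros computable_item)
qed

lemma computable_step_num: "computable step_num"
  unfolding step_num_def
proof (rule computable_tup)
  fix F assume "F \<in> set (map (\<lambda>i c. if i = 0 then new_state (scanned c)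
       else if odd i then set_digit B (tape_num (i div 2) c) (pos_num (i div 2) c) (new_symbol (i div 2) (scanned c))
       else head_num (new_move (i div 2 - 1) (scanned c)) (pos_num (i div 2 - 1) c)) [0..<2 * k + 1])"
  then obtain i where F: "F = (\<lambda>c. if i = 0 then new_state (scanned c)
       else if odd i then set_digit B (tape_num (i div 2) c) (pos_num (i div 2) c) (new_symbol (i div 2) (scanned c))
       else head_num (new_move (i div 2 - 1) (scanned c)) (pos_num (i div 2 - 1) c))"
    unfolding set_map by blast
  show "computable F" unfolding F tape_num_def pos_num_def
    by (intro computable_if computable_const computable_scanned computable_set_digit computable_head_num computable_item computable_id)
qed

text \<open>
  Cells are bounded by the number of symbols because the transition function is controlled only there.
\<close>

definition rep :: "nat \<Rightarrow> config \<Rightarrow> bool" where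
  "rep c cfg \<longleftrightarrow> item 0 c = fst cfg \<and> fst cfg < states M \<and> length (snd cfg) = k \<and>
     (\<forall>j<k. pos_num j c = int_encode (snd (snd cfg ! j)) \<and>
       (\<forall>i. digit B (tape_num j c) (int_encode i) = fst (snd cfg ! j) i \<and> fst (snd cfg ! j) i < symbols M))"

lemma rep_step:
  assumes "rep c cfg" shows "rep (step_num c) (step M cfg)"
proof -
  obtain q ts where cfg: "cfg = (q, ts)" by (cases cfg)
  have q: "item 0 c = q" "q < states M" "length ts = k"
    and pos: "\<And>j. j < k \<Longrightarrow> pos_num j c = int_encode (snd (ts ! j))"
    and tape: "\<And>i j. j < k \<Longrightarrow> digit B (tape_num j c) (int_encode i) = fst (ts ! j) i"
    and sym: "\<And>i j. j < k \<Longrightarrow> fst (ts ! j) i < symbols M"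
    using assms by (auto simp: rep_def cfg)
  define ss where "ss = map (\<lambda>(t, h). t h) ts"
  have ss: "length ss = k" "set ss \<subseteq> {..<symbols M}"
    using sym q(3) by (auto simp: ss_def set_conv_nth split: prod.split) (metis fst_conv)
  have ssj: "ss ! j = fst (ts ! j) (snd (ts ! j))" if "j < k" for j
    using that q(3) by (simp add: ss_def split_beta)
  have sc: "scanned c = q # ss"
    using q bounds pos tape
    by (auto simp: scanned_def ssj ss(1) intro!: nth_equalityI)
  have tr: "fst (trans M q ss) < states M" "length (snd (trans M q ss)) = k"
    "fst ` set (snd (trans M q ss)) \<subseteq> {..<symbols M}"
    using wf q(2) ss unfolding wf_dtm_def by blast+
  define q' where "q' = new_state (q # ss)"
  define ts' where "ts' = map (\<lambda>j. ((fst (ts ! j))(snd (ts ! j) := new_symbol j (q # ss)),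
     (if q = 1 \<or> q = 2 then snd (ts ! j) else move_head (snd (snd (trans M q ss) ! j)) (snd (ts ! j))))) [0..<k]"
  have st: "step M cfg = (q', ts')"
  proof (cases "q = 1 \<or> q = 2")
    case True
    then show ?thesis
      by (auto simp: cfg q'_def ts'_def new_state_def new_symbol_def ssj q(3) intro!: nth_equalityI)
  next
    case False
    have "map2 act (snd (trans M q ss)) ts = ts'"
    proof (rule nth_equalityI)
      fix j assume "j < length (map2 act (snd (trans M q ss)) ts)"
      then have j: "j < k" by (simp add: tr q)
      show "map2 act (snd (trans M q ss)) ts ! j = ts' ! j"
        using j False tr(2) q(3)
        by (cases "snd (trans M q ss) ! j"; cases "ts ! j") (simp add: ts'_def new_symbol_def)
    qed (simp add: ts'_def tr q)
    then show ?thesis using False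
      by (simp add: cfg q'_def new_state_def ss_def[symmetric] split_beta)
  qed
  have ns: "new_symbol j (q # ss) < symbols M" if "j < k" for j
  proof -
    have "ss ! j \<in> set ss" "snd (trans M q ss) ! j \<in> set (snd (trans M q ss))"
      using that tr(2) ss(1) by auto
    then show ?thesis using tr(3) ss(2) unfolding new_symbol_def by auto
  qed
  have i0: "item 0 (step_num c) = q'"
    unfolding step_num_def by (subst item_tup) (auto simp: sc q'_def simp del: upt_Suc)
  have it: "tape_num j (step_num c) = set_digit B (tape_num j c) (pos_num j c) (new_symbol j (q # ss))"
    if "j < k" for j
    unfolding step_num_def tape_num_def[of _ "tup _"] using that by (subst item_tup) (auto simp: sc simp del: upt_Suc)
  have ip: "pos_num j (step_num c) = head_num (new_move j (q # ss)) (pos_num j c)"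
    if "j < k" for j
    unfolding step_num_def pos_num_def[of _ "tup _"] using that by (subst item_tup) (auto simp: sc simp del: upt_Suc)
  have q'_less: "q' < states M" using tr(1) bounds by (auto simp: q'_def new_state_def)
  show ?thesis
    unfolding rep_def st
  proof (intro conjI allI impI, simp_all add: i0 q'_less)
    show "length ts' = k" by (simp add: ts'_def)
    fix j assume j: "j < k"
    show "pos_num j (step_num c) = int_encode (snd (ts' ! j))"
      using j head_num[of Stay] by (auto simp: ip ts'_def pos new_move_def head_num)
    fix i
    show "digit B (tape_num j (step_num c)) (int_encode i) = fst (ts' ! j) i"
      using j ns[OF j] bounds by (simp add: it ts'_def pos tape digit_set_digit inj_eq[OF inj_int_encode])
    show "fst (ts' ! j) i < symbols M"
      using j ns[OF j] sym by (simp add: ts'_def)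
  qed
qed

definition input_num :: "nat \<Rightarrow> nat" where
  "input_num n = rec_nat 0 (\<lambda>j D. set_digit B D (2 * j) (1 + (n div 2 ^ (len n - 1 - j)) mod 2)) (len n)"

lemma computable_input_num: assumes "computable F" shows "computable (\<lambda>x. input_num (F x))"
proof -
  have "computable input_num"
    unfolding input_num_def
    by (rule computable_rec[where H = "\<lambda>j D n. set_digit B D (2 * j) (1 + (n div 2 ^ (len n - 1 - j)) mod 2)"])
      (intro computable_set_digit computable_len computable_intros)+
  then show ?thesis by (rule computable_comp) (rule assms)
qed

lemma digit_input_num: "digit B (input_num (code x)) (int_encode i) = word_tape x i"
proof -
  let ?H = "\<lambda>j D. set_digit B D (2 * j) (1 + (code x div 2 ^ (length x - 1 - j)) mod 2)"
  have *: "digit B (rec_nat 0 ?H m) e = (if even e \<and> e div 2 < m then if x ! (e div 2) then 2 else 1 else 0)"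
    if "m \<le> length x" for m e
    using that
  proof (induction m)
    case (Suc m)
    have "1 + (code x div 2 ^ (length x - 1 - m)) mod 2 = (if x ! m then 2 else (1::nat))"
      using code_nth[of m x] Suc.prems by (auto simp: odd_iff_mod_2_eq_one even_iff_mod_2_eq_zero)
    moreover have "(if x ! m then 2 else 1) < B" using bounds by simp
    ultimately show ?case
      using Suc by (auto simp: digit_set_digit less_Suc_eq)
  qed simp
  show ?thesis
    unfolding input_num_def len_code *[OF order.refl]
    by (auto simp: word_tape_def int_encode_def sum_encode_def nat_less_iff)
qed

definition init_num :: "nat \<Rightarrow> nat" where
  "init_num n = tup (map (\<lambda>F. F n) (map (\<lambda>i n. if i = 1 then input_num n else 0) [0..<2 * k + 1]))"

lemma computable_init_num: assumes "computable F" shows "computable (\<lambda>x. init_num (F x))"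
proof -
  have "computable init_num" unfolding init_num_def
  proof (rule computable_tup)
    fix F assume "F \<in> set (map (\<lambda>i n. if i = 1 then input_num n else 0) [0..<2 * k + 1])"
    then obtain i :: nat where "F = (\<lambda>n. if i = 1 then input_num n else 0)" unfolding set_map by blast
    then show "computable F" by (simp only:) (intro computable_if computable_const computable_input_num computable_id)
  qed
  then show ?thesis by (rule computable_comp) (rule assms)
qed

lemma rep_init: "rep (init_num (code x)) (init M x)"
proof -
  have item: "item i (init_num (code x)) = (if i = 1 then input_num (code x) else 0)" if "i < 2 * k + 1" for i
    unfolding init_num_def using that by (subst item_tup) (auto simp del: upt_Suc)
  have d: "digit B 0 e = 0" for e by simp
  have e0: "int_encode 0 = 0" by (simp add: int_encode_def sum_encode_def)
  have "word_tape [] i = 0" for i by (simp add: word_tape_def)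
  moreover have "word_tape x i < symbols M" for i using bounds by (simp add: word_tape_def)
  ultimately show ?thesis
    using bounds
    by (auto simp: rep_def init_def item tape_num_def pos_num_def digit_input_num nth_Cons e0 split: nat.split)
qed

definition halted_num :: "nat \<Rightarrow> nat" where
  "halted_num c = of_bool (\<not> (item 0 c = 1 \<or> item 0 c = 2))"

definition output_num :: "nat \<Rightarrow> nat" where
  "output_num D = rec_nat 1 (\<lambda>j r. 2 * r + (digit B D (2 * j) - 1)) (LEAST j. digit B D (2 * j) = 0)"

lemma computable_output_num: assumes "computable F" shows "computable (\<lambda>x. output_num (F x))"
proof -
  have "computable output_num"
    unfolding output_num_def
  proof (rule computable_rec[where H = "\<lambda>j r D. 2 * r + (digit B D (2 * j) - 1)"])
    show "computable (\<lambda>D. LEAST j. digit B D (2 * j) = 0)"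
      by (intro computable_Least computable_digit computable_intros) (rule digit_vanishes, use bounds in simp)
  qed (intro computable_digit computable_intros)+
  then show ?thesis by (rule computable_comp) (rule assms)
qed

lemma output_num:
  assumes "\<And>i. digit B D (int_encode i) = word_tape y i"
  shows "output_num D = code y"
proof -
  have D: "digit B D (2 * j) = (if j < length y then if y ! j then 2 else 1 else 0)" for j
    using assms[of "int j"] by (simp add: int_encode_def sum_encode_def word_tape_def)
  have L: "(LEAST j. digit B D (2 * j) = 0) = length y"
    by (rule Least_equality) (auto simp: D split: if_splits)
  have "rec_nat 1 (\<lambda>j r. 2 * r + (digit B D (2 * j) - 1)) m = code (take m y)" if "m \<le> length y" for m
    using that by (induction m) (auto simp: D take_Suc_conv_app_nth)
  then show ?thesis by (simp add: output_num_def L)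
qed

text \<open>
  The machine halts on every input, so that the number of its steps is found by minimisation.
\<close>

lemma computable_by_machine:
  assumes "computes_in_time M f T"
  shows "computable (hat f)"
proof -
  let ?S = "\<lambda>n. init_num (if n = 0 then 1 else n)"
  let ?stop = "\<lambda>n. LEAST t. halted_num ((step_num ^^ t) (?S n)) = 0"
  let ?c = "\<lambda>n. (step_num ^^ ?stop n) (?S n)"
  have rep: "rep ((step_num ^^ t) (init_num (code x))) ((step M ^^ t) (init M x))" for t x
    by (induction t) (auto intro: rep_step rep_init)
  have fin: "fst ((step M ^^ T (length x)) (init M x)) \<in> {1, 2}" for x
    using assms[unfolded computes_in_time_def, rule_format, of x]
    by (auto split: option.splits)
  have ex: "\<exists>t. halted_num ((step_num ^^ t) (?S n)) = 0" for n
  proof -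
    obtain x where x: "code x = (if n = 0 then 1 else n)" using code_surj by fastforce
    show ?thesis
      using rep[of "T (length x)" x] fin[of x] by (auto simp: rep_def halted_num_def simp flip: x)
  qed
  have c: "computable ?c"
    by (rule computable_while[OF _ computable_step_num computable_init_num ex])
      (unfold halted_num_def, (intro computable_item computable_intros)+)
  let ?F = "\<lambda>n. if n = 0 then 0 else if item 0 (?c n) = 1 then output_num (item 3 (?c n)) else 0"
  have "?F = hat f"
  proof (rule hat_eqI)
    fix x
    define t where "t = ?stop (code x)"
    have S: "?S (code x) = init_num (code x)" by simp
    have h0: "halted_num ((step_num ^^ t) (init_num (code x))) = 0"
      using LeastI_ex[OF ex[of "code x"]] unfolding t_def S .
    have le: "t \<le> T (length x)"
    proof -
      have "halted_num ((step_num ^^ T (length x)) (?S (code x))) = 0"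
        using rep[of "T (length x)" x] fin[of x] by (auto simp: rep_def halted_num_def)
      then show ?thesis unfolding t_def by (rule Least_le)
    qed
    have r: "rep ((step_num ^^ t) (init_num (code x))) ((step M ^^ t) (init M x))" by (rule rep)
    obtain q ts where qts: "(step M ^^ t) (init M x) = (q, ts)" by fastforce
    have q: "q = 1 \<or> q = 2" using h0 r by (auto simp: rep_def halted_num_def qts split: if_splits)
    have stay: "(step M ^^ s) (q, ts) = (q, ts)" for s
      using q by (induction s) auto
    have "(step M ^^ T (length x)) (init M x) = (q, ts)"
    proof -
      obtain s where "T (length x) = s + t" using le by (metis le_add_diff_inverse2)
      then show ?thesis using stay[of s] by (simp add: funpow_add qts)
    qed
    then have f: "case f x of Some y \<Rightarrow> q = 1 \<and> fst (ts ! 1) = word_tape y | None \<Rightarrow> q = 2"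
      using assms[unfolded computes_in_time_def, rule_format, of x] by simp
    let ?d = "(step_num ^^ t) (init_num (code x))"
    have d: "?c (code x) = ?d" unfolding t_def S ..
    have i0: "item 0 ?d = q" using r by (simp add: rep_def qts)
    have i3: "digit B (item 3 ?d) (int_encode i) = fst (ts ! 1) i" for i
    proof -
      have "tape_num 1 ?d = item 3 ?d" by (simp add: tape_num_def numeral_3_eq_3)
      moreover have "1 < k" using bounds(1) by simp
      ultimately show ?thesis using r unfolding rep_def qts by fastforce
    qed
    show "?F (code x) = (case f x of None \<Rightarrow> 0 | Some y \<Rightarrow> code y)"
      unfolding d i0 using f i3 by (auto intro: output_num split: option.splits)
  qed simp
  moreover have "computable ?F"
    by (intro computable_if decidable_eq computable_item computable_output_num c computable_const computable_id)
  ultimately show ?thesis by (simp only:)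
qed

end

lemma fP_computable: "f \<in> fP \<Longrightarrow> computable (hat f)"
  unfolding fP_def poly_time_def by (auto intro: machine.computable_by_machine simp: machine_def)

section \<open>Clocked programs on Turing machines\<close>

text \<open>
  The control part of a step, which depends on the store only through which counters are nonzero.
\<close>

fun next_com :: "(nat \<Rightarrow> bool) \<Rightarrow> com list \<Rightarrow> com list" where
  "next_com z (Seq a b # l) = a # b # l"
| "next_com z (Cond r a b # l) = (if z r then a else b) # l"
| "next_com z (While r a # l) = (if z r then a # While r a # l else l)"
| "next_com z l = tl l"

lemma fst_exec1: "fst (exec1 s (l, \<sigma>, p, u)) = next_com (\<lambda>r. \<sigma> r \<noteq> 0) l"
  by (cases l; cases "hd l") auto

text \<open>
  The lists of pending commands that can arise while \<open>c\<close> is run before \<open>l\<close>. There are finitely many, and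
  they serve as the states of the machine.
\<close>

fun continuations :: "com \<Rightarrow> com list \<Rightarrow> com list set" where
  "continuations (Seq a b) l = insert (Seq a b # l) (continuations a (b # l) \<union> continuations b l)"
| "continuations (Cond r a b) l = insert (Cond r a b # l) (continuations a l \<union> continuations b l)"
| "continuations (While r a) l = insert (While r a # l) (continuations a (While r a # l))"
| "continuations c l = {c # l}"

lemma finite_continuations: "finite (continuations c l)"
  by (induction c arbitrary: l) auto

lemma continuations_self: "c # l \<in> continuations c l"
  by (cases c) auto

lemma next_com_continuations:
  "m \<in> continuations c l \<Longrightarrow> next_com z m \<in> insert l (continuations c l)"
proof (induction c arbitrary: l m)
  case (Seq a b)
  from Seq.prems consider "m = Seq a b # l" | "m \<in> continuations a (b # l)" | "m \<in> continuations b l"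
    by auto
  then show ?case
    using Seq.IH(1)[of m "b # l"] Seq.IH(2)[of m l] continuations_self[of a "b # l"] continuations_self[of b l]
    by cases auto
next
  case (Cond r a b)
  from Cond.prems consider "m = Cond r a b # l" | "m \<in> continuations a l" | "m \<in> continuations b l"
    by auto
  then show ?case
    using Cond.IH(1)[of m l] Cond.IH(2)[of m l] continuations_self[of a l] continuations_self[of b l]
    by cases auto
next
  case (While r a)
  from While.prems consider "m = While r a # l" | "m \<in> continuations a (While r a # l)"
    by auto
  then show ?case
    using While.IH[of m "While r a # l"] continuations_self[of a "While r a # l"]
    by cases auto
qed auto

fun reg_bound :: "com \<Rightarrow> nat" where
  "reg_bound (Inc r) = Suc r" | "reg_bound (Dec r) = Suc r" | "reg_bound (Read r) = Suc r"
| "reg_bound (Out r) = Suc r" | "reg_bound (Seq a b) = max (reg_bound a) (reg_bound b)"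
| "reg_bound (Cond r a b) = max (Suc r) (max (reg_bound a) (reg_bound b))"
| "reg_bound (While r a) = max (Suc r) (reg_bound a)"

lemma reg_bound_continuations:
  "m \<in> continuations c l \<Longrightarrow> reg_bound c \<le> R \<Longrightarrow> \<forall>d\<in>set l. reg_bound d \<le> R \<Longrightarrow> d \<in> set m \<Longrightarrow> reg_bound d \<le> R"
proof (induction c arbitrary: l m)
  case (Seq a b)
  then show ?case using Seq.IH(1)[of m "b # l"] Seq.IH(2)[of m l] by auto
next
  case (Cond r a b)
  then show ?case using Cond.IH(1)[of m l] Cond.IH(2)[of m l] by auto
next
  case (While r a)
  then show ?case using While.IH[of m "While r a # l"] by auto
qed auto

text \<open>
  A mark in cell 0 is all that is ever written on a counter tape; zero is recognised by reading it.
\<close>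

definition counter :: "nat \<Rightarrow> tape" where
  "counter n = (\<lambda>i. of_bool (i = 0), int n)"

definition stream :: "word \<Rightarrow> nat \<Rightarrow> bool" where
  "stream v i \<longleftrightarrow> i < length v \<and> v ! i"

definition conf :: "com \<Rightarrow> (nat \<Rightarrow> bool) \<Rightarrow> nat \<Rightarrow> com list \<times> store" where
  "conf K s n = (exec1 s ^^ n) ([K], (\<lambda>_. 0), 0, [])"

lemma conf_Suc: "conf K s (Suc n) = exec1 s (conf K s n)"
  by (simp add: conf_def)

lemma exec1_pos_out:
  assumes "exec1 s (l, \<sigma>, p, u) = (l', \<sigma>', p', u')"
  shows "p \<le> p'" "p' \<le> Suc p" "length u' \<le> Suc (length u)"
    "(\<And>i. i < p' \<Longrightarrow> s i = s' i) \<Longrightarrow> exec1 s' (l, \<sigma>, p, u) = (l', \<sigma>', p', u')"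
  using assms by (cases l; cases "hd l"; auto)+

lemma conf_pos_out: "conf K s n = (l, \<sigma>, p, u) \<Longrightarrow> p \<le> n \<and> length u \<le> n"
proof (induction n arbitrary: l \<sigma> p u)
  case 0
  then show ?case by (simp add: conf_def)
next
  case (Suc n)
  obtain l1 \<sigma>1 q1 u1 where 1: "conf K s n = (l1, \<sigma>1, q1, u1)" by (metis surj_pair)
  have "exec1 s (l1, \<sigma>1, q1, u1) = (l, \<sigma>, p, u)" using Suc.prems 1 by (simp add: conf_Suc)
  from exec1_pos_out(2,3)[OF this] Suc.IH[OF 1] show ?case by simp
qed

text \<open>
  A run cannot depend on letters that it has not read.
\<close>

lemma conf_stream_cong:
  "conf K s n = (l, \<sigma>, p, u) \<Longrightarrow> (\<And>i. i < p \<Longrightarrow> s i = s' i) \<Longrightarrow> conf K s' n = (l, \<sigma>, p, u)"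
proof (induction n arbitrary: l \<sigma> p u)
  case 0
  then show ?case by (simp add: conf_def)
next
  case (Suc n)
  obtain l1 \<sigma>1 q1 u1 where 1: "conf K s n = (l1, \<sigma>1, q1, u1)" by (metis surj_pair)
  have e: "exec1 s (l1, \<sigma>1, q1, u1) = (l, \<sigma>, p, u)" using Suc.prems 1 by (simp add: conf_Suc)
  have "q1 \<le> p" by (rule exec1_pos_out(1)[OF e])
  then have "conf K s' n = (l1, \<sigma>1, q1, u1)"
    by (intro Suc.IH[OF 1] Suc.prems(2)) simp
  then show ?case using exec1_pos_out(4)[OF e Suc.prems(2)] by (simp add: conf_Suc)
qed

lemma conf_halted: "conf K s n = ([], st) \<Longrightarrow> n \<le> m \<Longrightarrow> conf K s m = ([], st)"
proof (induction m)
  case (Suc m)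
  then show ?case by (cases "n = Suc m") (auto simp: conf_Suc)
qed simp

text \<open>
  The morphism computed by \<open>K\<close> under a clock: on input \<open>v\<close>, if \<open>K\<close> halts within half of the length of \<open>v\<close>
  many steps, then the unread rest of \<open>v\<close> is appended to its output. At that time \<open>K\<close> has read at most half
  of \<open>v\<close>, so extending \<open>v\<close> does not change the run, which makes this a right-ideal morphism; and the
  rest is at least half of \<open>v\<close>, which makes it polynomially balanced.
\<close>

definition clocked :: "com \<Rightarrow> word \<rightharpoonup> word" where
  "clocked K v = (case conf K (stream v) (length v div 2) of
     (l, \<sigma>, p, u) \<Rightarrow> if l = [] then Some (u @ drop p v) else None)"

lemma clocked_SomeE:
  assumes "clocked K v = Some y"
  obtains \<sigma> p u where "conf K (stream v) (length v div 2) = ([], \<sigma>, p, u)" "y = u @ drop p v"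
    "p \<le> length v div 2" "length u \<le> length v div 2"
proof -
  obtain l \<sigma> p u where 1: "conf K (stream v) (length v div 2) = (l, \<sigma>, p, u)" by (metis surj_pair)
  with assms have "l = []" "y = u @ drop p v" by (auto simp: clocked_def split: if_splits)
  with 1 conf_pos_out[OF 1] that show ?thesis by blast
qed

lemma clockedI:
  assumes "conf K s n = ([], \<sigma>, p, u)" "2 * n \<le> length v" "\<And>i. i < p \<Longrightarrow> s i = stream v i"
  shows "clocked K v = Some (u @ drop p v)"
proof -
  have "conf K (stream v) n = ([], \<sigma>, p, u)" by (rule conf_stream_cong[OF assms(1,3)])
  then have "conf K (stream v) (length v div 2) = ([], \<sigma>, p, u)"
    by (rule conf_halted) (use assms(2) in linarith)
  then show ?thesis by (simp add: clocked_def)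
qed

lemma clocked_append:
  assumes "clocked K v = Some y" shows "clocked K (v @ w) = Some (y @ w)"
proof -
  obtain \<sigma> p u where 1: "conf K (stream v) (length v div 2) = ([], \<sigma>, p, u)" "y = u @ drop p v"
    "p \<le> length v div 2" using assms by (rule clocked_SomeE)
  have "clocked K (v @ w) = Some (u @ drop p (v @ w))"
    by (rule clockedI[OF 1(1)]) (use 1(3) in \<open>auto simp: stream_def nth_append\<close>)
  then show ?thesis using 1(2,3) by simp
qed

lemma ideal_morphism_clocked: "ideal_morphism (clocked K)"
  unfolding ideal_morphism_def right_ideal_def ideal_gen_def
  by (auto simp: clocked_append)

lemma poly_balanced_clocked: "poly_balanced (clocked K)"
  unfolding poly_balanced_def
proof (intro exI[of _ "[:0, 2:]"] allI impI)
  fix v y assume "clocked K v = Some y"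
  then obtain \<sigma> p u where "y = u @ drop p v" "p \<le> length v div 2" "length u \<le> length v div 2"
    by (rule clocked_SomeE)
  then show "length y \<le> poly [:0, 2:] (length v) \<and> length v \<le> poly [:0, 2:] (length y)"
    by auto
qed

lemma funpow_trans: "(f ^^ a) x = y \<Longrightarrow> (f ^^ b) y = z \<Longrightarrow> (f ^^ (a + b)) x = z"
  by (simp add: funpow_add add.commute[of a])

declare step.simps [simp del]

text \<open>
  Tape 0 is the input, tape 1 the output, tape 2 the clock, and tape \<open>r + 3\<close> is counter \<open>r\<close>. State 0
  puts the marks on the counter tapes, states 3 and 4 set the clock to half of the input length, state 5
  rewinds the input, and state 6 copies the rest of the input to the output. The remaining states, from 7 on,
  are the continuations of the program; in these, every step also decreases the clock.
\<close>

locale program =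
  fixes K :: com
begin

definition "R = reg_bound K"
abbreviation "n \<equiv> R + 3"
definition "C = insert [] (continuations K [])"
definition "idx = (SOME f. bij_betw f C {0..<card C})"
definition "dec i = the_inv_into C idx i"

lemma finite_C: "finite C" by (simp add: C_def finite_continuations)

lemma idx: "bij_betw idx C {0..<card C}"
  unfolding idx_def by (rule someI_ex[where P = "\<lambda>f. bij_betw f C {0..<card C}"]) (rule ex_bij_betw_finite_nat[OF finite_C])

lemma idx_less: "l \<in> C \<Longrightarrow> idx l < card C"
  using idx by (auto simp: bij_betw_def)

lemma dec_idx [simp]: "l \<in> C \<Longrightarrow> dec (idx l) = l"
  unfolding dec_def using idx by (auto simp: bij_betw_def the_inv_into_f_f)

lemma dec_C: "i < card C \<Longrightarrow> dec i \<in> C"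
  unfolding dec_def using idx by (auto simp: bij_betw_def intro!: the_inv_into_into)

lemma next_com_C: "l \<in> C \<Longrightarrow> next_com z l \<in> C"
  using next_com_continuations[of l K "[]" z] by (auto simp: C_def)

lemma K_C: "[K] \<in> C" using continuations_self[of K "[]"] by (simp add: C_def)

lemma reg_bound_C: "c # l \<in> C \<Longrightarrow> reg_bound c \<le> R"
  using reg_bound_continuations[of "c # l" K "[]" R c] by (auto simp: C_def R_def)

definition next_state :: "nat \<Rightarrow> (nat \<Rightarrow> nat) \<Rightarrow> nat" where
  "next_state q a =
    (if q = 0 then 3
     else if q = 3 then if a 0 = 0 then 5 else 4
     else if q = 4 then if a 0 = 0 then 5 else 3
     else if q = 5 then if a 0 = 0 then 7 + idx [K] else 5
     else if q = 6 then if a 0 = 0 then 1 else 6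
     else if q < 7 then q
     else if dec (q - 7) = [] then 6
     else if a 2 = 1 then 2
     else 7 + idx (next_com (\<lambda>r. a (r + 3) \<noteq> 1) (dec (q - 7))))"

fun instr_action :: "(nat \<Rightarrow> nat) \<Rightarrow> com list \<Rightarrow> nat \<Rightarrow> nat \<times> move" where
  "instr_action a (Inc r # l) j = (a j, if j = r + 3 then Right else Stay)"
| "instr_action a (Dec r # l) j = (a j, if j = r + 3 \<and> a j \<noteq> 1 then Left else Stay)"
| "instr_action a (Read r # l) j = (a j, if j = 0 \<or> j = r + 3 \<and> a 0 = 2 then Right else Stay)"
| "instr_action a (Out r # l) j = (if j = 1 then (if a (r + 3) = 1 then 1 else 2, Right) else (a j, Stay))"
| "instr_action a l j = (a j, Stay)"

definition action :: "nat \<Rightarrow> (nat \<Rightarrow> nat) \<Rightarrow> nat \<Rightarrow> nat \<times> move" where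
  "action q a j =
    (if q = 0 then (if j < 2 then a j else 1, Stay)
     else if q = 3 then (a j, if j = 0 then if a 0 = 0 then Left else Right else Stay)
     else if q = 4 then (a j, if j = 0 then if a 0 = 0 then Left else Right
       else if j = 2 \<and> a 0 \<noteq> 0 then Right else Stay)
     else if q = 5 then (a j, if j = 0 then if a 0 = 0 then Right else Left else Stay)
     else if q = 6 then if a 0 = 0 then (a j, Stay)
       else (if j = 1 then a 0 else a j, if j < 2 then Right else Stay)
     else if q < 7 then (a j, Stay)
     else if dec (q - 7) = [] \<or> a 2 = 1 then (a j, Stay)
     else if j = 2 then (a j, Left)
     else instr_action a (dec (q - 7)) j)"

text \<open>
  Outside of the tapes a fixed value is returned, so that states and actions may be functions of all of
  \<open>nat \<Rightarrow> nat\<close>.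
\<close>

definition reading :: "nat list \<Rightarrow> nat \<Rightarrow> nat" where
  "reading ss j = (if j < n then ss ! j else 0)"

definition machine :: dtm where
  "machine = \<lparr>tapes = n, states = 7 + card C, symbols = 3,
     trans = (\<lambda>q ss. (next_state q (reading ss), map (action q (reading ss)) [0..<n]))\<rparr>"

lemma instr_action_less: "(\<And>i. a i < 3) \<Longrightarrow> fst (instr_action a l j) < 3"
  by (cases "(a, l, j)" rule: instr_action.cases) auto

lemma wf_machine: "wf_dtm machine"
proof -
  have "C \<noteq> {}" by (simp add: C_def)
  then have "0 < card C" using finite_C by (simp add: card_gt_0_iff)
  moreover have "next_state q a < 7 + card C" if "q < 7 + card C" for q a
  proof -
    have "7 \<le> q \<Longrightarrow> dec (q - 7) \<in> C" by (rule dec_C) (use that in auto)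
    from idx_less[OF next_com_C[OF this]] show ?thesis
      using idx_less[OF K_C] calculation that by (auto simp: next_state_def not_less)
  qed
  moreover have "fst (action q a j) < 3" if a: "\<And>i. a i < 3" for q a j
    using a[of j] a[of 0] instr_action_less[of a, OF a] by (auto simp: action_def)
  moreover have "reading ss j < 3" if "length ss = n" "set ss \<subseteq> {..<3}" for ss j
    using that by (auto simp: reading_def subset_iff)
  ultimately show ?thesis
    by (auto simp: wf_dtm_def machine_def)
qed

definition scan :: "(nat \<Rightarrow> tape) \<Rightarrow> nat \<Rightarrow> nat" where
  "scan t j = (if j < n then fst (t j) (snd (t j)) else 0)"

lemma step_machine:
  assumes "q \<noteq> 1" "q \<noteq> 2" "q' = next_state q (scan t)"
    and "\<And>j. j < n \<Longrightarrow> t' j = act (action q (scan t) j) (t j)"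
  shows "step machine (q, map t [0..<n]) = (q', map t' [0..<n])"
proof -
  let ?ss = "map (\<lambda>(t, h). t h) (map t [0..<n])"
  have r: "reading ?ss = scan t"
    by (auto simp: reading_def scan_def fun_eq_iff split_beta simp del: upt_Suc)
  have "map2 act (map (action q (scan t)) [0..<n]) (map t [0..<n]) = map t' [0..<n]"
    by (rule nth_equalityI) (use assms(4) in \<open>auto simp del: upt_Suc\<close>)
  moreover have "dtm.trans machine q ?ss = (next_state q (scan t), map (action q (scan t)) [0..<n])"
    unfolding r[symmetric] by (simp add: machine_def)
  ultimately show ?thesis using assms(1-3) by (simp add: step.simps del: map_map upt_Suc map_append)
qed

text \<open>
  Input \<open>v\<close> with head at \<open>z\<close>, output \<open>u\<close>, clock \<open>k\<close> and counters \<open>\<sigma>\<close>. The position \<open>z\<close> is an integer because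
  rewinding ends at the cell to the left of the input.
\<close>

definition layout :: "word \<Rightarrow> int \<Rightarrow> word \<Rightarrow> nat \<Rightarrow> (nat \<Rightarrow> nat) \<Rightarrow> nat \<Rightarrow> tape" where
  "layout v z u k \<sigma> j = (if j = 0 then (word_tape v, z) else if j = 1 then (word_tape u, int (length u))
     else if j = 2 then counter k else counter (\<sigma> (j - 3)))"

abbreviation config_at :: "nat \<Rightarrow> word \<Rightarrow> int \<Rightarrow> word \<Rightarrow> nat \<Rightarrow> (nat \<Rightarrow> nat) \<Rightarrow> config" where
  "config_at q v z u k \<sigma> \<equiv> (q, map (layout v z u k \<sigma>) [0..<n])"

lemma scan_layout:
  "scan (layout v z u k \<sigma>) 0 = word_tape v z"
  "scan (layout v z u k \<sigma>) (Suc 0) = 0"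
  "scan (layout v z u k \<sigma>) 2 = of_bool (k = 0)"
  "r < R \<Longrightarrow> scan (layout v z u k \<sigma>) (r + 3) = of_bool (\<sigma> r = 0)"
  by (auto simp: scan_def layout_def counter_def word_tape_def)

lemma act_same: "j < n \<Longrightarrow> act (scan t j, d) (t j) = (fst (t j), move_head d (snd (t j)))"
  by (cases "t j") (simp add: scan_def)

lemma init_config: "step machine (init machine v) = config_at 3 v 0 [] 0 (\<lambda>_. 0)"
proof -
  let ?t = "\<lambda>j. if j = 0 then (word_tape v, 0) else (word_tape [], 0)"
  have i: "init machine v = (0, map ?t [0..<n])"
    by (auto simp: init_def machine_def intro!: nth_equalityI simp: nth_Cons simp del: upt_Suc split: nat.split)
  show ?thesis unfolding i
  proof (rule step_machine)
    fix j assume "j < n"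
    then show "layout v 0 [] 0 (\<lambda>_. 0) j = act (action 0 (scan ?t) j) (?t j)"
      by (auto simp: layout_def action_def scan_def counter_def word_tape_def fun_eq_iff)
  qed (auto simp: next_state_def)
qed

lemma word_tape_pos: "word_tape v (int m) = 0 \<longleftrightarrow> length v \<le> m"
  by (auto simp: word_tape_def)

lemma count_phase:
  "m \<le> length v \<Longrightarrow> (step machine ^^ m) (config_at 3 v 0 [] 0 (\<lambda>_. 0))
    = config_at (if even m then 3 else 4) v (int m) [] (m div 2) (\<lambda>_. 0)"
proof (induction m)
  case (Suc m)
  have "step machine (config_at (if even m then 3 else 4) v (int m) [] (m div 2) (\<lambda>_. 0))
    = config_at (if even (Suc m) then 3 else 4) v (int (Suc m)) [] (Suc m div 2) (\<lambda>_. 0)"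
  proof (rule step_machine)
    fix j assume "j < n"
    then show "layout v (int (Suc m)) [] (Suc m div 2) (\<lambda>_. 0) j =
        act (action (if even m then 3 else 4) (scan (layout v (int m) [] (m div 2) (\<lambda>_. 0))) j)
          (layout v (int m) [] (m div 2) (\<lambda>_. 0) j)"
      using Suc.prems by (auto simp: action_def act_same scan_layout word_tape_pos)
        (auto simp: layout_def counter_def)
  qed (use Suc.prems in \<open>auto simp: next_state_def scan_layout word_tape_pos\<close>)
  then show ?case using Suc by simp
qed simp

lemma turn_phase:
  "step machine (config_at (if even (length v) then 3 else 4) v (int (length v)) [] k (\<lambda>_. 0))
    = config_at 5 v (int (length v) - 1) [] k (\<lambda>_. 0)"
proof (rule step_machine)
  fix j assume "j < n"
  then show "layout v (int (length v) - 1) [] k (\<lambda>_. 0) j =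
      act (action (if even (length v) then 3 else 4) (scan (layout v (int (length v)) [] k (\<lambda>_. 0))) j)
        (layout v (int (length v)) [] k (\<lambda>_. 0) j)"
    by (auto simp: action_def act_same scan_layout word_tape_pos) (auto simp: layout_def)
qed (auto simp: next_state_def scan_layout word_tape_pos)

lemma rewind_phase:
  "m \<le> length v \<Longrightarrow> (step machine ^^ Suc m) (config_at 5 v (int m - 1) [] k (\<lambda>_. 0))
    = config_at (7 + idx [K]) v 0 [] k (\<lambda>_. 0)"
proof (induction m)
  case 0
  have "step machine (config_at 5 v (- 1) [] k (\<lambda>_. 0)) = config_at (7 + idx [K]) v 0 [] k (\<lambda>_. 0)"
  proof (rule step_machine)
    fix j assume "j < n"
    then show "layout v 0 [] k (\<lambda>_. 0) j =
        act (action 5 (scan (layout v (- 1) [] k (\<lambda>_. 0))) j) (layout v (- 1) [] k (\<lambda>_. 0) j)"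
      by (auto simp: action_def act_same scan_layout word_tape_def) (auto simp: layout_def)
  qed (auto simp: next_state_def scan_layout word_tape_def)
  then show ?case by simp
next
  case (Suc m)
  have "step machine (config_at 5 v (int m) [] k (\<lambda>_. 0)) = config_at 5 v (int m - 1) [] k (\<lambda>_. 0)"
  proof (rule step_machine)
    fix j assume "j < n"
    then show "layout v (int m - 1) [] k (\<lambda>_. 0) j =
        act (action 5 (scan (layout v (int m) [] k (\<lambda>_. 0))) j) (layout v (int m) [] k (\<lambda>_. 0) j)"
      using Suc.prems by (auto simp: action_def act_same scan_layout word_tape_pos) (auto simp: layout_def)
  qed (use Suc.prems in \<open>auto simp: next_state_def scan_layout word_tape_pos\<close>)
  moreover have "int (Suc m) - 1 = int m" by simp
  ultimately show ?case using Suc by (simp only: funpow_Suc_right comp_apply)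
qed

lemma word_tape_snoc: "(word_tape u)(int (length u) := (if b then 2 else 1)) = word_tape (u @ [b])"
  by (auto simp: word_tape_def fun_eq_iff nth_append)

lemma next_com_cong:
  assumes "\<And>r. r < reg_bound c \<Longrightarrow> z r = z' r" shows "next_com z (c # l) = next_com z' (c # l)"
  using assms by (cases c) auto

lemma simulation_step:
  assumes "c # l \<in> C" "exec1 (stream v) (c # l, \<sigma>, p, u) = (l', \<sigma>', p', u')"
  shows "step machine (config_at (7 + idx (c # l)) v (int p) u (Suc k) \<sigma>) = config_at (7 + idx l') v (int p') u' k \<sigma>'"
proof (rule step_machine)
  let ?a = "scan (layout v (int p) u (Suc k) \<sigma>)"
  have R: "reg_bound c \<le> R" by (rule reg_bound_C[OF assms(1)])
  have a: "?a 0 = word_tape v (int p)" "?a (Suc 0) = 0" "?a 2 = 0" "\<And>r. r < R \<Longrightarrow> ?a (r + 3) = of_bool (\<sigma> r = 0)"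
    by (simp_all add: scan_layout)
  have l': "l' = next_com (\<lambda>r. \<sigma> r \<noteq> 0) (c # l)"
    using fst_exec1[of "stream v" "c # l" \<sigma> p u] assms(2) by simp
  also have "\<dots> = next_com (\<lambda>r. ?a (r + 3) \<noteq> 1) (c # l)"
    by (rule next_com_cong) (use R a(4) in auto)
  finally show "7 + idx l' = next_state (7 + idx (c # l)) ?a"
    using assms(1) a by (simp add: next_state_def)
  fix j assume j: "j < n"
  have "action (7 + idx (c # l)) ?a j = (if j = 2 then (?a j, Left) else instr_action ?a (c # l) j)"
    using assms(1) a by (simp add: action_def)
  moreover have "layout v (int p') u' k \<sigma>' j =
      act (if j = 2 then (?a j, Left) else instr_action ?a (c # l) j) (layout v (int p) u (Suc k) \<sigma> j)"
  proof (cases "j = 2")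
    case True
    then show ?thesis using j by (simp add: act_same) (simp add: layout_def counter_def)
  next
    case False
    then show ?thesis
    proof (cases c)
      case (Inc r)
      then show ?thesis using False j assms(2) by (auto simp: act_same) (auto simp: layout_def counter_def)
    next
      case (Dec r)
      then have "r < R" using R by simp
      then show ?thesis using False j assms(2) Dec a(4)[of r] by (auto simp: act_same) (auto simp: layout_def counter_def)
    next
      case (Read r)
      have "word_tape v (int p) = 2 \<longleftrightarrow> stream v p" by (auto simp: word_tape_def stream_def)
      then show ?thesis using False j assms(2) Read a(1) by (auto simp: act_same) (auto simp: layout_def counter_def)
    next
      case (Out r)
      then have "r < R" using R by simp
      then show ?thesis using False j assms(2) Out a(4)[of r] word_tape_snoc[of u True] word_tape_snoc[of u False]
        by (auto simp: act_same) (auto simp: layout_def)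
    qed (use False j assms(2) in \<open>auto simp: act_same\<close>, auto simp: layout_def)
  qed
  ultimately show "layout v (int p') u' k \<sigma>' j = act (action (7 + idx (c # l)) ?a j) (layout v (int p) u (Suc k) \<sigma> j)"
    by simp
qed auto

lemma conf_C: "fst (conf K s m) \<in> C"
proof (induction m)
  case 0
  show ?case using K_C by (simp add: conf_def)
next
  case (Suc m)
  obtain l \<sigma> p u where "conf K s m = (l, \<sigma>, p, u)" by (metis surj_pair)
  then show ?case using Suc next_com_C fst_exec1[of s l \<sigma> p u] by (simp add: conf_Suc)
qed

lemma simulation_phase:
  assumes "m \<le> k" "\<And>i. i < m \<Longrightarrow> fst (conf K (stream v) i) \<noteq> []" "conf K (stream v) m = (l, \<sigma>, p, u)"
  shows "(step machine ^^ m) (config_at (7 + idx [K]) v 0 [] k (\<lambda>_. 0)) = config_at (7 + idx l) v (int p) u (k - m) \<sigma>"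
  using assms
proof (induction m arbitrary: l \<sigma> p u)
  case 0
  then show ?case by (simp add: conf_def)
next
  case (Suc m)
  obtain l1 \<sigma>1 q1 u1 where 1: "conf K (stream v) m = (l1, \<sigma>1, q1, u1)" by (metis surj_pair)
  then have "l1 \<noteq> []" using Suc.prems(2)[of m] by simp
  then obtain c l2 where l1: "l1 = c # l2" by (cases l1) auto
  have "(step machine ^^ m) (config_at (7 + idx [K]) v 0 [] k (\<lambda>_. 0)) = config_at (7 + idx l1) v (int q1) u1 (Suc (k - Suc m)) \<sigma>1"
    using Suc.IH[OF _ _ 1] Suc.prems by (simp add: Suc_diff_Suc)
  moreover have "step machine (config_at (7 + idx l1) v (int q1) u1 (Suc (k - Suc m)) \<sigma>1) = config_at (7 + idx l) v (int p) u (k - Suc m) \<sigma>"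
    unfolding l1 using conf_C[of "stream v" m] Suc.prems(3) 1 by (intro simulation_step) (auto simp: l1 conf_Suc)
  ultimately show ?case by simp
qed

lemma finish_phase: "step machine (config_at (7 + idx []) v z u k \<sigma>) = config_at 6 v z u k \<sigma>"
proof (rule step_machine)
  have "[] \<in> C" by (simp add: C_def)
  then show "6 = next_state (7 + idx []) (scan (layout v z u k \<sigma>))" by (simp add: next_state_def)
  fix j assume "j < n"
  then show "layout v z u k \<sigma> j = act (action (7 + idx []) (scan (layout v z u k \<sigma>)) j) (layout v z u k \<sigma> j)"
    using \<open>[] \<in> C\<close> by (simp add: action_def act_same)
qed auto

lemma timeout_phase:
  assumes "l \<in> C" "l \<noteq> []" shows "step machine (config_at (7 + idx l) v z u 0 \<sigma>) = config_at 2 v z u 0 \<sigma>"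
proof (rule step_machine)
  show "2 = next_state (7 + idx l) (scan (layout v z u 0 \<sigma>))" using assms by (simp add: next_state_def scan_layout)
  fix j assume "j < n"
  then show "layout v z u 0 \<sigma> j = act (action (7 + idx l) (scan (layout v z u 0 \<sigma>)) j) (layout v z u 0 \<sigma> j)"
    using assms by (simp add: action_def act_same scan_layout)
qed auto

lemma copy_phase:
  "p \<le> length v \<Longrightarrow> (step machine ^^ Suc (length v - p)) (config_at 6 v (int p) u k \<sigma>)
     = config_at 1 v (int (length v)) (u @ drop p v) k \<sigma>"
proof (induction "length v - p" arbitrary: p u)
  case 0
  then have p: "p = length v" by simp
  have "step machine (config_at 6 v (int (length v)) u k \<sigma>) = config_at 1 v (int (length v)) u k \<sigma>"
  proof (rule step_machine)
    fix j assume "j < n"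
    then show "layout v (int (length v)) u k \<sigma> j =
        act (action 6 (scan (layout v (int (length v)) u k \<sigma>)) j) (layout v (int (length v)) u k \<sigma> j)"
      by (auto simp: action_def act_same scan_layout word_tape_pos)
  qed (auto simp: next_state_def scan_layout word_tape_pos)
  then show ?case using p by simp
next
  case (Suc m)
  then have p: "p < length v" by simp
  have "step machine (config_at 6 v (int p) u k \<sigma>) = config_at 6 v (int (Suc p)) (u @ [v ! p]) k \<sigma>"
  proof (rule step_machine)
    fix j assume "j < n"
    have "word_tape v (int p) = (if v ! p then 2 else 1)" using p by (simp add: word_tape_def)
    then show "layout v (int (Suc p)) (u @ [v ! p]) k \<sigma> j =
        act (action 6 (scan (layout v (int p) u k \<sigma>)) j) (layout v (int p) u k \<sigma> j)"
      using \<open>j < n\<close> word_tape_snoc[of u "v ! p"]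
      by (auto simp: action_def act_same scan_layout) (auto simp: layout_def)
  qed (use p in \<open>auto simp: next_state_def scan_layout word_tape_pos\<close>)
  moreover have "(step machine ^^ Suc (length v - Suc p)) (config_at 6 v (int (Suc p)) (u @ [v ! p]) k \<sigma>)
     = config_at 1 v (int (length v)) ((u @ [v ! p]) @ drop (Suc p) v) k \<sigma>"
    by (rule Suc.hyps(1)) (use Suc.hyps(2) p in auto)
  moreover have "length v - p = Suc (length v - Suc p)" using p by simp
  ultimately show ?case
    using p by (simp only: funpow_Suc_right comp_apply) (simp add: Cons_nth_drop_Suc)
qed

lemma computes: "computes_in_time machine (clocked K) (poly [:5, 4:])"
  unfolding computes_in_time_def
proof
  fix v :: word
  let ?k = "length v div 2"
  let ?good = "\<lambda>(q, ts). case clocked K v of Some y \<Rightarrow> q = 1 \<and> fst (ts ! 1) = word_tape y | None \<Rightarrow> q = 2"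
  have first: "(step machine ^^ 1) (init machine v) = config_at 3 v 0 [] 0 (\<lambda>_. 0)"
    by (simp only: funpow_0 One_nat_def funpow.simps comp_apply id_apply init_config)
  have turn: "(step machine ^^ 1) (config_at (if even (length v) then 3 else 4) v (int (length v)) [] ?k (\<lambda>_. 0))
      = config_at 5 v (int (length v) - 1) [] ?k (\<lambda>_. 0)"
    by (simp only: funpow_0 One_nat_def funpow.simps comp_apply id_apply turn_phase)
  have "(step machine ^^ (1 + length v + 1)) (init machine v) = config_at 5 v (int (length v) - 1) [] ?k (\<lambda>_. 0)"
    by (rule funpow_trans[OF funpow_trans[OF first count_phase[OF order.refl]] turn])
  from funpow_trans[OF this rewind_phase]
  have start: "(step machine ^^ (1 + length v + 1 + Suc (length v))) (init machine v) = config_at (7 + idx [K]) v 0 [] ?k (\<lambda>_. 0)"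
    by simp
  have "\<exists>t \<le> poly [:5, 4:] (length v). \<exists>cfg. (step machine ^^ t) (init machine v) = cfg \<and> ?good cfg \<and> fst cfg \<in> {1, 2}"
  proof (cases "fst (conf K (stream v) ?k) = []")
    case True
    define m where "m = (LEAST m. fst (conf K (stream v) m) = [])"
    have m: "fst (conf K (stream v) m) = []" unfolding m_def by (rule LeastI[of _ ?k]) (rule True)
    have mk: "m \<le> ?k" unfolding m_def by (rule Least_le) (rule True)
    have "fst (conf K (stream v) i) \<noteq> []" if "i < m" for i
      using that not_less_Least unfolding m_def by blast
    moreover obtain \<sigma> p u where c: "conf K (stream v) m = ([], \<sigma>, p, u)" using m by (metis surj_pair fst_conv)
    ultimately have "(step machine ^^ m) (config_at (7 + idx [K]) v 0 [] ?k (\<lambda>_. 0)) = config_at (7 + idx []) v (int p) u (?k - m) \<sigma>"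
      using mk by (intro simulation_phase) auto
    from funpow_trans[OF start this]
    have 1: "(step machine ^^ (1 + length v + 1 + Suc (length v) + m + 1)) (init machine v) = config_at 6 v (int p) u (?k - m) \<sigma>"
      by (rule funpow_trans) (simp add: finish_phase)
    have p: "p \<le> length v" using conjunct1[OF conf_pos_out[OF c]] mk by linarith
    have "(step machine ^^ (1 + length v + 1 + Suc (length v) + m + 1 + Suc (length v - p))) (init machine v) =
      config_at 1 v (int (length v)) (u @ drop p v) (?k - m) \<sigma>"
      by (rule funpow_trans[OF 1 copy_phase[OF p]])
    moreover have "clocked K v = Some (u @ drop p v)"
      by (rule clockedI[OF c]) (use mk in auto)
    ultimately show ?thesis using mk
      by (intro exI[of _ "1 + length v + 1 + Suc (length v) + m + 1 + Suc (length v - p)"] conjI exI[of _ "config_at 1 v (int (length v)) (u @ drop p v) (?k - m) \<sigma>"])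
        (auto simp: layout_def simp del: upt_Suc)
  next
    case False
    obtain l \<sigma> p u where c: "conf K (stream v) ?k = (l, \<sigma>, p, u)" by (metis surj_pair)
    have "fst (conf K (stream v) i) \<noteq> []" if "i < ?k" for i
    proof
      assume "fst (conf K (stream v) i) = []"
      then obtain st where "conf K (stream v) i = ([], st)" by (metis prod.collapse)
      from conf_halted[OF this, of ?k] that False show False by simp
    qed
    then have "(step machine ^^ ?k) (config_at (7 + idx [K]) v 0 [] ?k (\<lambda>_. 0)) = config_at (7 + idx l) v (int p) u (?k - ?k) \<sigma>"
      using c by (intro simulation_phase) auto
    from funpow_trans[OF start this]
    have 1: "(step machine ^^ (1 + length v + 1 + Suc (length v) + ?k)) (init machine v) = config_at (7 + idx l) v (int p) u 0 \<sigma>"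
      by simp
    have l: "l \<in> C" "l \<noteq> []" using conf_C[of "stream v" ?k] False c by auto
    have 2: "(step machine ^^ (1 + length v + 1 + Suc (length v) + ?k + 1)) (init machine v) = config_at 2 v (int p) u 0 \<sigma>"
      by (rule funpow_trans[OF 1]) (simp add: timeout_phase[OF l])
    have le: "1 + length v + 1 + Suc (length v) + ?k + 1 \<le> poly [:5, 4:] (length v)" by simp
    have "clocked K v = None" using l c by (simp add: clocked_def)
    then have good: "?good (config_at 2 v (int p) u 0 \<sigma>) \<and> fst (config_at 2 v (int p) u 0 \<sigma>) \<in> {1, 2}"
      by simp
    show ?thesis
      by (rule exI, rule conjI[OF le], rule exI, rule conjI[OF 2 good])
  qed
  then obtain t cfg where t: "t \<le> poly [:5, 4:] (length v)" "(step machine ^^ t) (init machine v) = cfg"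
    "?good cfg" "fst cfg \<in> {1, 2}" by (elim exE conjE) (rule that; assumption)
  have "step machine cfg = cfg"
    using t(4) by (cases cfg) (auto simp: step.simps)
  then have "(step machine ^^ i) cfg = cfg" for i
    by (induction i) simp_all
  from funpow_trans[OF t(2) this, of "poly [:5, 4:] (length v) - t"] t(1,3)
  show "?good ((step machine ^^ poly [:5, 4:] (length v)) (init machine v))"
    by simp
qed

lemma clocked_RMP: "clocked K \<in> carrier RMP"
  using wf_machine computes poly_balanced_clocked ideal_morphism_clocked
  by (auto simp: RMP_def fP_def poly_time_def)

end

section \<open>Padding a computable morphism into polynomial time\<close>

definition pref :: "(nat \<Rightarrow> bool) \<Rightarrow> nat \<Rightarrow> word" where
  "pref s i = map s [0..<i]"

lemma code_pref_Suc: "code (pref s (Suc i)) = 2 * code (pref s i) + of_bool (s i)"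
  by (simp add: pref_def)

lemma pref_stream: "i \<le> length v \<Longrightarrow> pref (stream v) i = take i v"
  by (rule nth_equalityI) (auto simp: pref_def stream_def)

lemma bits_of_code: "map (\<lambda>j. odd (code y div 2 ^ j)) (rev [0..<length y]) = y"
proof (rule nth_equalityI)
  fix i assume "i < length (map (\<lambda>j. odd (code y div 2 ^ j)) (rev [0..<length y]))"
  then show "map (\<lambda>j. odd (code y div 2 ^ j)) (rev [0..<length y]) ! i = y ! i"
    using code_nth[of i y] by (simp add: rev_nth)
qed simp

lemma runs_creg: "creg c \<sigma> \<sigma>' \<Longrightarrow> runs s c (\<sigma>, p, u) (\<sigma>', p, u)"
  by (simp add: creg_def)

lemma conf_run:
  assumes "conf K s n = (c # l, st)" "runs s c st st'"
  shows "\<exists>m. conf K s m = (l, st')"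
proof -
  obtain m where "(exec1 s ^^ m) (c # l, st) = (l, st')" using assms(2) unfolding runs_def by blast
  from funpow_trans[OF assms(1)[unfolded conf_def] this] show ?thesis unfolding conf_def by blast
qed

lemma conf_step:
  assumes "conf K s n = cfg" shows "\<exists>m. conf K s m = exec1 s cfg"
  using assms by (intro exI[of _ "Suc n"]) (simp add: conf_Suc)

text \<open>
  The program reads letters until the prefix read so far has a nonzero value, and then writes out the word
  with this code. Register 0 holds the code of the prefix, and register 1 says whether to go on.
\<close>

lemma search_program:
  assumes H: "computable H"
  obtains K where
    "\<And>s i y. (\<And>j. j < i \<Longrightarrow> H (code (pref s j)) = 0) \<Longrightarrow> H (code (pref s i)) = code y \<Longrightarrow>
       \<exists>n \<sigma>. conf K s n = ([], \<sigma>, i, y)"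
    "\<And>s n. (\<And>i. H (code (pref s i)) = 0) \<Longrightarrow> fst (conf K s n) \<noteq> []"
proof -
  let ?T = "\<lambda>x. of_bool (H x = 0) :: nat"
  let ?bit = "\<lambda>p. (H (p1 p) div 2 ^ p2 p) mod 2"
  have "computable ?T" by (intro computable_intros H)
  then obtain t where t: "implements 1 t ?T" by (rule computableE)
  have "computable (\<lambda>x. 2 * x)" by (intro computable_intros)
  then obtain d where d: "implements 0 d (\<lambda>x. 2 * x)" by (rule computableE)
  have "computable (\<lambda>x. len (H x))" by (intro computable_len H)
  then obtain e where e: "implements 1 e (\<lambda>x. len (H x))" by (rule computableE)
  have "computable ?bit" by (intro computable_intros computable_comp[OF H])
  then obtain b where b: "implements 2 b ?bit" by (rule computableE)
  define test where "test = copy 0 1 2 ;; t"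
  \<comment> \<open>doubling the code and adding the letter appends the letter to the prefix\<close>
  define body where "body = d ;; Read 0 ;; test"
  define loop where "loop = While 1 body"
  \<comment> \<open>the letters are the binary digits of the value below the leading one, from the most significant on\<close>
  define put where "put = While 1 (Dec 1 ;; copy 0 3 5 ;; copy 1 4 5 ;; pairing 2 3 4 ;; b ;; Out 2)"
  define outp where "outp = copy 0 1 2 ;; e ;; put"
  define K where "K = Inc 0 ;; test ;; loop ;; outp"
  have test: "\<exists>\<sigma>'. creg test \<sigma> \<sigma>' \<and> \<sigma>' 0 = \<sigma> 0 \<and> \<sigma>' 1 = ?T (\<sigma> 0)" for \<sigma>
  proof -
    let ?s0 = "\<sigma>(1 := \<sigma> 0, 2 := 0)"
    obtain s1 where s1: "creg t ?s0 s1" "s1 1 = ?T (?s0 1)" "\<forall>r<1. s1 r = ?s0 r"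
      using implementsD[OF t] by blast
    have "creg test \<sigma> s1" unfolding test_def by (rule creg_Seq[OF creg_copy s1(1)]) auto
    then show ?thesis using s1(2,3) by (intro exI[of _ s1]) auto
  qed
  have body: "\<exists>\<sigma>'. runs s body (\<sigma>, i, u) (\<sigma>', Suc i, u) \<and> \<sigma>' 0 = 2 * \<sigma> 0 + of_bool (s i) \<and> \<sigma>' 1 = ?T (\<sigma>' 0)"
    for s \<sigma> i u
  proof -
    obtain s1 where s1: "creg d \<sigma> s1" "s1 0 = 2 * \<sigma> 0"
      using implementsD[OF d] by blast
    let ?s2 = "s1(0 := s1 0 + of_bool (s i))"
    obtain s3 where s3: "creg test ?s2 s3" "s3 0 = ?s2 0" "s3 1 = ?T (?s2 0)" using test by blast
    have "runs s body (\<sigma>, i, u) (s3, Suc i, u)"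
      unfolding body_def
      by (rule runs_Seq[OF runs_creg[OF s1(1)] runs_Seq[OF runs_step runs_creg[OF s3(1)]]]) simp
    then show ?thesis using s1(2) s3(2,3) by (intro exI[of _ s3]) auto
  qed
  have put: "\<exists>\<sigma>'. runs s put (\<sigma>, i, u) (\<sigma>', i, u @ map (\<lambda>j. odd (H x div 2 ^ j)) (rev [0..<m]))"
    if "\<sigma> 0 = x" "\<sigma> 1 = m" for s \<sigma> i u x m
    using that
  proof (induction m arbitrary: \<sigma> u)
    case 0
    then show ?case unfolding put_def by (intro exI[of _ \<sigma>]) (auto intro!: runs_While_0)
  next
    case (Suc m)
    let ?s = "\<sigma>(1 := m, 3 := x, 5 := 0, 4 := m, 2 := pr x m, 3 := 0, 4 := 0)"
    obtain s1 where s1: "creg b ?s s1" "s1 2 = ?bit (?s 2)" "\<forall>r<2. s1 r = ?s r"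
      using implementsD[OF b] by blast
    have 1: "creg (Dec 1) \<sigma> (\<sigma>(1 := m))" using Suc.prems by (intro creg_Dec) simp
    have 2: "creg (copy 0 3 5) (\<sigma>(1 := m)) (\<sigma>(1 := m, 3 := x, 5 := 0))"
      using Suc.prems by (intro creg_copy) auto
    have 3: "creg (copy 1 4 5) (\<sigma>(1 := m, 3 := x, 5 := 0)) (\<sigma>(1 := m, 3 := x, 5 := 0, 4 := m))"
      by (intro creg_copy) (auto simp: fun_eq_iff)
    have 4: "creg (pairing 2 3 4) (\<sigma>(1 := m, 3 := x, 5 := 0, 4 := m)) ?s"
      using creg_pairing[of 2 3 4 "\<sigma>(1 := m, 3 := x, 5 := 0, 4 := m)"] by simp
    have 5: "runs s (Out 2) (s1, i, u) (s1, i, u @ [odd (H x div 2 ^ m)])"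
      by (rule runs_step) (simp add: s1(2) odd_iff_mod_2_eq_one)
    have round: "runs s (Dec 1 ;; copy 0 3 5 ;; copy 1 4 5 ;; pairing 2 3 4 ;; b ;; Out 2) (\<sigma>, i, u)
        (s1, i, u @ [odd (H x div 2 ^ m)])"
      by (rule runs_Seq[OF runs_creg[OF 1] runs_Seq[OF runs_creg[OF 2] runs_Seq[OF runs_creg[OF 3]
            runs_Seq[OF runs_creg[OF 4] runs_Seq[OF runs_creg[OF s1(1)] 5]]]]])
    have "s1 0 = x" "s1 1 = m" using s1(3) Suc.prems by auto
    from Suc.IH[OF this] obtain \<sigma>' where
      "runs s put (s1, i, u @ [odd (H x div 2 ^ m)])
         (\<sigma>', i, (u @ [odd (H x div 2 ^ m)]) @ map (\<lambda>j. odd (H x div 2 ^ j)) (rev [0..<m]))" by blast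
    then have "runs s put (\<sigma>, i, u) (\<sigma>', i, (u @ [odd (H x div 2 ^ m)]) @ map (\<lambda>j. odd (H x div 2 ^ j)) (rev [0..<m]))"
      unfolding put_def by (intro runs_While_Suc[OF _ round]) (use Suc.prems in auto)
    then show ?case by (intro exI[of _ \<sigma>']) simp
  qed
  have outp: "\<exists>\<sigma>'. runs s outp (\<sigma>, i, []) (\<sigma>', i, y)" if y: "H (\<sigma> 0) = code y" for s \<sigma> i y
  proof -
    let ?s0 = "\<sigma>(1 := \<sigma> 0, 2 := 0)"
    obtain s1 where s1: "creg e ?s0 s1" "s1 1 = len (H (?s0 1))" "\<forall>r<1. s1 r = ?s0 r"
      using implementsD[OF e] by blast
    have c: "creg (copy 0 1 2) \<sigma> ?s0" by (rule creg_copy) auto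
    have "s1 0 = \<sigma> 0" "s1 1 = length y" using s1(2,3) y by auto
    from put[OF this, of s i "[]"] obtain s2 where
      "runs s put (s1, i, []) (s2, i, y)" by (auto simp: y bits_of_code)
    from runs_Seq[OF runs_creg[OF c] runs_Seq[OF runs_creg[OF s1(1)] this]]
    show ?thesis unfolding outp_def by blast
  qed
  have head: "\<exists>n \<sigma>. conf K s n = ([loop, outp], \<sigma>, i, []) \<and> \<sigma> 0 = code (pref s i) \<and> \<sigma> 1 = ?T (\<sigma> 0)"
    if "\<And>j. j < i \<Longrightarrow> H (code (pref s j)) = 0" for s i
    using that
  proof (induction i)
    case 0
    have "conf K s 0 = ([K], (\<lambda>_. 0), 0, [])" by (simp add: conf_def)
    from conf_step[OF this] obtain n where
      "conf K s n = ([Inc 0, test ;; loop ;; outp], (\<lambda>_. 0), 0, [])" by (auto simp: K_def)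
    from conf_step[OF this] obtain n where
      "conf K s n = ([test ;; loop ;; outp], (\<lambda>_. 0)(0 := 1), 0, [])" by auto
    from conf_step[OF this] obtain n where
      n: "conf K s n = ([test, loop ;; outp], (\<lambda>_. 0)(0 := 1), 0, [])" by auto
    obtain \<sigma> where \<sigma>: "creg test ((\<lambda>_. 0)(0 := 1)) \<sigma>" "\<sigma> 0 = 1" "\<sigma> 1 = ?T 1"
      using test[of "(\<lambda>_. 0)(0 := 1)"] by auto
    from conf_run[OF n runs_creg[OF \<sigma>(1)]] obtain n where
      "conf K s n = ([loop ;; outp], \<sigma>, 0, [])" by blast
    from conf_step[OF this] obtain n where "conf K s n = ([loop, outp], \<sigma>, 0, [])" by auto
    moreover have "\<sigma> 0 = code (pref s 0)" "\<sigma> 1 = ?T (\<sigma> 0)" using \<sigma>(2,3) by (auto simp: pref_def)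
    ultimately show ?case by blast
  next
    case (Suc i)
    then obtain n \<sigma> where n: "conf K s n = ([loop, outp], \<sigma>, i, [])" "\<sigma> 0 = code (pref s i)" "\<sigma> 1 = ?T (\<sigma> 0)"
      by (metis less_SucI)
    have "\<sigma> 1 \<noteq> 0" using n(2,3) Suc.prems[of i] by simp
    with conf_step[OF n(1)] obtain n' where n': "conf K s n' = ([body, loop, outp], \<sigma>, i, [])"
      by (auto simp: loop_def)
    obtain \<sigma>' where \<sigma>': "runs s body (\<sigma>, i, []) (\<sigma>', Suc i, [])" "\<sigma>' 0 = 2 * \<sigma> 0 + of_bool (s i)" "\<sigma>' 1 = ?T (\<sigma>' 0)"
      using body by blast
    from conf_run[OF n' \<sigma>'(1)] show ?case
      using \<sigma>'(2,3) n(2) unfolding code_pref_Suc by metis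
  qed
  show ?thesis
  proof (rule that)
    fix s i y assume none: "\<And>j. j < i \<Longrightarrow> H (code (pref s j)) = 0" and y: "H (code (pref s i)) = code y"
    obtain n \<sigma> where n: "conf K s n = ([loop, outp], \<sigma>, i, [])" "\<sigma> 0 = code (pref s i)" "\<sigma> 1 = ?T (\<sigma> 0)"
      using head[OF none] by blast
    have "\<sigma> 1 = 0" using n(2,3) y by simp
    with conf_step[OF n(1)] obtain n' where n': "conf K s n' = ([outp], \<sigma>, i, [])"
      by (auto simp: loop_def)
    obtain \<sigma>' where "runs s outp (\<sigma>, i, []) (\<sigma>', i, y)" using outp[of \<sigma> y s i] y n(2) by auto
    from conf_run[OF n' this] show "\<exists>n \<sigma>. conf K s n = ([], \<sigma>, i, y)" by blast
  next
    fix s n assume none: "\<And>i. H (code (pref s i)) = 0"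
    show "fst (conf K s n) \<noteq> []"
    proof
      \<comment> \<open>the loop head is reached after reading \<open>n\<close> letters, which takes at least \<open>n\<close> steps\<close>
      assume "fst (conf K s n) = []"
      then obtain st where h: "conf K s n = ([], st)" by (metis prod.collapse)
      obtain m \<sigma> where m: "conf K s m = ([loop, outp], \<sigma>, n, [])"
        using head[of n s] none by blast
      then have "n \<le> m" using conf_pos_out by blast
      from conf_halted[OF h this] m show False by simp
    qed
  qed
qed

text \<open>
  Apply the clocked search program to \<^term>\<open>hat h\<close>: it finds the shortest prefix of the input in the
  domain of \<open>h\<close>, writes its value, and appends the rest. Its running time depends only on that prefix, so
  that every sufficiently long extension of a word in the domain of \<open>h\<close> is accepted.
\<close>

theorem padding:
  assumes "ideal_morphism h" "computable (hat h)"
  obtains h' where "h' \<in> carrier RMP" "h' \<subseteq>\<^sub>m h"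
    "\<And>x. x \<in> dom h \<Longrightarrow> \<exists>k. \<forall>w. k \<le> length w \<longrightarrow> x @ w \<in> dom h'"
proof -
  obtain K where
    halts: "\<And>s i y. (\<And>j. j < i \<Longrightarrow> hat h (code (pref s j)) = 0) \<Longrightarrow> hat h (code (pref s i)) = code y \<Longrightarrow>
       \<exists>n \<sigma>. conf K s n = ([], \<sigma>, i, y)" and
    diverges: "\<And>s n. (\<And>i. hat h (code (pref s i)) = 0) \<Longrightarrow> fst (conf K s n) \<noteq> []"
    using search_program[OF assms(2)] by blast
  have least: "\<exists>i y n \<sigma>. i \<le> j \<and> h (pref s i) = Some y \<and> conf K s n = ([], \<sigma>, i, y)"
    if j: "hat h (code (pref s j)) \<noteq> 0" for s j
  proof -
    define i where "i = (LEAST i. hat h (code (pref s i)) \<noteq> 0)"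
    have i: "hat h (code (pref s i)) \<noteq> 0" unfolding i_def by (rule LeastI[of _ j]) (rule j)
    then obtain y where y: "h (pref s i) = Some y" by (auto simp: hat_code split: option.splits)
    have "hat h (code (pref s l)) = 0" if "l < i" for l
      using that not_less_Least unfolding i_def by blast
    moreover have "hat h (code (pref s i)) = code y" using y by (simp add: hat_code)
    ultimately obtain n \<sigma> where "conf K s n = ([], \<sigma>, i, y)" using halts by blast
    moreover have "i \<le> j" unfolding i_def by (rule Least_le) (rule j)
    ultimately show ?thesis using y by blast
  qed
  have ext: "h (x @ w) = Some (y @ w)" if "h x = Some y" for x y w
    using assms(1) that unfolding ideal_morphism_def by force
  show ?thesis
  proof
    show "clocked K \<in> carrier RMP" by (rule program.clocked_RMP)
    show "clocked K \<subseteq>\<^sub>m h"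
      unfolding map_le_def
    proof
      fix v assume "v \<in> dom (clocked K)"
      then obtain z where z: "clocked K v = Some z" by blast
      then obtain \<sigma> p u where c: "conf K (stream v) (length v div 2) = ([], \<sigma>, p, u)" "z = u @ drop p v"
        "p \<le> length v div 2" by (rule clocked_SomeE)
      have "\<exists>j. hat h (code (pref (stream v) j)) \<noteq> 0"
        using diverges[of "stream v" "length v div 2"] c(1) by (metis fst_conv)
      then obtain i y n \<sigma>' where i: "h (pref (stream v) i) = Some y" "conf K (stream v) n = ([], \<sigma>', i, y)"
        using least by blast
      have "conf K (stream v) (max n (length v div 2)) = ([], \<sigma>', i, y)"
        by (rule conf_halted[OF i(2)]) simp
      moreover have "conf K (stream v) (max n (length v div 2)) = ([], \<sigma>, p, u)"
        by (rule conf_halted[OF c(1)]) simp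
      ultimately have "i = p" "y = u" by auto
      then have "h (take p v) = Some u" using i(1) c(3) by (simp add: pref_stream)
      from ext[OF this, of "drop p v"] show "clocked K v = h v" using z c(2) by simp
    qed
    fix x assume "x \<in> dom h"
    then have "hat h (code (pref (stream x) (length x))) \<noteq> 0"
      by (auto simp: pref_stream hat_code)
    from least[OF this] obtain i y n \<sigma> where
      i: "i \<le> length x" "conf K (stream x) n = ([], \<sigma>, i, y)" by blast
    have "x @ w \<in> dom (clocked K)" if "2 * n \<le> length w" for w
    proof -
      have "clocked K (x @ w) = Some (y @ drop i (x @ w))"
        by (rule clockedI[OF i(2)]) (use that i(1) in \<open>auto simp: stream_def nth_append\<close>)
      then show ?thesis by blast
    qed
    then show "\<exists>k. \<forall>w. k \<le> length w \<longrightarrow> x @ w \<in> dom (clocked K)" by blast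
  qed
qed

section \<open>Bounded end-equivalence\<close>

lemma right_idealD: "right_ideal R \<Longrightarrow> x \<in> R \<Longrightarrow> x @ w \<in> R"
  unfolding right_ideal_def ideal_gen_def by blast

lemma right_idealI:
  assumes "\<And>x w. x \<in> R \<Longrightarrow> x @ w \<in> R" shows "right_ideal R"
  unfolding right_ideal_def ideal_gen_def
proof (intro equalityI subsetI)
  show "x \<in> {x @ w |x w. x \<in> R}" if "x \<in> R" for x
    using that by (intro CollectI exI[of _ x] exI[of _ "[]"]) simp
qed (use assms in auto)

lemma right_ideal_ideal_gen: "right_ideal (ideal_gen P)"
proof (rule right_idealI)
  fix x w assume "x \<in> ideal_gen P"
  then obtain a u where "x = a @ u" "a \<in> P" unfolding ideal_gen_def by blast
  then have "x @ w = a @ (u @ w)" "a \<in> P" by simp_all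
  then show "x @ w \<in> ideal_gen P" unfolding ideal_gen_def by blast
qed

lemma in_ideal_gen_iff: "v \<in> ideal_gen P \<longleftrightarrow> (\<exists>a\<in>P. prefix a v)"
  by (auto simp: ideal_gen_def prefix_def)

lemma code_of: assumes "right_ideal R"
  shows "prefix_code (code_of R)" "ideal_gen (code_of R) = R"
  using theI'[OF ex1_prefix_code[OF assms]] by (auto simp: code_of_def)

lemma code_of_ideal_gen: "prefix_code P \<Longrightarrow> code_of (ideal_gen P) = P"
  using ex1_prefix_code[OF right_ideal_ideal_gen[of P]] code_of[OF right_ideal_ideal_gen[of P]] by auto

lemma prefix_codeD: "prefix_code P \<Longrightarrow> a \<in> P \<Longrightarrow> b \<in> P \<Longrightarrow> prefix a b \<Longrightarrow> a = b"
  unfolding prefix_code_def pref_comparable_def by blast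

lemma code_of_subset: "right_ideal R \<Longrightarrow> code_of R \<subseteq> R"
  using code_of(2)[of R] by (force simp: ideal_gen_def)

lemma code_of_minimal:
  assumes "right_ideal R" "a \<in> code_of R" "x \<in> R" "prefix x a" shows "x = a"
proof -
  obtain b where b: "b \<in> code_of R" "prefix b x"
    using assms(1,3) code_of(2)[OF assms(1)] in_ideal_gen_iff by blast
  then have "b = a" using prefix_codeD[OF code_of(1)[OF assms(1)] b(1) assms(2)] assms(4) by (meson prefix_order.trans)
  with b(2) assms(4) show ?thesis by (simp add: prefix_order.antisym)
qed

text \<open>
  Bounded equivalence in terms of the ideals: all long extensions of a word in \<open>R\<close> are in \<open>R'\<close>. As there are
  only finitely many words of each length, a bound for each word is as good as a bound \<open>\<beta>\<close> on lengths.
\<close>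

definition bd_sub :: "word set \<Rightarrow> word set \<Rightarrow> bool" where
  "bd_sub R R' \<longleftrightarrow> (\<forall>x\<in>R. \<exists>k. \<forall>w. k \<le> length w \<longrightarrow> x @ w \<in> R')"

lemma finite_words: "finite {v :: word. length v = l}" "finite {v :: word. length v \<le> l}"
  using finite_lists_length_eq[of "UNIV :: bool set" l] finite_lists_length_le[of "UNIV :: bool set" l] by auto

lemma uniform_bound:
  assumes "finite S" "\<And>x. x \<in> S \<Longrightarrow> \<exists>k::nat. \<forall>w :: word. k \<le> length w \<longrightarrow> Q x w"
  shows "\<exists>k. \<forall>x\<in>S. \<forall>w. k \<le> length w \<longrightarrow> Q x w"
proof -
  have "\<forall>x\<in>S. \<exists>k. \<forall>w. k \<le> length w \<longrightarrow> Q x w" using assms(2) by blast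
  then obtain k where k: "\<forall>x\<in>S. \<forall>w. k x \<le> length w \<longrightarrow> Q x w" by (auto simp: bchoice_iff)
  have "k x \<le> Max (k ` S)" if "x \<in> S" for x using assms(1) that by simp
  with k show ?thesis by (meson order.trans)
qed

lemma bd_sub_refl: "right_ideal R \<Longrightarrow> R \<subseteq> R' \<Longrightarrow> bd_sub R R'"
  unfolding bd_sub_def using right_idealD by blast

lemma bd_sub_trans:
  assumes "bd_sub R1 R2" "bd_sub R2 R3" shows "bd_sub R1 R3"
  unfolding bd_sub_def
proof
  fix x assume "x \<in> R1"
  then obtain k where k: "\<And>w. k \<le> length w \<Longrightarrow> x @ w \<in> R2" using assms(1) unfolding bd_sub_def by blast
  have "\<exists>m. \<forall>v\<in>{v. length v = k}. \<forall>w. m \<le> length w \<longrightarrow> (x @ v) @ w \<in> R3"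
  proof (rule uniform_bound[OF finite_words(1)])
    fix v :: word assume "v \<in> {v. length v = k}"
    then have "x @ v \<in> R2" by (intro k) simp
    then show "\<exists>m. \<forall>w. m \<le> length w \<longrightarrow> (x @ v) @ w \<in> R3" using assms(2) unfolding bd_sub_def by blast
  qed
  then obtain m where m: "\<And>v w. length v = k \<Longrightarrow> m \<le> length w \<Longrightarrow> x @ v @ w \<in> R3" by auto
  have "x @ w \<in> R3" if "k + m \<le> length w" for w
    using m[of "take k w" "drop k w"] that by simp
  then show "\<exists>k. \<forall>w. k \<le> length w \<longrightarrow> x @ w \<in> R3" by blast
qed

text \<open>
  For \<open>x\<close> in \<open>R1\<close> and long \<open>w\<close>, the right ideal generated by \<open>x w\<close> meets \<open>R2\<close>, hence \<open>x w\<close> is comparable with a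
  word of the code of \<open>R2\<close>; as that word is short, it is a prefix of \<open>x w\<close>.
\<close>

lemma bd_sub_of_end_equiv:
  assumes R: "right_ideal R1" "right_ideal R2"
    and e: "\<And>R. right_ideal R \<Longrightarrow> R1 \<inter> R \<noteq> {} \<Longrightarrow> R2 \<inter> R \<noteq> {}"
    and b: "\<And>a c. a \<in> code_of R1 \<Longrightarrow> c \<in> code_of R2 \<Longrightarrow> pref_comparable a c \<Longrightarrow> length c \<le> \<beta> (length a)"
  shows "bd_sub R1 R2"
  unfolding bd_sub_def
proof
  fix x assume x: "x \<in> R1"
  then obtain a where a: "a \<in> code_of R1" "prefix a x" using code_of(2)[OF R(1)] in_ideal_gen_iff by blast
  have "x @ w \<in> R2" if w: "\<beta> (length a) \<le> length w" for w
  proof -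
    have "x @ w \<in> R1 \<inter> ideal_gen {x @ w}" using right_idealD[OF R(1) x] by (auto simp: in_ideal_gen_iff)
    then have "R2 \<inter> ideal_gen {x @ w} \<noteq> {}" using e right_ideal_ideal_gen by blast
    then obtain z where z: "z \<in> R2" "prefix (x @ w) z" by (auto simp: in_ideal_gen_iff)
    then obtain c where c: "c \<in> code_of R2" "prefix c z" using code_of(2)[OF R(2)] in_ideal_gen_iff by blast
    have "prefix a z" using a(2) z(2) by (meson prefix_order.trans prefixI)
    then have "pref_comparable a c" unfolding pref_comparable_def using c(2) prefix_same_cases by blast
    then have "length c \<le> length (x @ w)" using b[OF a(1) c(1)] w by simp
    then have "prefix c (x @ w)" using c(2) z(2) prefix_length_prefix by blast
    then show ?thesis using c(1) code_of(2)[OF R(2)] in_ideal_gen_iff by blast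
  qed
  then show "\<exists>k. \<forall>w. k \<le> length w \<longrightarrow> x @ w \<in> R2" by blast
qed

text \<open>
  If \<open>c\<close> were much longer than \<open>a\<close>, then some proper prefix of \<open>c\<close> that extends \<open>a\<close> would be in \<open>R2\<close>, against
  the minimality of \<open>c\<close>.
\<close>

lemma bd_sub_code_bound:
  assumes R: "right_ideal R1" "right_ideal R2" and s: "bd_sub R1 R2"
  shows "\<exists>\<beta>. \<forall>a\<in>code_of R1. \<forall>c\<in>code_of R2. pref_comparable a c \<longrightarrow> length c \<le> \<beta> (length a)"
proof -
  have "\<exists>k. \<forall>a\<in>{a. length a = l \<and> a \<in> code_of R1}. \<forall>w. k \<le> length w \<longrightarrow> a @ w \<in> R2" for l
    by (rule uniform_bound) (use s code_of_subset[OF R(1)] finite_subset[OF _ finite_words(1)[of l]] in \<open>auto simp: bd_sub_def\<close>)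
  then obtain k where k: "\<And>a w. a \<in> code_of R1 \<Longrightarrow> k (length a) \<le> length w \<Longrightarrow> a @ w \<in> R2" by simp metis
  have "length c \<le> length a + k (length a)" if "a \<in> code_of R1" "c \<in> code_of R2" "pref_comparable a c" for a c
  proof (rule ccontr)
    assume l: "\<not> length c \<le> length a + k (length a)"
    then have "prefix a c" using that(3) prefix_length_le unfolding pref_comparable_def by fastforce
    then obtain w where w: "c = a @ w" by (auto simp: prefix_def)
    have "a @ take (k (length a)) w \<in> R2" using k[OF that(1)] l w by simp
    moreover have "prefix (a @ take (k (length a)) w) c" using w take_is_prefix by simp
    ultimately have "a @ take (k (length a)) w = c" using code_of_minimal[OF R(2) that(2)] by blast
    then show False using l w by (metis append_eq_conv_conj length_append length_take min.cobounded2 nat_add_left_cancel_le)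
  qed
  then show ?thesis by (intro exI[of _ "\<lambda>l. l + k l"]) auto
qed

lemma bd_equiv_code_iff:
  assumes R: "right_ideal R1" "right_ideal R2"
  shows "bd_equiv_code (code_of R1) (code_of R2) \<longleftrightarrow> bd_sub R1 R2 \<and> bd_sub R2 R1"
proof
  assume l: "bd_equiv_code (code_of R1) (code_of R2)"
  then obtain \<beta> where b: "\<And>a c. a \<in> code_of R1 \<Longrightarrow> c \<in> code_of R2 \<Longrightarrow> pref_comparable a c \<Longrightarrow>
      length a \<le> \<beta> (length c) \<and> length c \<le> \<beta> (length a)" unfolding bd_equiv_code_def by blast
  have e: "R1 \<inter> R \<noteq> {} \<longleftrightarrow> R2 \<inter> R \<noteq> {}" if "right_ideal R" for R
    using l that code_of(2) R unfolding bd_equiv_code_def end_equiv_def by auto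
  have c: "pref_comparable a c \<Longrightarrow> pref_comparable c a" for a c by (auto simp: pref_comparable_def)
  show "bd_sub R1 R2 \<and> bd_sub R2 R1"
    by (rule conjI; rule bd_sub_of_end_equiv[where \<beta> = \<beta>]) (use R b e c in blast)+
next
  assume r: "bd_sub R1 R2 \<and> bd_sub R2 R1"
  obtain \<beta>1 where 1: "\<And>a c. a \<in> code_of R1 \<Longrightarrow> c \<in> code_of R2 \<Longrightarrow> pref_comparable a c \<Longrightarrow> length c \<le> \<beta>1 (length a)"
    using bd_sub_code_bound[OF R] r by blast
  obtain \<beta>2 where 2: "\<And>a c. a \<in> code_of R2 \<Longrightarrow> c \<in> code_of R1 \<Longrightarrow> pref_comparable a c \<Longrightarrow> length c \<le> \<beta>2 (length a)"
    using bd_sub_code_bound[OF R(2,1)] r by blast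
  have meet: "R' \<inter> R \<noteq> {}" if R: "bd_sub R'' R'" "right_ideal R" "R'' \<inter> R \<noteq> {}" for R R' R''
  proof -
    obtain x where x: "x \<in> R''" "x \<in> R" using R(3) by blast
    then obtain k where "\<And>w. k \<le> length w \<Longrightarrow> x @ w \<in> R'" using R(1) unfolding bd_sub_def by blast
    from this[of "replicate k True"] right_idealD[OF R(2) x(2)] show ?thesis by auto
  qed
  have "end_equiv (code_of R1) (code_of R2)"
    unfolding end_equiv_def using meet r code_of(2) R by metis
  moreover have "length a \<le> max (\<beta>1 (length c)) (\<beta>2 (length c)) \<and> length c \<le> max (\<beta>1 (length a)) (\<beta>2 (length a))"
    if "a \<in> code_of R1" "c \<in> code_of R2" "pref_comparable a c" for a c
    using 1[OF that] 2[OF that(2,1)] that(3) by (auto simp: pref_comparable_def)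
  ultimately show "bd_equiv_code (code_of R1) (code_of R2)"
    unfolding bd_equiv_code_def by (intro conjI exI[of _ "\<lambda>l. max (\<beta>1 l) (\<beta>2 l)"]) blast+
qed

text \<open>
  The same minimality argument bounds the length of each word in the code of \<open>R2\<close> by that of a comparable
  word in the code of \<open>R1\<close>.
\<close>

lemma finite_code_of:
  assumes R: "right_ideal R1" "right_ideal R2" and s: "bd_sub R1 R2" "bd_sub R2 R1" and fin: "finite (code_of R1)"
  shows "finite (code_of R2)"
proof -
  have "\<exists>k. \<forall>a\<in>code_of R1. \<forall>w. k \<le> length w \<longrightarrow> a @ w \<in> R2"
    by (rule uniform_bound[OF fin]) (use s(1) code_of_subset[OF R(1)] in \<open>auto simp: bd_sub_def\<close>)
  then obtain k where k: "\<And>a w. a \<in> code_of R1 \<Longrightarrow> k \<le> length w \<Longrightarrow> a @ w \<in> R2" by blast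
  have "\<exists>a\<in>code_of R1. length c \<le> length a + k" if c: "c \<in> code_of R2" for c
  proof -
    obtain m where m: "\<And>w. m \<le> length w \<Longrightarrow> c @ w \<in> R1"
      using s(2) code_of_subset[OF R(2)] c unfolding bd_sub_def by blast
    have "c @ replicate m True \<in> R1" by (rule m) simp
    then obtain a where a: "a \<in> code_of R1" "prefix a (c @ replicate m True)"
      using code_of(2)[OF R(1)] in_ideal_gen_iff by blast
    have "length c \<le> length a + k"
    proof (rule ccontr)
      assume l: "\<not> length c \<le> length a + k"
      then have "prefix a c" using a(2) prefix_length_prefix[of a "c @ replicate m True" c] by simp
      then obtain w where w: "c = a @ w" by (auto simp: prefix_def)
      have "a @ take k w \<in> R2" using k[OF a(1)] l w by simp
      moreover have "prefix (a @ take k w) c" using w take_is_prefix by simp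
      ultimately have "a @ take k w = c" using code_of_minimal[OF R(2) c] by blast
      then have "length c \<le> length a + k" by (metis length_append length_take min.cobounded2 nat_add_left_cancel_le)
      with l show False by simp
    qed
    with a(1) show ?thesis by blast
  qed
  then have "code_of R2 \<subseteq> (\<Union>a\<in>code_of R1. {v. length v \<le> length a + k})" by blast
  then show ?thesis by (rule finite_subset) (use fin finite_words in blast)
qed

section \<open>Morphisms up to bounded equivalence\<close>

lemma ideal_morphismD: "ideal_morphism h \<Longrightarrow> h x = Some y \<Longrightarrow> h (x @ w) = Some (y @ w)"
  using domI[of h x y] by (simp add: ideal_morphism_def)

lemma ideal_morphismI:
  assumes "\<And>x y w. h x = Some y \<Longrightarrow> h (x @ w) = Some (y @ w)" shows "ideal_morphism h"
proof -
  have "right_ideal (dom h)" by (rule right_idealI) (use assms in blast)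
  then show ?thesis unfolding ideal_morphism_def using assms by auto
qed

lemma right_ideal_dom: "ideal_morphism h \<Longrightarrow> right_ideal (dom h)"
  by (simp add: ideal_morphism_def)

lemma right_ideal_ran: assumes "ideal_morphism h" shows "right_ideal (ran h)"
proof (rule right_idealI)
  fix y w assume "y \<in> ran h"
  then obtain x where "h x = Some y" by (auto simp: ran_def)
  from ideal_morphismD[OF assms this] show "y @ w \<in> ran h" by (rule ranI)
qed

lemma ideal_morphism_comp:
  assumes "ideal_morphism f" "ideal_morphism g" shows "ideal_morphism (f \<circ>\<^sub>m g)"
  by (rule ideal_morphismI) (use assms in \<open>auto simp: map_comp_def ideal_morphismD split: option.splits\<close>)

lemma bd_equiv_iff:
  assumes "ideal_morphism f" "ideal_morphism g"
  shows "bd_equiv f g \<longleftrightarrow> bd_sub (dom f) (dom g) \<and> bd_sub (dom g) (dom f) \<and> (\<forall>x\<in>dom f \<inter> dom g. f x = g x)"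
  unfolding bd_equiv_def domC_def bd_equiv_code_iff[OF assms[THEN right_ideal_dom]] by (simp only: conj_assoc)

lemma bd_equiv_refl: "ideal_morphism f \<Longrightarrow> bd_equiv f f"
  by (simp add: bd_equiv_iff bd_sub_refl right_ideal_dom)

lemma bd_equiv_sym:
  assumes "ideal_morphism f" "ideal_morphism g" "bd_equiv f g" shows "bd_equiv g f"
  using assms(3) unfolding bd_equiv_iff[OF assms(1,2)] bd_equiv_iff[OF assms(2,1)]
  by (elim conjE) (intro conjI ballI, assumption+, simp)

lemma bd_equiv_trans:
  assumes m: "ideal_morphism f" "ideal_morphism g" "ideal_morphism h" and e: "bd_equiv f g" "bd_equiv g h"
  shows "bd_equiv f h"
proof -
  have s: "bd_sub (dom f) (dom g)" "bd_sub (dom g) (dom f)" "bd_sub (dom g) (dom h)" "bd_sub (dom h) (dom g)"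
    and a: "\<And>x. x \<in> dom f \<Longrightarrow> x \<in> dom g \<Longrightarrow> f x = g x" "\<And>x. x \<in> dom g \<Longrightarrow> x \<in> dom h \<Longrightarrow> g x = h x"
    using e unfolding bd_equiv_iff[OF m(1,2)] bd_equiv_iff[OF m(2,3)] by blast+
  have agree: "f x = h x" if x: "f x = Some y" "h x = Some z" for x y z
  proof -
    obtain k where "\<And>w. k \<le> length w \<Longrightarrow> x @ w \<in> dom g" using s(1) x(1) unfolding bd_sub_def by blast
    then have g: "x @ replicate k True \<in> dom g" by simp
    have fx: "f (x @ replicate k True) = Some (y @ replicate k True)" by (rule ideal_morphismD[OF m(1) x(1)])
    have hx: "h (x @ replicate k True) = Some (z @ replicate k True)" by (rule ideal_morphismD[OF m(3) x(2)])
    have d: "x @ replicate k True \<in> dom f" "x @ replicate k True \<in> dom h" using fx hx by blast+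
    have "f (x @ replicate k True) = g (x @ replicate k True)" by (rule a(1)[OF d(1) g])
    also have "\<dots> = h (x @ replicate k True)" by (rule a(2)[OF g d(2)])
    finally have "f (x @ replicate k True) = h (x @ replicate k True)" .
    then show ?thesis using fx hx x by simp
  qed
  show ?thesis
    unfolding bd_equiv_iff[OF m(1,3)]
  proof (intro conjI ballI)
    show "bd_sub (dom f) (dom h)" by (rule bd_sub_trans[OF s(1,3)])
    show "bd_sub (dom h) (dom f)" by (rule bd_sub_trans[OF s(4,2)])
    show "f x = h x" if "x \<in> dom f \<inter> dom h" for x using that agree by blast
  qed
qed

lemma bd_equiv_restrict:
  assumes "ideal_morphism f" "ideal_morphism g" "f \<subseteq>\<^sub>m g" "bd_sub (dom g) (dom f)" shows "bd_equiv f g"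
  unfolding bd_equiv_iff[OF assms(1,2)]
proof (intro conjI ballI)
  show "bd_sub (dom f) (dom g)"
    by (rule bd_sub_refl[OF right_ideal_dom[OF assms(1)] map_le_implies_dom_le[OF assms(3)]])
  show "f x = g x" if "x \<in> dom f \<inter> dom g" for x using that assms(3) unfolding map_le_def by blast
qed (rule assms(4))

lemma dom_comp_iff: "x \<in> dom (f \<circ>\<^sub>m g) \<longleftrightarrow> (\<exists>y. g x = Some y \<and> y \<in> dom f)"
  by (auto simp: map_comp_def split: option.splits)

text \<open>
  If \<open>g x = y\<close>, then \<open>g\<close> maps \<open>x w\<close> to \<open>y w\<close>, so that the bounds for \<open>g\<close> at \<open>x\<close> and for \<open>f\<close> at \<open>y\<close> combine
  to one for the composition at \<open>x\<close>.
\<close>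

lemma bd_equiv_comp:
  assumes m: "ideal_morphism f" "ideal_morphism f'" "ideal_morphism g" "ideal_morphism g'"
    and e: "bd_equiv f f'" "bd_equiv g g'"
  shows "bd_equiv (f \<circ>\<^sub>m g) (f' \<circ>\<^sub>m g')"
proof -
  have half: "bd_sub (dom (f \<circ>\<^sub>m g)) (dom (f' \<circ>\<^sub>m g'))"
    if m: "ideal_morphism f" "ideal_morphism f'" "ideal_morphism g" "ideal_morphism g'"
      and e: "bd_equiv f f'" "bd_equiv g g'" for f f' g g'
    unfolding bd_sub_def
  proof
    have s: "bd_sub (dom f) (dom f')" "bd_sub (dom g) (dom g')" "\<And>x. x \<in> dom g \<Longrightarrow> x \<in> dom g' \<Longrightarrow> g x = g' x"
      using e unfolding bd_equiv_iff[OF m(1,2)] bd_equiv_iff[OF m(3,4)] by blast+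
    fix x assume "x \<in> dom (f \<circ>\<^sub>m g)"
    then obtain y where y: "g x = Some y" "y \<in> dom f" unfolding dom_comp_iff by blast
    obtain k1 where k1: "\<And>w. k1 \<le> length w \<Longrightarrow> x @ w \<in> dom g'"
      using s(2) y(1) unfolding bd_sub_def by blast
    obtain k2 where k2: "\<And>w. k2 \<le> length w \<Longrightarrow> y @ w \<in> dom f'"
      using s(1) y(2) unfolding bd_sub_def by blast
    have "x @ w \<in> dom (f' \<circ>\<^sub>m g')" if "max k1 k2 \<le> length w" for w
    proof -
      have "g (x @ w) = Some (y @ w)" by (rule ideal_morphismD[OF m(3) y(1)])
      moreover have "x @ w \<in> dom g'" using k1 that by simp
      ultimately have "g' (x @ w) = Some (y @ w)" using s(3)[of "x @ w"] by (simp add: domI)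
      moreover have "y @ w \<in> dom f'" using k2 that by simp
      ultimately show ?thesis unfolding dom_comp_iff by blast
    qed
    then show "\<exists>k. \<forall>w. k \<le> length w \<longrightarrow> x @ w \<in> dom (f' \<circ>\<^sub>m g')" by blast
  qed
  have "(f \<circ>\<^sub>m g) x = (f' \<circ>\<^sub>m g') x" if x: "x \<in> dom (f \<circ>\<^sub>m g) \<inter> dom (f' \<circ>\<^sub>m g')" for x
  proof -
    obtain y y' where y: "g x = Some y" "y \<in> dom f" "g' x = Some y'" "y' \<in> dom f'"
      using x unfolding Int_iff dom_comp_iff by blast
    have "x \<in> dom g \<inter> dom g'" using y by blast
    then have "g x = g' x" using e(2) m unfolding bd_equiv_iff[OF m(3,4)] by blast
    then have "y = y'" using y by simp
    then have "f y = f' y" using e(1) m y unfolding bd_equiv_iff[OF m(1,2)] by blast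
    then show ?thesis using y \<open>y = y'\<close> by (simp add: map_comp_def)
  qed
  then show ?thesis
    using half[OF m e] half[OF m(2,1,4,3) bd_equiv_sym[OF m(1,2) e(1)] bd_equiv_sym[OF m(3,4) e(2)]]
    unfolding bd_equiv_iff[OF ideal_morphism_comp[OF m(1,3)] ideal_morphism_comp[OF m(2,4)]] by blast
qed

lemma RMP_morphism: "f \<in> carrier RMP \<Longrightarrow> ideal_morphism f"
  by (simp add: RMP_def)

lemma bd_classD: assumes "g \<in> bd_class f" shows "g \<in> carrier RMP" "bd_equiv g f"
  using assms by (simp_all add: bd_class_def)

lemma bd_class_self: "f \<in> carrier RMP \<Longrightarrow> f \<in> bd_class f"
  by (simp add: bd_class_def bd_equiv_refl RMP_morphism)

lemma bd_class_eqI: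
  assumes "ideal_morphism f" "ideal_morphism g" "bd_equiv f g" shows "bd_class f = bd_class g"
proof -
  have "bd_equiv h f \<longleftrightarrow> bd_equiv h g" if h: "h \<in> carrier RMP" for h
  proof
    show "bd_equiv h g" if "bd_equiv h f"
      by (rule bd_equiv_trans[OF RMP_morphism[OF h] assms(1,2) that assms(3)])
    show "bd_equiv h f" if "bd_equiv h g"
      by (rule bd_equiv_trans[OF RMP_morphism[OF h] assms(2,1) that bd_equiv_sym[OF assms]])
  qed
  then show ?thesis unfolding bd_class_def by (intro Collect_cong conj_cong refl)
qed

text \<open>
  All products of representatives are equivalent, so the union that defines the multiplication is over equal
  sets.
\<close>

lemma bd_class_mult:
  assumes "f \<in> carrier RMP" "g \<in> carrier RMP"
  shows "bd_class f \<otimes>\<^bsub>MbdP\<^esub> bd_class g = bd_class (f \<circ>\<^sub>m g)"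
proof -
  note m = RMP_morphism[OF assms(1)] RMP_morphism[OF assms(2)]
  have eq: "bd_class (f' \<circ>\<^sub>m g') = bd_class (f \<circ>\<^sub>m g)" if "f' \<in> bd_class f" "g' \<in> bd_class g" for f' g'
  proof -
    note e = bd_classD(2)[OF that(1)] bd_classD(2)[OF that(2)]
    note c = bd_classD(1)[OF that(1)] bd_classD(1)[OF that(2)]
    note m' = RMP_morphism[OF c(1)] RMP_morphism[OF c(2)]
    show ?thesis
      by (rule bd_class_eqI[OF ideal_morphism_comp[OF m'] ideal_morphism_comp[OF m]
            bd_equiv_comp[OF m'(1) m(1) m'(2) m(2) e]])
  qed
  have "bd_class f \<otimes>\<^bsub>MbdP\<^esub> bd_class g = (\<Union>f'\<in>bd_class f. \<Union>g'\<in>bd_class g. bd_class (f' \<circ>\<^sub>m g'))"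
    by (simp add: MbdP_def RMP_def)
  also have "\<dots> = (\<Union>f'\<in>bd_class f. \<Union>g'\<in>bd_class g. bd_class (f \<circ>\<^sub>m g))"
    by (intro SUP_cong refl eq)
  also have "\<dots> = bd_class (f \<circ>\<^sub>m g)"
    using bd_class_self[OF assms(1)] bd_class_self[OF assms(2)] by blast
  finally show ?thesis .
qed

lemma carrier_MbdP: "carrier MbdP = bd_class ` carrier RMP"
  by (simp add: MbdP_def)

section \<open>Green relations witnessed by computable morphisms\<close>

definition computable_morphism :: "(word \<rightharpoonup> word) \<Rightarrow> bool" where
  "computable_morphism h \<longleftrightarrow> ideal_morphism h \<and> computable (hat h)"

lemma RMP_computable: "f \<in> carrier RMP \<Longrightarrow> computable_morphism f"
  by (simp add: computable_morphism_def RMP_def fP_computable)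

lemma computable_morphism_comp:
  "computable_morphism f \<Longrightarrow> computable_morphism g \<Longrightarrow> computable_morphism (f \<circ>\<^sub>m g)"
  using computable_comp[of "hat f" "hat g"] unfolding computable_morphism_def hat_comp[abs_def]
  by (simp add: ideal_morphism_comp)

lemma computable_morphism_RMP:
  assumes "computable_morphism h" obtains h' where "h' \<in> carrier RMP" "bd_equiv h' h"
proof -
  have h: "ideal_morphism h" "computable (hat h)" using assms by (auto simp: computable_morphism_def)
  obtain h' where h': "h' \<in> carrier RMP" "h' \<subseteq>\<^sub>m h" "\<And>x. x \<in> dom h \<Longrightarrow> \<exists>k. \<forall>w. k \<le> length w \<longrightarrow> x @ w \<in> dom h'"
    using padding[OF h] by blast
  have "bd_equiv h' h"
    by (rule bd_equiv_restrict[OF RMP_morphism[OF h'(1)] h(1) h'(2)]) (use h'(3) in \<open>auto simp: bd_sub_def\<close>)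
  with h'(1) that show ?thesis by blast
qed

lemma L_leI:
  assumes "t \<in> carrier RMP" "s \<in> carrier RMP" "computable_morphism m" "bd_equiv t (m \<circ>\<^sub>m s)"
  shows "L_le MbdP (bd_class t) (bd_class s)"
proof -
  obtain m' where m': "m' \<in> carrier RMP" "bd_equiv m' m" by (rule computable_morphism_RMP[OF assms(3)])
  have M: "ideal_morphism t" "ideal_morphism s" "ideal_morphism m" "ideal_morphism m'"
    using assms(1-3) m'(1) unfolding computable_morphism_def by (simp_all add: RMP_morphism)
  have "bd_equiv (m' \<circ>\<^sub>m s) (m \<circ>\<^sub>m s)" by (rule bd_equiv_comp[OF M(4,3,2,2) m'(2) bd_equiv_refl[OF M(2)]])
  then have "bd_class (m' \<circ>\<^sub>m s) = bd_class (m \<circ>\<^sub>m s)"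
    by (rule bd_class_eqI[OF ideal_morphism_comp[OF M(4,2)] ideal_morphism_comp[OF M(3,2)]])
  moreover have "bd_class t = bd_class (m \<circ>\<^sub>m s)"
    by (rule bd_class_eqI[OF M(1) ideal_morphism_comp[OF M(3,2)] assms(4)])
  ultimately have "bd_class t = bd_class m' \<otimes>\<^bsub>MbdP\<^esub> bd_class s" by (simp only: bd_class_mult[OF m'(1) assms(2)])
  then show ?thesis unfolding L_le_def carrier_MbdP by (rule bexI[OF _ imageI[OF m'(1)]])
qed

lemma R_leI:
  assumes "v \<in> carrier RMP" "u \<in> carrier RMP" "computable_morphism m" "bd_equiv v (u \<circ>\<^sub>m m)"
  shows "R_le MbdP (bd_class v) (bd_class u)"
proof -
  obtain m' where m': "m' \<in> carrier RMP" "bd_equiv m' m" by (rule computable_morphism_RMP[OF assms(3)])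
  have M: "ideal_morphism v" "ideal_morphism u" "ideal_morphism m" "ideal_morphism m'"
    using assms(1-3) m'(1) unfolding computable_morphism_def by (simp_all add: RMP_morphism)
  have "bd_equiv (u \<circ>\<^sub>m m') (u \<circ>\<^sub>m m)" by (rule bd_equiv_comp[OF M(2,2,4,3) bd_equiv_refl[OF M(2)] m'(2)])
  then have "bd_class (u \<circ>\<^sub>m m') = bd_class (u \<circ>\<^sub>m m)"
    by (rule bd_class_eqI[OF ideal_morphism_comp[OF M(2,4)] ideal_morphism_comp[OF M(2,3)]])
  moreover have "bd_class v = bd_class (u \<circ>\<^sub>m m)"
    by (rule bd_class_eqI[OF M(1) ideal_morphism_comp[OF M(2,3)] assms(4)])
  ultimately have "bd_class v = bd_class u \<otimes>\<^bsub>MbdP\<^esub> bd_class m'" by (simp only: bd_class_mult[OF assms(2) m'(1)])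
  then show ?thesis unfolding R_le_def carrier_MbdP by (rule bexI[OF _ imageI[OF m'(1)]])
qed

lemma L_leD:
  assumes "t \<in> carrier RMP" "s \<in> carrier RMP" "L_le MbdP (bd_class t) (bd_class s)"
  obtains m where "m \<in> carrier RMP" "bd_equiv t (m \<circ>\<^sub>m s)"
proof -
  obtain X where X: "X \<in> bd_class ` carrier RMP" "bd_class t = X \<otimes>\<^bsub>MbdP\<^esub> bd_class s"
    using assms(3) unfolding L_le_def carrier_MbdP by (rule bexE)
  obtain m where m: "m \<in> carrier RMP" "X = bd_class m" using X(1) by (rule imageE)
  have "t \<in> bd_class (m \<circ>\<^sub>m s)"
    using bd_class_self[OF assms(1)] unfolding X(2) m(2) bd_class_mult[OF m(1) assms(2)] .
  then show ?thesis by (rule that[OF m(1) bd_classD(2)])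
qed

lemma R_leD:
  assumes "v \<in> carrier RMP" "u \<in> carrier RMP" "R_le MbdP (bd_class v) (bd_class u)"
  obtains m where "m \<in> carrier RMP" "bd_equiv v (u \<circ>\<^sub>m m)"
proof -
  obtain X where X: "X \<in> bd_class ` carrier RMP" "bd_class v = bd_class u \<otimes>\<^bsub>MbdP\<^esub> X"
    using assms(3) unfolding R_le_def carrier_MbdP by (rule bexE)
  obtain m where m: "m \<in> carrier RMP" "X = bd_class m" using X(1) by (rule imageE)
  have "v \<in> bd_class (u \<circ>\<^sub>m m)"
    using bd_class_self[OF assms(1)] unfolding X(2) m(2) bd_class_mult[OF assms(2) m(1)] .
  then show ?thesis by (rule that[OF m(1) bd_classD(2)])
qed

section \<open>Invariants of the Green relations\<close>

lemma bd_sub_ran: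
  assumes m: "ideal_morphism f" "ideal_morphism g" and e: "bd_equiv f g"
  shows "bd_sub (ran f) (ran g)"
  unfolding bd_sub_def
proof
  have s: "bd_sub (dom f) (dom g)" "\<And>x. x \<in> dom f \<Longrightarrow> x \<in> dom g \<Longrightarrow> f x = g x"
    using e unfolding bd_equiv_iff[OF m] by blast+
  fix y assume "y \<in> ran f"
  then obtain x where x: "f x = Some y" by (auto simp: ran_def)
  then obtain k where k: "\<And>w. k \<le> length w \<Longrightarrow> x @ w \<in> dom g"
    using s(1) unfolding bd_sub_def by blast
  have "y @ w \<in> ran g" if "k \<le> length w" for w
  proof -
    have "f (x @ w) = Some (y @ w)" by (rule ideal_morphismD[OF m(1) x])
    moreover have "x @ w \<in> dom g" by (rule k[OF that])
    ultimately have "g (x @ w) = Some (y @ w)" using s(2)[of "x @ w"] by (simp add: domI)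
    then show ?thesis by (rule ranI)
  qed
  then show "\<exists>k. \<forall>w. k \<le> length w \<longrightarrow> y @ w \<in> ran g" by blast
qed

lemma ran_comp_subset: "ran (f \<circ>\<^sub>m g) \<subseteq> ran f"
  by (auto simp: ran_def map_comp_def split: option.splits)

lemma finite_imC_cong:
  assumes m: "ideal_morphism f" "ideal_morphism g" and e: "bd_equiv f g"
  shows "finite (imC f) \<longleftrightarrow> finite (imC g)"
proof -
  note R = right_ideal_ran[OF m(1)] right_ideal_ran[OF m(2)]
    and s = bd_sub_ran[OF m e] bd_sub_ran[OF m(2,1) bd_equiv_sym[OF m e]]
  show ?thesis unfolding imC_def
    using finite_code_of[OF R s] finite_code_of[OF R(2,1) s(2,1)] by (rule iffI)
qed

text \<open>
  The images of R-equivalent morphisms contain one another up to padding.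
\<close>

lemma finite_imC_R:
  assumes m: "ideal_morphism f" "ideal_morphism g" "ideal_morphism h" "ideal_morphism h'"
    and e: "bd_equiv f (g \<circ>\<^sub>m h)" "bd_equiv g (f \<circ>\<^sub>m h')" and fin: "finite (imC f)"
  shows "finite (imC g)"
proof -
  have M: "ideal_morphism (g \<circ>\<^sub>m h)" "ideal_morphism (f \<circ>\<^sub>m h')"
    by (rule ideal_morphism_comp[OF m(2,3)], rule ideal_morphism_comp[OF m(1,4)])
  have 1: "bd_sub (ran f) (ran g)"
    by (rule bd_sub_trans[OF bd_sub_ran[OF m(1) M(1) e(1)] bd_sub_refl[OF right_ideal_ran[OF M(1)] ran_comp_subset]])
  have 2: "bd_sub (ran g) (ran f)"
    by (rule bd_sub_trans[OF bd_sub_ran[OF m(2) M(2) e(2)] bd_sub_refl[OF right_ideal_ran[OF M(2)] ran_comp_subset]])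
  show ?thesis
    using finite_code_of[OF right_ideal_ran[OF m(1)] right_ideal_ran[OF m(2)] 1 2] fin unfolding imC_def by simp
qed

text \<open>
  Since \<open>f\<close> factors through \<open>g\<close> and conversely, \<open>h' f\<close> is defined on long extensions of every word in the
  domain of \<open>f\<close>. So \<open>h'\<close> is defined on all extensions \<open>y w\<close> of words \<open>y\<close> in the finite image code of \<open>f\<close> with \<open>w\<close>
  of length at least some \<open>k\<close>, and the values of \<open>h'\<close> at the shorter extensions and those of length \<open>k\<close>
  generate the image of \<open>h' f\<close>.
\<close>

lemma finite_imC_L:
  assumes m: "ideal_morphism f" "ideal_morphism g" "ideal_morphism h" "ideal_morphism h'"
    and e: "bd_equiv f (h \<circ>\<^sub>m g)" "bd_equiv g (h' \<circ>\<^sub>m f)" and fin: "finite (imC f)"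
  shows "finite (imC g)"
proof -
  have M: "ideal_morphism (h' \<circ>\<^sub>m f)" "ideal_morphism (h \<circ>\<^sub>m g)" by (rule ideal_morphism_comp[OF m(4,1)], rule ideal_morphism_comp[OF m(3,2)])
  have d: "dom (h \<circ>\<^sub>m g) \<subseteq> dom g" unfolding subset_iff dom_comp_iff by blast
  have "bd_sub (dom f) (dom (h \<circ>\<^sub>m g))" using e(1) unfolding bd_equiv_iff[OF m(1) M(2)] by (elim conjE)
  then have "bd_sub (dom f) (dom g)" by (rule bd_sub_trans[OF _ bd_sub_refl[OF right_ideal_dom[OF M(2)] d]])
  moreover have "bd_sub (dom g) (dom (h' \<circ>\<^sub>m f))" using e(2) unfolding bd_equiv_iff[OF m(2) M(1)] by (elim conjE)
  ultimately have s: "bd_sub (dom f) (dom (h' \<circ>\<^sub>m f))" by (rule bd_sub_trans)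
  have R: "right_ideal (ran f)" by (rule right_ideal_ran[OF m(1)])
  have "\<exists>k. \<forall>w. k \<le> length w \<longrightarrow> y @ w \<in> dom h'" if y: "y \<in> code_of (ran f)" for y
  proof -
    obtain x where x: "f x = Some y" using y code_of_subset[OF R] by (auto simp: ran_def)
    then obtain k where k: "\<And>w. k \<le> length w \<Longrightarrow> x @ w \<in> dom (h' \<circ>\<^sub>m f)"
      using s unfolding bd_sub_def by blast
    have "y @ w \<in> dom h'" if "k \<le> length w" for w
      using k[OF that] ideal_morphismD[OF m(1) x, of w] by (auto simp: map_comp_def split: option.splits)
    then show ?thesis by blast
  qed
  then have "\<exists>k. \<forall>y\<in>code_of (ran f). \<forall>w. k \<le> length w \<longrightarrow> y @ w \<in> dom h'"
    using fin unfolding imC_def by (intro uniform_bound)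
  then obtain k where k: "\<And>y w. y \<in> code_of (ran f) \<Longrightarrow> k \<le> length w \<Longrightarrow> y @ w \<in> dom h'" by blast
  let ?Z = "(\<lambda>v. the (h' v)) ` (\<Union>y\<in>code_of (ran f). (\<lambda>w. y @ w) ` {w. length w \<le> k})"
  have Z: "finite ?Z" using fin finite_words unfolding imC_def by blast
  have R': "right_ideal (ran (h' \<circ>\<^sub>m f))" by (rule right_ideal_ran[OF M(1)])
  have "code_of (ran (h' \<circ>\<^sub>m f)) \<subseteq> ?Z"
  proof
    fix c assume c: "c \<in> code_of (ran (h' \<circ>\<^sub>m f))"
    then have "c \<in> ran (h' \<circ>\<^sub>m f)" by (rule subsetD[OF code_of_subset[OF R']])
    then obtain x where "(h' \<circ>\<^sub>m f) x = Some c" unfolding ran_def by blast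
    then obtain y where y: "f x = Some y" "h' y = Some c" unfolding map_comp_Some_iff by blast
    have "y \<in> ran f" using y(1) by (rule ranI)
    then have "y \<in> ideal_gen (code_of (ran f))" by (simp only: code_of(2)[OF R])
    then obtain p w where p: "p \<in> code_of (ran f)" "y = p @ w" unfolding ideal_gen_def by blast
    show "c \<in> ?Z"
    proof (cases "length w \<le> k")
      case True
      then show ?thesis using p y(2) by (intro image_eqI[of _ _ y]) auto
    next
      case False
      then have "p @ take k w \<in> dom h'" by (intro k[OF p(1)]) simp
      then obtain z where z: "h' (p @ take k w) = Some z" by blast
      from ideal_morphismD[OF m(4) z, of "drop k w"] have cz: "c = z @ drop k w" using p(2) y(2) by simp
      have "p \<in> ran f" using p(1) code_of_subset[OF R] by blast
      then have "p @ take k w \<in> ran f" by (rule right_idealD[OF R])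
      then obtain x' where "f x' = Some (p @ take k w)" by (auto simp: ran_def)
      then have "(h' \<circ>\<^sub>m f) x' = Some z" using z by (simp add: map_comp_def)
      then have "z \<in> ran (h' \<circ>\<^sub>m f)" by (rule ranI)
      then have "z = c" by (rule code_of_minimal[OF R' c]) (use cz in \<open>simp add: prefix_def\<close>)
      moreover have "p @ take k w \<in> (\<Union>y\<in>code_of (ran f). (\<lambda>w. y @ w) ` {w. length w \<le> k})"
        by (rule UN_I[OF p(1)], rule imageI) simp
      ultimately show ?thesis using z by (intro image_eqI[of _ _ "p @ take k w"]) simp_all
    qed
  qed
  then have "finite (imC (h' \<circ>\<^sub>m f))" unfolding imC_def using Z by (rule finite_subset)
  then show ?thesis using finite_imC_cong[OF m(2) M(1) e(2)] by simp
qed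

lemma bd_equiv_empty: "ideal_morphism f \<Longrightarrow> bd_equiv f Map.empty \<Longrightarrow> f = Map.empty"
proof -
  assume f: "ideal_morphism f" and e: "bd_equiv f Map.empty"
  have "ideal_morphism Map.empty" by (rule ideal_morphismI) simp
  with f e have "bd_sub (dom f) {}" by (simp add: bd_equiv_iff)
  then have "x \<notin> dom f" for x
    unfolding bd_sub_def using Ex_list_of_length[where ?'a = bool] by (metis empty_iff order.refl)
  then show ?thesis by (simp add: domIff fun_eq_iff)
qed

lemma D_equivE:
  assumes "D_equiv MbdP (bd_class f) (bd_class g)" "f \<in> carrier RMP" "g \<in> carrier RMP"
  obtains z n n' k k' where "z \<in> carrier RMP"
    "n \<in> carrier RMP" "bd_equiv f (z \<circ>\<^sub>m n)" "n' \<in> carrier RMP" "bd_equiv z (f \<circ>\<^sub>m n')"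
    "k \<in> carrier RMP" "bd_equiv z (k \<circ>\<^sub>m g)" "k' \<in> carrier RMP" "bd_equiv g (k' \<circ>\<^sub>m z)"
proof -
  obtain Z where Z: "Z \<in> bd_class ` carrier RMP" "R_equiv MbdP (bd_class f) Z \<and> L_equiv MbdP Z (bd_class g)"
    using assms(1) unfolding D_equiv_def carrier_MbdP by (rule bexE)
  obtain z where z: "z \<in> carrier RMP" "Z = bd_class z" using Z(1) by (rule imageE)
  have le: "R_le MbdP (bd_class f) (bd_class z)" "R_le MbdP (bd_class z) (bd_class f)"
    "L_le MbdP (bd_class z) (bd_class g)" "L_le MbdP (bd_class g) (bd_class z)"
    using Z(2) unfolding z(2) R_equiv_def L_equiv_def by simp_all
  obtain n where n: "n \<in> carrier RMP" "bd_equiv f (z \<circ>\<^sub>m n)" by (rule R_leD[OF assms(2) z(1) le(1)])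
  obtain n' where n': "n' \<in> carrier RMP" "bd_equiv z (f \<circ>\<^sub>m n')" by (rule R_leD[OF z(1) assms(2) le(2)])
  obtain k where k: "k \<in> carrier RMP" "bd_equiv z (k \<circ>\<^sub>m g)" by (rule L_leD[OF z(1) assms(3) le(3)])
  obtain k' where k': "k' \<in> carrier RMP" "bd_equiv g (k' \<circ>\<^sub>m z)" by (rule L_leD[OF assms(3) z(1) le(4)])
  show ?thesis by (rule that[OF z(1) n n' k k'])
qed

lemma D_equiv_finite_imC:
  assumes fg: "f \<in> carrier RMP" "g \<in> carrier RMP" and D: "D_equiv MbdP (bd_class f) (bd_class g)"
  shows "finite (imC f) \<longleftrightarrow> finite (imC g)"
proof -
  obtain z n n' k k' where z: "z \<in> carrier RMP"
    and n: "n \<in> carrier RMP" "bd_equiv f (z \<circ>\<^sub>m n)" and n': "n' \<in> carrier RMP" "bd_equiv z (f \<circ>\<^sub>m n')"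
    and k: "k \<in> carrier RMP" "bd_equiv z (k \<circ>\<^sub>m g)" and k': "k' \<in> carrier RMP" "bd_equiv g (k' \<circ>\<^sub>m z)"
    by (rule D_equivE[OF D fg])
  note M = RMP_morphism[OF fg(1)] RMP_morphism[OF fg(2)] RMP_morphism[OF z] RMP_morphism[OF n(1)] RMP_morphism[OF n'(1)]
    RMP_morphism[OF k(1)] RMP_morphism[OF k'(1)]
  have "finite (imC f) \<longleftrightarrow> finite (imC z)"
    using finite_imC_R[OF M(1,3,4,5) n(2) n'(2)] finite_imC_R[OF M(3,1,5,4) n'(2) n(2)] by blast
  moreover have "finite (imC z) \<longleftrightarrow> finite (imC g)"
    using finite_imC_L[OF M(3,2,6,7) k(2) k'(2)] finite_imC_L[OF M(2,3,7,6) k'(2) k(2)] by blast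
  ultimately show ?thesis by blast
qed

lemma D_equiv_empty:
  assumes fg: "f \<in> carrier RMP" "g \<in> carrier RMP" and D: "D_equiv MbdP (bd_class f) (bd_class g)"
  shows "f = Map.empty \<longleftrightarrow> g = Map.empty"
proof -
  obtain z n n' k k' where z: "z \<in> carrier RMP"
    and n: "n \<in> carrier RMP" "bd_equiv f (z \<circ>\<^sub>m n)" and n': "n' \<in> carrier RMP" "bd_equiv z (f \<circ>\<^sub>m n')"
    and k: "k \<in> carrier RMP" "bd_equiv z (k \<circ>\<^sub>m g)" and k': "k' \<in> carrier RMP" "bd_equiv g (k' \<circ>\<^sub>m z)"
    by (rule D_equivE[OF D fg])
  have e: "Map.empty \<circ>\<^sub>m h = Map.empty" "h \<circ>\<^sub>m Map.empty = Map.empty" for h :: "word \<rightharpoonup> word"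
    by (rule ext, simp add: map_comp_def split: option.split)+
  note E = bd_equiv_empty[OF RMP_morphism]
  show ?thesis
  proof
    assume "f = Map.empty"
    then have "z = Map.empty" using E[OF z] n'(2) e by simp
    then show "g = Map.empty" using E[OF fg(2)] k'(2) e by simp
  next
    assume "g = Map.empty"
    then have "z = Map.empty" using E[OF z] k(2) e by simp
    then show "f = Map.empty" using E[OF fg(1)] n(2) e by simp
  qed
qed

section \<open>Morphisms determined by a prefix code\<close>

text \<open>
  The right-ideal morphism determined by its values on a prefix code. The choice is unambiguous because at
  most one prefix of \<open>v\<close> is in the code.
\<close>

definition extension :: "(word \<rightharpoonup> word) \<Rightarrow> word \<rightharpoonup> word" where
  "extension \<phi> v = (if \<exists>a b u. v = a @ u \<and> \<phi> a = Some b
     then Some (SOME y. \<exists>a b u. v = a @ u \<and> \<phi> a = Some b \<and> y = b @ u) else None)"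

lemma extension_eq:
  assumes p: "prefix_code (dom \<phi>)" and a: "\<phi> a = Some b"
  shows "extension \<phi> (a @ u) = Some (b @ u)"
proof -
  have "y = b @ u" if y: "\<exists>a' b' u'. a @ u = a' @ u' \<and> \<phi> a' = Some b' \<and> y = b' @ u'" for y
  proof -
    obtain a' b' u' where 1: "a @ u = a' @ u'" "\<phi> a' = Some b'" "y = b' @ u'" using y by blast
    have "prefix a (a @ u)" by simp
    moreover have "prefix a' (a @ u)" unfolding 1(1) by simp
    ultimately have "pref_comparable a a'" unfolding pref_comparable_def by (rule prefix_same_cases)
    then have "a = a'" using p domI[of \<phi>, OF a] domI[of \<phi>, OF 1(2)] unfolding prefix_code_def by blast
    with 1 a show ?thesis by simp
  qed
  then have "(SOME y. \<exists>a' b' u'. a @ u = a' @ u' \<and> \<phi> a' = Some b' \<and> y = b' @ u') = b @ u"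
    by (intro some_equality) (use a in blast)+
  then show ?thesis unfolding extension_def using a by auto
qed

lemma extension_SomeE:
  assumes "prefix_code (dom \<phi>)" "extension \<phi> v = Some y"
  obtains a b u where "v = a @ u" "\<phi> a = Some b" "y = b @ u"
proof -
  obtain a b u where 1: "v = a @ u" "\<phi> a = Some b"
    using assms(2) unfolding extension_def by (auto split: if_splits)
  then have "y = b @ u" using extension_eq[OF assms(1) 1(2)] assms(2) by simp
  with 1 that show ?thesis by blast
qed

lemma dom_extension: "dom (extension \<phi>) = ideal_gen (dom \<phi>)"
proof -
  have "extension \<phi> v \<noteq> None \<longleftrightarrow> v \<in> ideal_gen (dom \<phi>)" for v
    unfolding extension_def ideal_gen_def by auto
  then show ?thesis by blast
qed

text \<open>
  The prefix of a word that lies in the code is found by dropping letters from the end, that is, by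
  dividing by powers of 2. The clause \<^term>\<open>n \<le> j\<close> only ensures that the search ends: the quotient is then 0.
\<close>

lemma hat_extension:
  assumes p: "prefix_code (dom \<phi>)"
  shows "hat (extension \<phi>) = (\<lambda>n. let j = (LEAST j. n \<le> j \<or> hat \<phi> (n div 2 ^ j) \<noteq> 0) in
    if hat \<phi> (n div 2 ^ j) = 0 then 0 else hat \<phi> (n div 2 ^ j) * 2 ^ j + n mod 2 ^ j)"
proof (rule hat_eqI[symmetric])
  fix v
  let ?P = "\<lambda>j. code v \<le> j \<or> hat \<phi> (code v div 2 ^ j) \<noteq> 0"
  define j where "j = (LEAST j. ?P j)"
  have j: "?P j" unfolding j_def by (rule LeastI[of _ "code v"]) simp
  have split: "\<exists>a u b. v = a @ u \<and> length u = i \<and> \<phi> a = Some b \<and> hat \<phi> (code v div 2 ^ i) = code b"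
    if i: "hat \<phi> (code v div 2 ^ i) \<noteq> 0" for i
  proof -
    have "i \<le> length v"
    proof (rule ccontr)
      assume "\<not> i \<le> length v"
      then have "(2::nat) ^ Suc (length v) \<le> 2 ^ i" by (intro power_increasing) auto
      then have "code v div 2 ^ i = 0" using code_bounds(2)[of v] by simp
      with i show False by simp
    qed
    define a where "a = take (length v - i) v"
    define u where "u = drop (length v - i) v"
    have v: "v = a @ u" "length u = i" using \<open>i \<le> length v\<close> by (simp_all add: a_def u_def)
    then have d: "code v div 2 ^ i = code a" by (metis code_prefix_div)
    obtain b where "\<phi> a = Some b" using i unfolding d hat_code by (auto split: option.splits)
    moreover from this have "hat \<phi> (code v div 2 ^ i) = code b" unfolding d hat_code by simp
    ultimately show ?thesis using v by blast
  qed
  have goal: "(if hat \<phi> (code v div 2 ^ j) = 0 then 0 else hat \<phi> (code v div 2 ^ j) * 2 ^ j + code v mod 2 ^ j)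
     = (case extension \<phi> v of None \<Rightarrow> 0 | Some y \<Rightarrow> code y)"
  proof (cases "extension \<phi> v")
    case None
    have "hat \<phi> (code v div 2 ^ j) = 0"
    proof (rule ccontr)
      assume "hat \<phi> (code v div 2 ^ j) \<noteq> 0"
      from split[OF this] obtain a u b where "v = a @ u" "\<phi> a = Some b" by blast
      then have "extension \<phi> v = Some (b @ u)" using extension_eq[OF p] by simp
      with None show False by simp
    qed
    with None show ?thesis by simp
  next
    case (Some y)
    obtain a b u where 1: "v = a @ u" "\<phi> a = Some b" "y = b @ u"
      by (rule extension_SomeE[OF p Some])
    have "hat \<phi> (code v div 2 ^ length u) = code b"
      unfolding 1(1) code_prefix_div hat_code 1(2) by simp
    then have "j \<le> length u" unfolding j_def by (intro Least_le) simp
    also have "length u \<le> length v" using 1(1) by simp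
    also have "length v < code v" by (rule less_le_trans[OF less_exp code_bounds(1)])
    finally have "hat \<phi> (code v div 2 ^ j) \<noteq> 0" using j by simp
    from split[OF this] obtain a' u' b' where
      2: "v = a' @ u'" "length u' = j" "\<phi> a' = Some b'" "hat \<phi> (code v div 2 ^ j) = code b'" by blast
    have "y = b' @ u'" using extension_eq[OF p 2(3), of u'] Some 2(1) by simp
    moreover have "code v mod 2 ^ j = val u'" unfolding 2(1) 2(2)[symmetric] by (rule code_suffix_mod)
    ultimately show ?thesis using Some 2 by (simp add: code_append)
  qed
  then show "(let j = (LEAST j. ?P j) in
      if hat \<phi> (code v div 2 ^ j) = 0 then 0 else hat \<phi> (code v div 2 ^ j) * 2 ^ j + code v mod 2 ^ j)
     = (case extension \<phi> v of None \<Rightarrow> 0 | Some y \<Rightarrow> code y)"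
    unfolding Let_def j_def .
qed simp

lemma computable_extension:
  assumes p: "prefix_code (dom \<phi>)" and c: "computable (hat \<phi>)"
  shows "computable_morphism (extension \<phi>)"
  unfolding computable_morphism_def
proof
  show "ideal_morphism (extension \<phi>)"
  proof (rule ideal_morphismI)
    fix x y w assume "extension \<phi> x = Some y"
    then obtain a b u where "x = a @ u" "\<phi> a = Some b" "y = b @ u" by (rule extension_SomeE[OF p])
    then show "extension \<phi> (x @ w) = Some (y @ w)" using extension_eq[OF p, of a b "u @ w"] by simp
  qed
  let ?J = "\<lambda>n. LEAST j. n \<le> j \<or> hat \<phi> (n div 2 ^ j) \<noteq> 0"
  have J: "computable ?J"
    by (intro computable_Least computable_intros computable_comp[OF c]) auto
  show "computable (hat (extension \<phi>))"
    unfolding hat_extension[OF p] Let_def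
    by (intro computable_intros computable_comp[OF c] J)
qed

section \<open>Morphisms with matching images are D-equivalent\<close>

text \<open>
  A computable right inverse of \<open>f\<close>, defined on a prefix code that generates the image of \<open>f\<close> up to padding.
\<close>

definition section_of :: "(word \<rightharpoonup> word) \<Rightarrow> (word \<rightharpoonup> word) \<Rightarrow> bool" where
  "section_of f \<phi> \<longleftrightarrow> prefix_code (dom \<phi>) \<and> computable (hat \<phi>) \<and> (\<forall>y x. \<phi> y = Some x \<longrightarrow> f x = Some y) \<and>
     bd_sub (ran f) (ideal_gen (dom \<phi>))"

lemma extension_inverse:
  assumes p: "prefix_code (dom \<phi>)" "prefix_code (dom \<psi>)" and inv: "\<And>y z. \<phi> y = Some z \<Longrightarrow> \<psi> z = Some y"
    and v: "extension \<phi> v = Some x"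
  shows "extension \<psi> x = Some v"
proof -
  obtain a b u where 1: "v = a @ u" "\<phi> a = Some b" "x = b @ u" by (rule extension_SomeE[OF p(1) v])
  then show ?thesis using extension_eq[OF p(2) inv[OF 1(2)], of u] by simp
qed

lemma section_of_extension:
  assumes s: "section_of f \<phi>" and f: "ideal_morphism f" and v: "extension \<phi> v = Some x"
  shows "f x = Some v"
proof -
  have p: "prefix_code (dom \<phi>)" using s by (simp add: section_of_def)
  obtain a b u where 1: "v = a @ u" "\<phi> a = Some b" "x = b @ u" by (rule extension_SomeE[OF p v])
  then have "f b = Some a" using s by (simp add: section_of_def)
  from ideal_morphismD[OF f this, of u] 1 show ?thesis by simp
qed

text \<open>
  Restricting \<open>f\<close> to the preimage of almost all of its image does not change its class.
\<close>

lemma corestrict_bd_equiv: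
  assumes f: "ideal_morphism f" and h: "ideal_morphism h" "h \<subseteq>\<^sub>m f"
    and R: "bd_sub (ran f) R" and d: "\<And>x y. f x = Some y \<Longrightarrow> y \<in> R \<Longrightarrow> x \<in> dom h"
  shows "bd_equiv f h"
proof (rule bd_equiv_sym[OF h(1) f], rule bd_equiv_restrict[OF h(1) f h(2)])
  show "bd_sub (dom f) (dom h)"
    unfolding bd_sub_def
  proof
    fix x assume "x \<in> dom f"
    then obtain y where y: "f x = Some y" by blast
    then have "y \<in> ran f" by (rule ranI)
    then obtain k where k: "\<And>w. k \<le> length w \<Longrightarrow> y @ w \<in> R" using R unfolding bd_sub_def by blast
    have "x @ w \<in> dom h" if "k \<le> length w" for w
      using d[OF ideal_morphismD[OF f y] k[OF that]] .
    then show "\<exists>k. \<forall>w. k \<le> length w \<longrightarrow> x @ w \<in> dom h" by blast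
  qed
qed

text \<open>
  With \<open>z = \<tau>' g\<close>, extended to ideals, one has \<open>z = f (\<phi> z)\<close>, while \<open>z (\<psi> \<tau> f)\<close> and \<open>\<tau> z\<close> are restrictions of
  \<open>f\<close> and \<open>g\<close> as in \<open>corestrict_bd_equiv\<close>. The morphism \<open>z\<close> is replaced by an equivalent \<open>z0\<close> in \<^const>\<open>RMP\<close>.
\<close>

lemma D_equivI:
  assumes f: "f \<in> carrier RMP" and g: "g \<in> carrier RMP"
    and \<phi>: "section_of f \<phi>" and \<psi>: "section_of g \<psi>"
    and \<tau>: "dom \<tau> = dom \<phi>" "dom \<tau>' = dom \<psi>" "\<And>y z. \<tau> y = Some z \<longleftrightarrow> \<tau>' z = Some y"
      "computable (hat \<tau>)" "computable (hat \<tau>')"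
  shows "D_equiv MbdP (bd_class f) (bd_class g)"
proof -
  have p: "prefix_code (dom \<phi>)" "prefix_code (dom \<psi>)" and c: "computable (hat \<phi>)" "computable (hat \<psi>)"
    and b: "bd_sub (ran f) (ideal_gen (dom \<phi>))" "bd_sub (ran g) (ideal_gen (dom \<psi>))"
    using \<phi> \<psi> by (simp_all add: section_of_def)
  have p': "prefix_code (dom \<tau>)" "prefix_code (dom \<tau>')" using p \<tau>(1,2) by simp_all
  define t where "t = extension \<tau>"
  define t' where "t' = extension \<tau>'"
  define sf where "sf = extension \<phi>"
  define sg where "sg = extension \<psi>"
  have C: "computable_morphism t" "computable_morphism t'" "computable_morphism sf" "computable_morphism sg"
    unfolding t_def t'_def sf_def sg_def using p p' c \<tau>(4,5) by (simp_all add: computable_extension)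
  have Cf: "computable_morphism f" and Cg: "computable_morphism g" using f g by (simp_all add: RMP_computable)
  note mf = RMP_morphism[OF f] and mg = RMP_morphism[OF g]
  have tt': "t' w = Some v" if "t v = Some w" for v w
    using extension_inverse[OF p', of v w] \<tau>(3) that unfolding t_def t'_def by blast
  have t't: "t v = Some w" if "t' w = Some v" for v w
    using extension_inverse[OF p'(2,1), of w v] \<tau>(3) that unfolding t_def t'_def by blast
  have fs: "f x = Some v" if "sf v = Some x" for v x
    using section_of_extension[OF \<phi> mf] that unfolding sf_def .
  have gs: "g x = Some v" if "sg v = Some x" for v x
    using section_of_extension[OF \<psi> mg] that unfolding sg_def .
  have dt: "dom t = ideal_gen (dom \<phi>)" "dom t' = ideal_gen (dom \<psi>)" "dom sf = dom t" "dom sg = dom t'"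
    unfolding t_def t'_def sf_def sg_def dom_extension by (simp_all add: \<tau>)
  define z where "z = t' \<circ>\<^sub>m g"
  have Cz: "computable_morphism z" unfolding z_def by (rule computable_morphism_comp[OF C(2) Cg])
  then have mz: "ideal_morphism z" by (simp add: computable_morphism_def)
  obtain z0 where z0: "z0 \<in> carrier RMP" "bd_equiv z0 z" by (rule computable_morphism_RMP[OF Cz])
  note mz0 = RMP_morphism[OF z0(1)]
  have zD: "z x = Some v \<longleftrightarrow> (\<exists>w. g x = Some w \<and> t' w = Some v)" for x v
    unfolding z_def map_comp_Some_iff by blast
  have M: "ideal_morphism h" if "computable_morphism h" for h using that by (simp add: computable_morphism_def)
  define n where "n = sf \<circ>\<^sub>m z"
  have Cn: "computable_morphism n" unfolding n_def by (rule computable_morphism_comp[OF C(3) Cz])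
  define m where "m = (sg \<circ>\<^sub>m t) \<circ>\<^sub>m f"
  have Cm: "computable_morphism m" unfolding m_def by (rule computable_morphism_comp[OF computable_morphism_comp[OF C(4,1)] Cf])
  have fn: "f \<circ>\<^sub>m n = z"
  proof
    fix x show "(f \<circ>\<^sub>m n) x = z x"
    proof (cases "z x")
      case None
      then show ?thesis by (simp add: n_def map_comp_def)
    next
      case (Some v)
      then obtain w where "t' w = Some v" using zD by blast
      then have "v \<in> dom sf" using t't dt(3) by blast
      then obtain y where y: "sf v = Some y" by blast
      from fs[OF y] Some y show ?thesis by (simp add: n_def map_comp_def)
    qed
  qed
  have zm: "bd_equiv f (z \<circ>\<^sub>m m)"
  proof (rule corestrict_bd_equiv[OF mf ideal_morphism_comp[OF mz M[OF Cm]] _ b(1)])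
    \<comment> \<open>on the preimage of the ideal generated by the code, \<open>f\<close> and \<open>z m\<close> agree\<close>
    have eq: "(z \<circ>\<^sub>m m) x = Some v" if "f x = Some v" "t v = Some w" for x v w
    proof -
      have "w \<in> dom sg" using tt'[OF that(2)] dt(4) by blast
      then obtain y where y: "sg w = Some y" by blast
      have "m x = Some y" using that y by (simp add: m_def map_comp_def)
      moreover have "z y = Some v" using zD gs[OF y] tt'[OF that(2)] by blast
      ultimately show ?thesis by (simp add: map_comp_def)
    qed
    show "z \<circ>\<^sub>m m \<subseteq>\<^sub>m f"
      unfolding map_le_def
    proof
      fix x assume "x \<in> dom (z \<circ>\<^sub>m m)"
      then obtain y where "m x = Some y" unfolding dom_comp_iff by blast
      then obtain v w where "f x = Some v" "t v = Some w" unfolding m_def map_comp_Some_iff by blast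
      with eq show "(z \<circ>\<^sub>m m) x = f x" by simp
    qed
    fix x v assume v: "f x = Some v" "v \<in> ideal_gen (dom \<phi>)"
    then obtain w where "t v = Some w" using dt(1) by blast
    from eq[OF v(1) this] show "x \<in> dom (z \<circ>\<^sub>m m)" by blast
  qed
  have tz: "bd_equiv g (t \<circ>\<^sub>m z)"
  proof (rule corestrict_bd_equiv[OF mg ideal_morphism_comp[OF M[OF C(1)] mz] _ b(2)])
    have eq: "(t \<circ>\<^sub>m z) x = Some w" if "g x = Some w" "t' w = Some v" for x v w
      using zD that t't[OF that(2)] unfolding map_comp_Some_iff by blast
    show "t \<circ>\<^sub>m z \<subseteq>\<^sub>m g"
      unfolding map_le_def
    proof
      fix x assume "x \<in> dom (t \<circ>\<^sub>m z)"
      then obtain v where "z x = Some v" unfolding dom_comp_iff by blast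
      then obtain w where "g x = Some w" "t' w = Some v" using zD by blast
      with eq show "(t \<circ>\<^sub>m z) x = g x" by simp
    qed
    fix x w assume w: "g x = Some w" "w \<in> ideal_gen (dom \<psi>)"
    then obtain v where "t' w = Some v" using dt(2) by blast
    from eq[OF w(1) this] show "x \<in> dom (t \<circ>\<^sub>m z)" by blast
  qed
  have zz0: "bd_equiv z z0" by (rule bd_equiv_sym[OF mz0 mz z0(2)])
  have 1: "R_le MbdP (bd_class f) (bd_class z0)"
  proof (rule R_leI[OF f z0(1) Cm])
    have e: "bd_equiv (z \<circ>\<^sub>m m) (z0 \<circ>\<^sub>m m)" by (rule bd_equiv_comp[OF mz mz0 M[OF Cm] M[OF Cm] zz0 bd_equiv_refl[OF M[OF Cm]]])
    show "bd_equiv f (z0 \<circ>\<^sub>m m)"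
      by (rule bd_equiv_trans[OF mf ideal_morphism_comp[OF mz M[OF Cm]] ideal_morphism_comp[OF mz0 M[OF Cm]] zm e])
  qed
  have 2: "R_le MbdP (bd_class z0) (bd_class f)"
    by (rule R_leI[OF z0(1) f Cn]) (simp only: fn z0(2))
  have 3: "L_le MbdP (bd_class z0) (bd_class g)"
    by (rule L_leI[OF z0(1) g C(2)]) (use z0(2) in \<open>simp only: z_def\<close>)
  have 4: "L_le MbdP (bd_class g) (bd_class z0)"
  proof (rule L_leI[OF g z0(1) C(1)])
    note mt = M[OF C(1)]
    have e: "bd_equiv (t \<circ>\<^sub>m z) (t \<circ>\<^sub>m z0)" by (rule bd_equiv_comp[OF mt mt mz mz0 bd_equiv_refl[OF mt] zz0])
    show "bd_equiv g (t \<circ>\<^sub>m z0)"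
      by (rule bd_equiv_trans[OF mg ideal_morphism_comp[OF mt mz] ideal_morphism_comp[OF mt mz0] tz e])
  qed
  show ?thesis
    unfolding D_equiv_def carrier_MbdP R_equiv_def L_equiv_def
    by (rule bexI[OF _ imageI[OF z0(1)]]) (intro conjI 1 2 3 4)
qed

section \<open>Matching sections: finite images\<close>

lemma prefix_code_split:
  assumes p: "prefix_code Y" and y: "y \<in> Y"
  shows "prefix_code (Y - {y} \<union> {y @ [False], y @ [True]})"
  unfolding prefix_code_def
proof (intro ballI impI)
  have *: "a = b" if ab: "a \<in> Y - {y} \<union> {y @ [False], y @ [True]}" "b \<in> Y - {y} \<union> {y @ [False], y @ [True]}"
    and pre: "prefix a b" for a b
  proof -
    consider "a \<in> Y - {y}" "b \<in> Y - {y}" | c where "a \<in> Y - {y}" "b = y @ [c]"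
      | c where "b \<in> Y - {y}" "a = y @ [c]" | c d where "a = y @ [c]" "b = y @ [d]"
      using ab by blast
    then show ?thesis
    proof cases
      case 1
      then show ?thesis using prefix_codeD[OF p _ _ pre] by blast
    next
      case 2
      then have "prefix a y \<or> a = b" using pre by auto
      then show ?thesis using prefix_codeD[OF p _ y] 2(1) by blast
    next
      case 3
      then have "prefix y b" using pre by (auto simp: prefix_def)
      then show ?thesis using prefix_codeD[OF p y] 3(1) by blast
    next
      case 4
      then show ?thesis using pre by (auto simp: prefix_def)
    qed
  qed
  fix a b assume ab: "a \<in> Y - {y} \<union> {y @ [False], y @ [True]}" "b \<in> Y - {y} \<union> {y @ [False], y @ [True]}"
    and c: "pref_comparable a b"
  show "a = b" using *[OF ab] *[OF ab(2,1)] c unfolding pref_comparable_def by blast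
qed

text \<open>
  Replacing one word \<open>y\<close> by \<open>y0\<close> and \<open>y1\<close> makes the code larger by one, and loses only \<open>y\<close> from the ideal.
\<close>

lemma refine_code:
  assumes p: "prefix_code Y" and fin: "finite Y" "Y \<noteq> {}" and N: "card Y \<le> N"
  shows "\<exists>Y'. prefix_code Y' \<and> finite Y' \<and> card Y' = N \<and> ideal_gen Y' \<subseteq> ideal_gen Y \<and> bd_sub (ideal_gen Y) (ideal_gen Y')"
  using N
proof (induction N rule: dec_induct)
  case base
  show ?case using p fin bd_sub_refl[OF right_ideal_ideal_gen, of Y "ideal_gen Y"] by blast
next
  case (step N)
  then obtain Z where Z: "prefix_code Z" "finite Z" "card Z = N" "ideal_gen Z \<subseteq> ideal_gen Y" "bd_sub (ideal_gen Y) (ideal_gen Z)"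
    by blast
  have "0 < card Y" using fin by (simp add: card_gt_0_iff)
  then have "Z \<noteq> {}" using Z(3) step.hyps(1) by auto
  then obtain y where y: "y \<in> Z" by blast
  let ?Z = "Z - {y} \<union> {y @ [False], y @ [True]}"
  have n: "y @ [b] \<notin> Z" for b
    using prefix_codeD[OF Z(1) y, of "y @ [b]"] by auto
  have "card ?Z = card (Z - {y}) + card {y @ [False], y @ [True]}"
    by (rule card_Un_disjoint) (use Z(2) n in auto)
  also have "card (Z - {y}) = N - 1" using Z(3) y by simp
  also have "card {y @ [False], y @ [True]} = 2" by simp
  finally have "card ?Z = Suc N" using \<open>0 < card Y\<close> step.hyps(1) by simp
  moreover have "ideal_gen ?Z \<subseteq> ideal_gen Z"
  proof
    fix v assume "v \<in> ideal_gen ?Z"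
    then obtain a where "a \<in> ?Z" "prefix a v" unfolding in_ideal_gen_iff by blast
    moreover have "prefix y v" if "prefix (y @ [b]) v" for b using that by (auto simp: prefix_def)
    ultimately show "v \<in> ideal_gen Z" using y unfolding in_ideal_gen_iff by blast
  qed
  moreover have "bd_sub (ideal_gen Z) (ideal_gen ?Z)"
    unfolding bd_sub_def
  proof (intro ballI exI[of _ 1] allI impI)
    fix v and w :: word assume "v \<in> ideal_gen Z" and w: "1 \<le> length w"
    then obtain a u where a: "v = a @ u" "a \<in> Z" unfolding ideal_gen_def by blast
    show "v @ w \<in> ideal_gen ?Z"
    proof (cases "a = y")
      case True
      obtain b t where bt: "u @ w = b # t" using w by (cases "u @ w") auto
      have "v @ w = (y @ [b]) @ t" using a(1) True bt by simp
      moreover have "y @ [b] \<in> ?Z" by (cases b) auto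
      ultimately show ?thesis unfolding ideal_gen_def by blast
    next
      case False
      then have "a \<in> ?Z" "v @ w = a @ (u @ w)" using a by auto
      then show ?thesis unfolding ideal_gen_def by blast
    qed
  qed
  ultimately show ?case
    using prefix_code_split[OF Z(1) y] Z(2,4) bd_sub_trans[OF Z(5), of "ideal_gen ?Z"]
    by (intro exI[of _ ?Z]) auto
qed

lemma computable_hat_finite: assumes "finite (dom \<phi>)" shows "computable (hat \<phi>)"
proof (rule computable_finite_support)
  have "{n. hat \<phi> n \<noteq> 0} \<subseteq> code ` dom \<phi>"
  proof
    fix n assume n: "n \<in> {n. hat \<phi> n \<noteq> 0}"
    then have "n \<noteq> 0" by (intro notI) simp
    then obtain v where v: "n = code v" using code_surj[of n] by auto
    then have "v \<in> dom \<phi>" using n by (auto simp: hat_code split: option.splits)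
    then show "n \<in> code ` dom \<phi>" using v by blast
  qed
  then show "finite {n. hat \<phi> n \<noteq> 0}" using assms by (rule finite_subset[OF _ finite_imageI])
qed

lemma finite_section:
  assumes f: "ideal_morphism f" "f \<noteq> Map.empty" and fin: "finite (imC f)" and N: "card (imC f) \<le> N"
  obtains \<phi> where "section_of f \<phi>" "finite (dom \<phi>)" "card (dom \<phi>) = N"
proof -
  note R = right_ideal_ran[OF f(1)]
  have I: "prefix_code (imC f)" "ideal_gen (imC f) = ran f"
    unfolding imC_def using code_of[OF R] by simp_all
  have "imC f \<noteq> {}"
  proof
    assume "imC f = {}"
    then have "ran f = {}" using I(2) by (auto simp: ideal_gen_def)
    then show False using f(2) by (auto simp: ran_def fun_eq_iff)
  qed
  from refine_code[OF I(1) fin this N] obtain Y where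
    Y: "prefix_code Y" "finite Y" "card Y = N" "ideal_gen Y \<subseteq> ran f" "bd_sub (ran f) (ideal_gen Y)"
    unfolding I(2) by blast
  define \<phi> where "\<phi> y = (if y \<in> Y then Some (SOME x. f x = Some y) else None)" for y
  have d: "dom \<phi> = Y" unfolding \<phi>_def dom_def by simp
  have "f x = Some y" if "\<phi> y = Some x" for x y
  proof -
    have "y \<in> Y" and x: "x = (SOME x. f x = Some y)" using that unfolding \<phi>_def by (auto split: if_splits)
    then have "y \<in> ideal_gen Y" unfolding in_ideal_gen_iff by blast
    then have "y \<in> ran f" using Y(4) by blast
    then have "\<exists>x. f x = Some y" by (simp add: ran_def)
    then show ?thesis unfolding x by (rule someI_ex)
  qed
  then have "section_of f \<phi>"
    unfolding section_of_def d using Y(1,5) computable_hat_finite[of \<phi>] d Y(2) by simp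
  then show ?thesis by (rule that) (simp_all add: d Y(2,3))
qed

lemma D_equiv_finite:
  assumes f: "f \<in> carrier RMP" "f \<noteq> Map.empty" "finite (imC f)"
    and g: "g \<in> carrier RMP" "g \<noteq> Map.empty" "finite (imC g)"
  shows "D_equiv MbdP (bd_class f) (bd_class g)"
proof -
  let ?N = "max (card (imC f)) (card (imC g))"
  obtain \<phi> where \<phi>: "section_of f \<phi>" "finite (dom \<phi>)" "card (dom \<phi>) = ?N"
    by (rule finite_section[OF RMP_morphism[OF f(1)] f(2,3), of ?N]) simp_all
  obtain \<psi> where \<psi>: "section_of g \<psi>" "finite (dom \<psi>)" "card (dom \<psi>) = ?N"
    by (rule finite_section[OF RMP_morphism[OF g(1)] g(2,3), of ?N]) simp_all
  obtain \<beta> where \<beta>: "bij_betw \<beta> (dom \<phi>) (dom \<psi>)"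
    using finite_same_card_bij[OF \<phi>(2) \<psi>(2)] \<phi>(3) \<psi>(3) by auto
  define \<tau> where "\<tau> y = (if y \<in> dom \<phi> then Some (\<beta> y) else None)" for y
  define \<tau>' where "\<tau>' z = (if z \<in> dom \<psi> then Some (the_inv_into (dom \<phi>) \<beta> z) else None)" for z
  have d: "dom \<tau> = dom \<phi>" "dom \<tau>' = dom \<psi>" unfolding \<tau>_def \<tau>'_def by (auto simp: dom_def)
  have inv: "\<tau> y = Some z \<longleftrightarrow> \<tau>' z = Some y" for y z
  proof -
    have inj: "inj_on \<beta> (dom \<phi>)" and img: "\<beta> ` dom \<phi> = dom \<psi>" using \<beta> by (simp_all add: bij_betw_def)
    have 1: "\<tau>' (\<beta> y) = Some y" if "y \<in> dom \<phi>" for y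
      using imageI[OF that, of \<beta>] unfolding img by (simp add: \<tau>'_def the_inv_into_f_f[OF inj that])
    have 2: "\<exists>y\<in>dom \<phi>. z = \<beta> y" if "z \<in> dom \<psi>" for z using that unfolding img[symmetric] by blast
    show ?thesis
    proof
      assume "\<tau> y = Some z"
      then have "y \<in> dom \<phi>" "z = \<beta> y" unfolding \<tau>_def by (simp_all split: if_splits)
      then show "\<tau>' z = Some y" using 1 by simp
    next
      assume z: "\<tau>' z = Some y"
      then have "z \<in> dom \<psi>" using d(2) by blast
      then obtain x where x: "x \<in> dom \<phi>" "z = \<beta> x" using 2 by blast
      then have "x = y" using 1[OF x(1)] z by simp
      then show "\<tau> y = Some z" using x by (simp add: \<tau>_def)
    qed
  qed
  show ?thesis
    by (rule D_equivI[OF f(1) g(1) \<phi>(1) \<psi>(1) d inv])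
      (auto intro!: computable_hat_finite simp: d \<phi>(2) \<psi>(2))
qed

section \<open>Matching sections: infinite images\<close>

text \<open>
  The inverse of \<^const>\<open>hat\<close>, for functions with value 0 at 0.
\<close>

definition lift :: "(nat \<Rightarrow> nat) \<Rightarrow> word \<rightharpoonup> word" where
  "lift G v = (if G (code v) = 0 then None else Some (the_inv code (G (code v))))"

lemma lift_Some_iff: "lift G v = Some w \<longleftrightarrow> G (code v) = code w"
proof
  assume "lift G v = Some w"
  then have 1: "G (code v) \<noteq> 0" "w = the_inv code (G (code v))" by (auto simp: lift_def split: if_splits)
  then obtain x where "code x = G (code v)" using code_surj by blast
  then show "G (code v) = code w" using 1(2) the_inv_f_f[OF inj_code, of x] by simp
qed (simp add: lift_def the_inv_f_f[OF inj_code])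

lemma dom_lift: "dom (lift G) = {v. G (code v) \<noteq> 0}"
  by (auto simp: lift_def split: if_splits)

lemma hat_lift: assumes "G 0 = 0" shows "hat (lift G) = G"
proof (rule hat_eqI[symmetric])
  show "G 0 = 0" by (rule assms)
  fix v show "G (code v) = (case lift G v of None \<Rightarrow> 0 | Some y \<Rightarrow> code y)"
  proof (cases "lift G v")
    case None
    then show ?thesis by (simp add: lift_def split: if_splits)
  next
    case (Some y)
    then have "G (code v) = code y" unfolding lift_Some_iff .
    then show ?thesis using Some by simp
  qed
qed

text \<open>
  A decidable part of the image, where \<open>F\<close> is \<open>hat f\<close>: the codes of those words with a preimage whose
  code is at most the square of their own. If \<open>f x = y\<close>, then appending \<open>w\<close> to both multiplies both codes by
  about the same factor; so this condition is inherited by extensions and holds for all long ones.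
\<close>

definition early :: "(nat \<Rightarrow> nat) \<Rightarrow> nat \<Rightarrow> bool" where
  "early F n \<longleftrightarrow> n \<noteq> 0 \<and> (\<exists>i<Suc (n * n). F i = n)"

text \<open>
  Halving a code drops the last letter, so these are the minimal elements of the ideal of early words.
\<close>

definition early_min :: "(nat \<Rightarrow> nat) \<Rightarrow> nat \<Rightarrow> bool" where
  "early_min F n \<longleftrightarrow> early F n \<and> \<not> early F (n div 2)"

lemma decidable_early: assumes "computable F" "computable A" shows "decidable (\<lambda>x. early F (A x))"
proof -
  have "decidable (\<lambda>n. n \<noteq> 0 \<and> (\<exists>i<Suc (n * n). F i = n))"
    by (intro decidable_conj decidable_bex computable_intros computable_comp[OF assms(1)])
  then have "decidable (early F)" unfolding early_def .
  then show ?thesis by (rule computable_comp[OF _ assms(2)])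
qed

lemma early_snoc:
  assumes f: "ideal_morphism f" and v: "early (hat f) (code v)"
  shows "early (hat f) (code (v @ [b]))"
proof -
  obtain i where i: "i < Suc (code v * code v)" "hat f i = code v" using v unfolding early_def by blast
  then have "i \<noteq> 0" by (intro notI) simp
  then obtain x where x: "i = code x" using code_surj[of i] by auto
  then have "f x = Some v" using i(2) by (auto simp: hat_code split: option.splits)
  from ideal_morphismD[OF f this, of "[b]"] have "hat f (code (x @ [b])) = code (v @ [b])"
    by (simp only: hat_code) simp
  moreover have "code (x @ [b]) < Suc (code (v @ [b]) * code (v @ [b]))"
  proof -
    define c where "c = code v"
    have "1 \<le> c" using code_pos(2)[of v] unfolding c_def by linarith
    then have "1 \<le> c * c" by simp
    have "code (x @ [b]) \<le> 2 * code x + 1" by simp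
    also have "\<dots> \<le> 2 * (c * c) + 1" using i(1) x unfolding c_def by simp
    also have "\<dots> \<le> (2 * c) * (2 * c)" using \<open>1 \<le> c * c\<close> by simp
    also have "\<dots> \<le> code (v @ [b]) * code (v @ [b])" unfolding c_def by (intro mult_mono) simp_all
    finally show ?thesis by simp
  qed
  ultimately show ?thesis unfolding early_def using code_pos(1) by blast
qed

lemma early_append:
  assumes f: "ideal_morphism f" and v: "early (hat f) (code v)"
  shows "early (hat f) (code (v @ u))"
proof (induction u rule: rev_induct)
  case (snoc b u)
  from early_snoc[OF f this, of b] show ?case by simp
qed (use v in simp)

lemma half_code: "code (v @ [b]) div 2 = code v" by simp

lemma prefix_code_early_min:
  assumes f: "ideal_morphism f" shows "prefix_code {v. early_min (hat f) (code v)}"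
proof -
  have "a = b" if a: "early_min (hat f) (code a)" and b: "early_min (hat f) (code b)" and p: "prefix a b" for a b
  proof (rule ccontr)
    assume "a \<noteq> b"
    then obtain u where u: "b = a @ u" "u \<noteq> []" using p by (auto simp: prefix_def)
    then obtain t c where t: "u = t @ [c]" by (metis rev_exhaust)
    have "early (hat f) (code (a @ t))" using early_append[OF f] a unfolding early_min_def by blast
    then have "early (hat f) (code b div 2)" unfolding u(1) t append_assoc[symmetric] half_code .
    then show False using b unfolding early_min_def by blast
  qed
  then show ?thesis unfolding prefix_code_def pref_comparable_def by blast
qed

lemma early_in_ideal_gen: "early (hat f) (code v) \<Longrightarrow> v \<in> ideal_gen {v. early_min (hat f) (code v)}"
proof (induction v rule: rev_induct)
  case Nil
  have "\<not> early (hat f) (code [] div 2)" by (simp add: early_def)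
  then have "early_min (hat f) (code [])" using Nil unfolding early_min_def by blast
  then show ?case unfolding in_ideal_gen_iff by blast
next
  case (snoc b v)
  show ?case
  proof (cases "early (hat f) (code v)")
    case True
    then have "v \<in> ideal_gen {v. early_min (hat f) (code v)}" by (rule snoc.IH)
    then show ?thesis by (rule right_idealD[OF right_ideal_ideal_gen])
  next
    case False
    then have "early_min (hat f) (code (v @ [b]))" using snoc.prems unfolding early_min_def half_code by blast
    then show ?thesis unfolding in_ideal_gen_iff by blast
  qed
qed

text \<open>
  The code of the early words, with the least preimage as right inverse. It is infinite by
  \<open>finite_code_of\<close>, because it generates the image up to padding.
\<close>

lemma infinite_section:
  assumes f: "computable_morphism f" and inf: "infinite (imC f)"
  obtains \<phi> A where "section_of f \<phi>" "dom \<phi> = {v. A (code v)}" "decidable A" "\<not> A 0" "infinite {n. A n}"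
proof -
  have m: "ideal_morphism f" and c: "computable (hat f)" using f by (simp_all add: computable_morphism_def)
  let ?A = "early_min (hat f)"
  let ?Y = "{v. ?A (code v)}"
  define G where "G n = (if ?A n then (LEAST i. n * n < i \<or> hat f i = n) else 0)" for n
  have cA: "decidable ?A"
    unfolding early_min_def by (intro decidable_conj decidable_not decidable_early c computable_intros)
  have A0: "\<not> ?A 0" by (simp add: early_min_def early_def)
  have "computable (\<lambda>n. LEAST i. n * n < i \<or> hat f i = n)"
    by (intro computable_Least decidable_disj decidable_less decidable_eq computable_mult computable_p1 computable_p2 computable_id computable_comp[OF c]) blast
  then have cG: "computable G" unfolding G_def by (intro computable_if cA computable_const)
  have G: "hat f (G n) = n" if "?A n" for n
  proof -
    obtain i where i: "i < Suc (n * n)" "hat f i = n" using \<open>?A n\<close> unfolding early_min_def early_def by blast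
    let ?l = "LEAST i. n * n < i \<or> hat f i = n"
    have l: "n * n < ?l \<or> hat f ?l = n" by (rule LeastI[of _ i]) (simp add: i(2))
    have "?l \<le> i" by (rule Least_le) (simp add: i(2))
    with i(1) have "\<not> n * n < ?l" by simp
    with l have "hat f ?l = n" by blast
    then show ?thesis using that by (simp add: G_def)
  qed
  have G0: "G n \<noteq> 0 \<longleftrightarrow> ?A n" for n
  proof
    assume A: "?A n"
    then have "n \<noteq> 0" using A0 by metis
    then show "G n \<noteq> 0" using G[OF A] by (metis hat_0)
  qed (simp add: G_def split: if_splits)
  have d: "dom (lift G) = ?Y" unfolding dom_lift G0 ..
  have p: "prefix_code ?Y" by (rule prefix_code_early_min[OF m])
  have s: "f x = Some y" if y: "lift G y = Some x" for x y
  proof -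
    have "G (code y) = code x" using y unfolding lift_Some_iff .
    moreover from this have "?A (code y)" using G0[of "code y"] code_pos(1)[of x] by simp
    ultimately have "hat f (code x) = code y" using G[of "code y"] by simp
    then show ?thesis unfolding hat_code by (auto split: option.splits)
  qed
  have b: "bd_sub (ran f) (ideal_gen ?Y)"
    unfolding bd_sub_def
  proof
    fix y assume "y \<in> ran f"
    then obtain x where x: "f x = Some y" by (auto simp: ran_def)
    have "y @ w \<in> ideal_gen ?Y" if w: "length x + 1 \<le> length w" for w
    proof (rule early_in_ideal_gen)
      have "hat f (code (x @ w)) = code (y @ w)" unfolding hat_code ideal_morphismD[OF m x] by simp
      moreover have "code (x @ w) < Suc (code (y @ w) * code (y @ w))"
      proof -
        have "code (x @ w) < 2 ^ Suc (length (x @ w))" by (rule code_bounds)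
        also have "\<dots> \<le> 2 ^ (length (y @ w) + length (y @ w))" by (rule power_increasing) (use w in auto)
        also have "\<dots> = 2 ^ length (y @ w) * 2 ^ length (y @ w)" by (rule power_add)
        also have "\<dots> \<le> code (y @ w) * code (y @ w)" by (intro mult_mono code_bounds) simp_all
        finally show ?thesis by simp
      qed
      ultimately show "early (hat f) (code (y @ w))" unfolding early_def using code_pos(1) by blast
    qed
    then show "\<exists>k. \<forall>w. k \<le> length w \<longrightarrow> y @ w \<in> ideal_gen ?Y" by blast
  qed
  have "G 0 = 0" using G0[of 0] A0 by simp
  then have sec: "section_of f (lift G)"
    unfolding section_of_def d using p s b cG by (simp add: hat_lift)
  have "ideal_gen ?Y \<subseteq> ran f"
  proof
    fix v assume "v \<in> ideal_gen ?Y"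
    then obtain a u where a: "v = a @ u" "a \<in> dom (lift G)" unfolding ideal_gen_def d by blast
    then obtain x where "lift G a = Some x" by blast
    then have "a \<in> ran f" using s by (intro ranI)
    then show "v \<in> ran f" unfolding a(1) by (rule right_idealD[OF right_ideal_ran[OF m]])
  qed
  then have b': "bd_sub (ideal_gen ?Y) (ran f)" by (rule bd_sub_refl[OF right_ideal_ideal_gen])
  have "infinite {n. ?A n}"
  proof
    assume "finite {n. ?A n}"
    then have "finite (code -` {n. ?A n})" by (rule finite_vimageI[OF _ inj_code])
    then have "finite ?Y" by (simp add: vimage_def)
    then have "finite (code_of (ideal_gen ?Y))" unfolding code_of_ideal_gen[OF p] .
    from finite_code_of[OF right_ideal_ideal_gen right_ideal_ran[OF m] b' b this] inf
    show False unfolding imC_def by simp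
  qed
  then show ?thesis by (rule that[OF sec d cA A0])
qed

text \<open>
  The position of \<open>n\<close> in the increasing enumeration of \<open>A\<close>.
\<close>

definition rank :: "(nat \<Rightarrow> bool) \<Rightarrow> nat \<Rightarrow> nat" where
  "rank A n = (\<Sum>i<n. of_bool (A i))"

lemma rank_Suc: "rank A (Suc n) = rank A n + of_bool (A n)"
  by (simp add: rank_def)

lemma rank_card: "rank A n = card {i. i < n \<and> A i}"
proof (induction n)
  case (Suc n)
  have "{i. i < Suc n \<and> A i} = (if A n then insert n {i. i < n \<and> A i} else {i. i < n \<and> A i})"
    by (auto simp: less_Suc_eq)
  then show ?case using Suc by (simp add: rank_Suc)
qed (simp add: rank_def)

lemma rank_mono: "m \<le> n \<Longrightarrow> rank A m \<le> rank A n"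
  by (induction rule: dec_induct) (auto simp: rank_Suc)

lemma rank_unique:
  assumes "A m" "A n" "rank A m = rank A n" shows "m = n"
proof -
  have *: "\<not> m < n" if "A m" "rank A m = rank A n" for m n
  proof
    assume "m < n"
    then have "rank A (Suc m) \<le> rank A n" by (intro rank_mono) simp
    with that show False by (simp add: rank_Suc)
  qed
  show ?thesis using *[OF assms(1,3)] *[OF assms(2) assms(3)[symmetric]] by simp
qed

text \<open>
  The rank grows by at most 1 at each step and is unbounded, so it passes every value \<open>x\<close>; the last number
  before it exceeds \<open>x\<close> is in \<open>A\<close> and has rank \<open>x\<close>.
\<close>

lemma rank_surj:
  assumes "infinite {n. A n}" shows "\<exists>m. A m \<and> rank A m = x"
proof -
  have "\<exists>n. x < rank A n"
  proof -
    obtain S where S: "S \<subseteq> {n. A n}" "finite S" "card S = Suc x"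
      using infinite_arbitrarily_large[OF assms] by blast
    have "card S \<le> rank A (Suc (Max S))"
    proof -
      have "S \<subseteq> {i. i < Suc (Max S) \<and> A i}" using S Max_ge[OF S(2)] by (auto simp: less_Suc_eq_le)
      then show ?thesis unfolding rank_card by (intro card_mono) auto
    qed
    then show ?thesis using S(3) by (intro exI[of _ "Suc (Max S)"]) simp
  qed
  define n where "n = (LEAST n. x < rank A n)"
  have n: "x < rank A n" unfolding n_def using \<open>\<exists>n. x < rank A n\<close> by (rule LeastI_ex)
  then have "n \<noteq> 0" by (intro notI) (simp add: rank_def)
  then obtain m where m: "n = Suc m" by (cases n) auto
  have "\<not> x < rank A m" using not_less_Least[of m "\<lambda>n. x < rank A n"] m unfolding n_def by simp
  then show ?thesis using n unfolding m rank_Suc by (intro exI[of _ m]) (auto split: if_splits simp: of_bool_def)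
qed

lemma matching:
  assumes A: "decidable A" "\<not> A 0" "infinite {n. A n}" and B: "decidable B" "\<not> B 0" "infinite {n. B n}"
  obtains \<tau> where "computable (hat \<tau>)" "dom \<tau> = {v. A (code v)}"
    "\<And>y z. \<tau> y = Some z \<longleftrightarrow> A (code y) \<and> B (code z) \<and> rank A (code y) = rank B (code z)"
proof -
  have cr: "computable (\<lambda>x. rank C (F x))" if "decidable C" "computable F" for C F
    unfolding rank_def by (intro computable_sum that(2) computable_comp[OF that(1)] computable_p1 computable_id)
  define G where "G n = (if A n then (LEAST m. B m \<and> rank B m = rank A n) else 0)" for n
  have "computable (\<lambda>n. LEAST m. B m \<and> rank B m = rank A n)"
    by (intro computable_Least decidable_conj decidable_eq computable_comp[OF B(1)] cr A(1) B(1) computable_p1 computable_p2 computable_id rank_surj[OF B(3)])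
  then have cG: "computable G" unfolding G_def by (intro computable_if A(1) computable_const)
  have G: "B (G n) \<and> rank B (G n) = rank A n" if "A n" for n
  proof -
    have "B (LEAST m. B m \<and> rank B m = rank A n) \<and> rank B (LEAST m. B m \<and> rank B m = rank A n) = rank A n"
      by (rule LeastI_ex) (rule rank_surj[OF B(3)])
    then show ?thesis using that by (simp add: G_def)
  qed
  have G0: "G n \<noteq> 0 \<longleftrightarrow> A n" for n
  proof
    show "A n \<Longrightarrow> G n \<noteq> 0" using G[of n] B(2) by metis
  qed (simp add: G_def split: if_splits)
  have "G 0 = 0" using G0[of 0] A(2) by simp
  then have h: "computable (hat (lift G))" using cG by (simp add: hat_lift)
  have d: "dom (lift G) = {v. A (code v)}" unfolding dom_lift G0 ..
  have iff: "lift G y = Some z \<longleftrightarrow> A (code y) \<and> B (code z) \<and> rank A (code y) = rank B (code z)" for y z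
    unfolding lift_Some_iff
  proof
    assume e: "G (code y) = code z"
    then have "A (code y)" using G0[of "code y"] code_pos(1)[of z] by simp
    with G[OF this] e show "A (code y) \<and> B (code z) \<and> rank A (code y) = rank B (code z)" by simp
  next
    assume r: "A (code y) \<and> B (code z) \<and> rank A (code y) = rank B (code z)"
    then show "G (code y) = code z" using G[of "code y"] by - (rule rank_unique[of B], simp_all)
  qed
  show ?thesis by (rule that[OF h d iff])
qed

lemma D_equiv_infinite:
  assumes f: "f \<in> carrier RMP" "infinite (imC f)" and g: "g \<in> carrier RMP" "infinite (imC g)"
  shows "D_equiv MbdP (bd_class f) (bd_class g)"
proof -
  obtain \<phi> A where \<phi>: "section_of f \<phi>" "dom \<phi> = {v. A (code v)}" and A: "decidable A" "\<not> A 0" "infinite {n. A n}"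
    by (rule infinite_section[OF RMP_computable[OF f(1)] f(2)])
  obtain \<psi> B where \<psi>: "section_of g \<psi>" "dom \<psi> = {v. B (code v)}" and B: "decidable B" "\<not> B 0" "infinite {n. B n}"
    by (rule infinite_section[OF RMP_computable[OF g(1)] g(2)])
  obtain \<tau> where \<tau>: "computable (hat \<tau>)" "dom \<tau> = {v. A (code v)}"
    "\<And>y z. \<tau> y = Some z \<longleftrightarrow> A (code y) \<and> B (code z) \<and> rank A (code y) = rank B (code z)"
    by (rule matching[OF A B], rule that)
  obtain \<tau>' where \<tau>': "computable (hat \<tau>')" "dom \<tau>' = {v. B (code v)}"
    "\<And>y z. \<tau>' y = Some z \<longleftrightarrow> B (code y) \<and> A (code z) \<and> rank B (code y) = rank A (code z)"
    by (rule matching[OF B A], rule that)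
  show ?thesis
  proof (rule D_equivI[OF f(1) g(1) \<phi>(1) \<psi>(1) _ _ _ \<tau>(1) \<tau>'(1)])
    show "dom \<tau> = dom \<phi>" "dom \<tau>' = dom \<psi>" unfolding \<tau>(2) \<tau>'(2) \<phi>(2) \<psi>(2) by (rule refl)+
    show "\<tau> y = Some z \<longleftrightarrow> \<tau>' z = Some y" for y z unfolding \<tau>(3) \<tau>'(3) by auto
  qed
qed

section \<open>The two nonzero D-classes\<close>

lemma empty_RMP: "Map.empty \<in> carrier RMP"
proof -
  have hat: "hat Map.empty = (\<lambda>_. 0)" by (rule hat_eqI[symmetric]) simp_all
  have "ideal_morphism Map.empty" by (rule ideal_morphismI) simp
  then have "computable_morphism Map.empty"
    unfolding computable_morphism_def hat using computable_const[of 0] by (rule conjI)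
  then obtain h where h: "h \<in> carrier RMP" "bd_equiv h Map.empty" by (rule computable_morphism_RMP)
  show ?thesis using h(1) unfolding bd_equiv_empty[OF RMP_morphism[OF h(1)] h(2)] .
qed

text \<open>
  A padding of the identity.
\<close>

lemma finite_image_exists: "\<exists>f\<in>carrier RMP. f \<noteq> Map.empty \<and> finite (imC f)"
proof -
  have hat: "hat Some = (\<lambda>n. n)" by (rule hat_eqI[symmetric]) simp_all
  have m: "ideal_morphism Some" by (rule ideal_morphismI) simp
  have c: "computable_morphism Some" unfolding computable_morphism_def hat using m computable_id by (rule conjI)
  obtain h where h: "h \<in> carrier RMP" "bd_equiv h Some" using c by (rule computable_morphism_RMP)
  have "prefix_code {[]}" by (simp add: prefix_code_def)
  moreover have "ran Some = ideal_gen {[] :: word}" by (auto simp: ran_def ideal_gen_def)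
  ultimately have "imC Some = {[]}" unfolding imC_def by (simp add: code_of_ideal_gen)
  then have fin: "finite (imC h)" using finite_imC_cong[OF RMP_morphism[OF h(1)] m h(2)] by simp
  have "h \<noteq> Map.empty"
  proof
    assume "h = Map.empty"
    then have "bd_equiv Some Map.empty" using bd_equiv_sym[OF RMP_morphism[OF h(1)] m h(2)] by simp
    from fun_cong[OF bd_equiv_empty[OF m this], of "[]"] show False by simp
  qed
  then have "h \<noteq> Map.empty \<and> finite (imC h)" using fin by (rule conjI)
  then show ?thesis by (rule bexI[OF _ h(1)])
qed

text \<open>
  A padding of the identity restricted to the right ideal generated by the words \<open>0\<^sup>i1\<close>, whose codes are the
  numbers \<open>2 * 2 ^ i + 1\<close>.
\<close>

lemma infinite_image_exists: "\<exists>f\<in>carrier RMP. infinite (imC f)"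
proof -
  define Y where "Y = range (\<lambda>i. replicate i False @ [True])"
  define G where "G n = (if \<exists>i<n. n = 2 * 2 ^ i + 1 then n else 0)" for n :: nat
  have code: "code (replicate i False) = 2 ^ i" for i
  proof (induction i)
    case (Suc i)
    have "replicate (Suc i) False = replicate i False @ [False]" by (simp add: replicate_append_same)
    then show ?case using Suc by (simp only: code_snoc) simp
  qed simp
  have GY: "G (code v) = (if v \<in> Y then code v else 0)" for v
  proof -
    have "(\<exists>i<code v. code v = 2 * 2 ^ i + 1) \<longleftrightarrow> v \<in> Y"
    proof
      assume "\<exists>i<code v. code v = 2 * 2 ^ i + 1"
      then obtain i where "code v = 2 * 2 ^ i + 1" by blast
      then have "code v = code (replicate i False @ [True])" by (simp add: code)
      then have "v = replicate i False @ [True]" unfolding code_eq .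
      then show "v \<in> Y" unfolding Y_def by blast
    next
      assume "v \<in> Y"
      then obtain i where v: "v = replicate i False @ [True]" unfolding Y_def by blast
      have "i < 2 ^ i" by (rule less_exp)
      then have "i < 2 * 2 ^ i + 1" by linarith
      then show "\<exists>i<code v. code v = 2 * 2 ^ i + 1" by (intro exI[of _ i]) (simp add: v code)
    qed
    then show ?thesis by (simp add: G_def)
  qed
  have cG: "computable G" unfolding G_def by (intro computable_if decidable_bex computable_intros)
  have "G 0 = 0" by (simp add: G_def)
  then have h: "computable (hat (lift G))" using cG by (simp add: hat_lift)
  have l: "lift G v = Some w \<longleftrightarrow> v \<in> Y \<and> w = v" for v w
    unfolding lift_Some_iff GY by auto
  then have d: "dom (lift G) = Y" by auto
  have p: "prefix_code Y"
  proof -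
    have "i = j" if ij: "prefix (replicate i False @ [True]) (replicate j False @ [True])" for i j
    proof (rule ccontr)
      assume ne: "i \<noteq> j"
      have "i \<le> j" using prefix_length_le[OF ij] by simp
      with ne have lt: "i < j" by simp
      obtain w where w: "replicate j False @ [True] = (replicate i False @ [True]) @ w" using ij unfolding prefix_def by (rule exE)
      have "(replicate j False @ [True]) ! i = False" using lt by (simp add: nth_append)
      moreover have "((replicate i False @ [True]) @ w) ! i = True" by (simp add: nth_append)
      ultimately show False using w by simp
    qed
    then show ?thesis unfolding prefix_code_def pref_comparable_def Y_def by blast
  qed
  let ?e = "extension (lift G)"
  have c: "computable_morphism ?e" by (rule computable_extension) (simp_all add: d p h)
  then have m: "ideal_morphism ?e" by (simp add: computable_morphism_def)
  have fix_e: "?e v = Some v" if v: "v \<in> ideal_gen Y" for v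
  proof -
    obtain a u where a: "v = a @ u" "a \<in> Y" using v unfolding ideal_gen_def by blast
    have "lift G a = Some a" using l a(2) by blast
    then show ?thesis unfolding a(1) by (intro extension_eq) (simp_all add: d p)
  qed
  have "ran ?e = ideal_gen Y"
  proof (intro equalityI subsetI)
    fix y assume "y \<in> ran ?e"
    then obtain x where x: "?e x = Some y" unfolding ran_def by blast
    then have "x \<in> ideal_gen Y" unfolding d[symmetric] dom_extension[symmetric] by (rule domI)
    with fix_e[OF this] x show "y \<in> ideal_gen Y" by simp
  qed (rule ranI, rule fix_e)
  then have imC: "imC ?e = Y" unfolding imC_def by (simp only: code_of_ideal_gen[OF p])
  have "infinite Y"
    unfolding Y_def
  proof (rule range_inj_infinite, rule injI)
    fix i j :: nat
    assume "replicate i False @ [True] = replicate j False @ [True]"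
    then have "length (replicate i False @ [True]) = length (replicate j False @ [True])" by (simp only:)
    then show "i = j" by (simp only: length_append length_replicate add_right_cancel)
  qed
  then have inf: "infinite (imC ?e)" unfolding imC .
  obtain f where f: "f \<in> carrier RMP" "bd_equiv f ?e" using c by (rule computable_morphism_RMP)
  have "infinite (imC f)" unfolding finite_imC_cong[OF RMP_morphism[OF f(1)] m f(2)] by (rule inf)
  then show ?thesis by (rule bexI[OF _ f(1)])
qed

lemma bd_class_invariants:
  assumes "f \<in> carrier RMP" "h \<in> bd_class f"
  shows "finite (imC h) \<longleftrightarrow> finite (imC f)" "h = Map.empty \<longleftrightarrow> f = Map.empty"
proof -
  note m = RMP_morphism[OF bd_classD(1)[OF assms(2)]] RMP_morphism[OF assms(1)]
  note e = bd_classD(2)[OF assms(2)]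
  show "finite (imC h) \<longleftrightarrow> finite (imC f)" by (rule finite_imC_cong[OF m e])
  show "h = Map.empty \<longleftrightarrow> f = Map.empty"
    using bd_equiv_empty[OF m(1)] bd_equiv_empty[OF m(2)] e bd_equiv_sym[OF m e] by metis
qed

theorem theorem3p22:
  fixes D\<^sub>1 D\<^sub>2 :: "(word \<rightharpoonup> word) set set"
  defines "D\<^sub>1 \<equiv> {X \<in> carrier MbdP. \<exists>f\<in>X. f \<noteq> Map.empty \<and> finite (imC f)}"
      and "D\<^sub>2 \<equiv> {X \<in> carrier MbdP. \<exists>f\<in>X. infinite (imC f)}"
  shows "D_classes MbdP - {D_class MbdP (bd_class Map.empty)} = {D\<^sub>1, D\<^sub>2} \<and> D\<^sub>1 \<noteq> D\<^sub>2"
proof -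
  let ?fin = "\<lambda>f. f \<noteq> Map.empty \<and> finite (imC f)"
  have in1: "bd_class f \<in> D\<^sub>1 \<longleftrightarrow> ?fin f" and in2: "bd_class f \<in> D\<^sub>2 \<longleftrightarrow> infinite (imC f)"
    if f: "f \<in> carrier RMP" for f
  proof -
    have car: "bd_class f \<in> carrier MbdP" unfolding carrier_MbdP by (rule imageI[OF f])
    have "(\<exists>h\<in>bd_class f. ?fin h) \<longleftrightarrow> ?fin f"
    proof
      assume "\<exists>h\<in>bd_class f. ?fin h"
      then obtain h where "h \<in> bd_class f" "?fin h" by (rule bexE)
      then show "?fin f" using bd_class_invariants[OF f, of h] by simp
    qed (rule bexI[OF _ bd_class_self[OF f]])
    then show "bd_class f \<in> D\<^sub>1 \<longleftrightarrow> ?fin f" unfolding D\<^sub>1_def using car by simp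
    have "(\<exists>h\<in>bd_class f. infinite (imC h)) \<longleftrightarrow> infinite (imC f)"
    proof
      assume "\<exists>h\<in>bd_class f. infinite (imC h)"
      then obtain h where "h \<in> bd_class f" "infinite (imC h)" by (rule bexE)
      then show "infinite (imC f)" using bd_class_invariants(1)[OF f, of h] by simp
    qed (rule bexI[OF _ bd_class_self[OF f]])
    then show "bd_class f \<in> D\<^sub>2 \<longleftrightarrow> infinite (imC f)" unfolding D\<^sub>2_def using car by simp
  qed
  have sub: "D\<^sub>1 \<subseteq> bd_class ` carrier RMP" "D\<^sub>2 \<subseteq> bd_class ` carrier RMP"
    unfolding D\<^sub>1_def D\<^sub>2_def carrier_MbdP by simp_all
  have inD: "bd_class g \<in> D_class MbdP (bd_class f) \<longleftrightarrow> D_equiv MbdP (bd_class f) (bd_class g)"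
    if "g \<in> carrier RMP" for f g
    unfolding D_class_def carrier_MbdP using imageI[OF that, of bd_class] by simp
  have subD: "D_class MbdP X \<subseteq> bd_class ` carrier RMP" for X
    unfolding D_class_def carrier_MbdP by simp
  have eqI: "S = T" if "S \<subseteq> bd_class ` carrier RMP" "T \<subseteq> bd_class ` carrier RMP"
    "\<And>g. g \<in> carrier RMP \<Longrightarrow> bd_class g \<in> S \<longleftrightarrow> bd_class g \<in> T" for S T :: "(word \<rightharpoonup> word) set set"
  proof (rule Set.set_eqI)
    fix X
    show "X \<in> S \<longleftrightarrow> X \<in> T"
    proof (cases "X \<in> bd_class ` carrier RMP")
      case True
      then obtain g where "g \<in> carrier RMP" "X = bd_class g" by (rule imageE)
      then show ?thesis using that(3) by simp
    next
      case False
      show ?thesis using contra_subsetD[OF that(1) False] contra_subsetD[OF that(2) False] by (simp only:)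
    qed
  qed
  have class1: "D_class MbdP (bd_class f) = D\<^sub>1" if f: "f \<in> carrier RMP" "?fin f" for f
  proof (rule eqI[OF subD sub(1)])
    fix g assume g: "g \<in> carrier RMP"
    show "bd_class g \<in> D_class MbdP (bd_class f) \<longleftrightarrow> bd_class g \<in> D\<^sub>1"
      unfolding inD[OF g] in1[OF g]
    proof
      assume D: "D_equiv MbdP (bd_class f) (bd_class g)"
      show "?fin g" using D_equiv_finite_imC[OF f(1) g D] D_equiv_empty[OF f(1) g D] f(2) by simp
    next
      assume "?fin g"
      then show "D_equiv MbdP (bd_class f) (bd_class g)" using f by (intro D_equiv_finite g) simp_all
    qed
  qed
  have class2: "D_class MbdP (bd_class f) = D\<^sub>2" if f: "f \<in> carrier RMP" "infinite (imC f)" for f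
  proof (rule eqI[OF subD sub(2)])
    fix g assume g: "g \<in> carrier RMP"
    show "bd_class g \<in> D_class MbdP (bd_class f) \<longleftrightarrow> bd_class g \<in> D\<^sub>2"
      unfolding inD[OF g] in2[OF g]
    proof
      assume D: "D_equiv MbdP (bd_class f) (bd_class g)"
      show "infinite (imC g)" using D_equiv_finite_imC[OF f(1) g D] f(2) by simp
    next
      assume "infinite (imC g)"
      then show "D_equiv MbdP (bd_class f) (bd_class g)" by (rule D_equiv_infinite[OF f g])
    qed
  qed
  obtain f1 where f1: "f1 \<in> carrier RMP" "?fin f1" using finite_image_exists by (rule bexE)
  obtain f2 where f2: "f2 \<in> carrier RMP" "infinite (imC f2)" using infinite_image_exists by (rule bexE)
  let ?Z = "D_class MbdP (bd_class Map.empty)"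
  have notZ: "bd_class f \<notin> ?Z" if f: "f \<in> carrier RMP" "f \<noteq> Map.empty" for f
    unfolding inD[OF f(1)] using D_equiv_empty[OF empty_RMP f(1)] f(2) by metis
  have ran_empty: "finite (imC Map.empty)"
    unfolding imC_def using code_of_subset[OF right_ideal_ran[OF RMP_morphism[OF empty_RMP]]]
    by (simp add: ran_def)
  have f2ne: "f2 \<noteq> Map.empty" using f2(2) ran_empty by metis
  have D1Z: "D\<^sub>1 \<noteq> ?Z" using in1[OF f1(1)] f1(2) notZ[OF f1(1)] by metis
  have D2Z: "D\<^sub>2 \<noteq> ?Z" using in2[OF f2(1)] f2(2) notZ[OF f2(1) f2ne] by metis
  have D12: "D\<^sub>1 \<noteq> D\<^sub>2" using in1[OF f1(1)] in2[OF f1(1)] f1(2) by metis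
  have "D_classes MbdP - {?Z} = {D\<^sub>1, D\<^sub>2}"
  proof (rule Set.set_eqI, rule iffI)
    fix S assume S: "S \<in> D_classes MbdP - {?Z}"
    then have "S \<in> D_class MbdP ` bd_class ` carrier RMP" unfolding D_classes_def carrier_MbdP by simp
    then obtain X where X: "X \<in> bd_class ` carrier RMP" "S = D_class MbdP X" by (rule imageE) (rule that)
    obtain f where f: "f \<in> carrier RMP" "X = bd_class f" using X(1) by (rule imageE) (rule that)
    have "f \<noteq> Map.empty"
    proof
      assume "f = Map.empty"
      then have "S = ?Z" unfolding X(2) f(2) by (rule arg_cong)
      with S show False by simp
    qed
    then show "S \<in> {D\<^sub>1, D\<^sub>2}"
      using class1[OF f(1)] class2[OF f(1)] unfolding X(2) f(2) by (cases "finite (imC f)") simp_all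
  next
    fix S assume "S \<in> {D\<^sub>1, D\<^sub>2}"
    moreover have "D\<^sub>1 \<in> D_classes MbdP"
      unfolding D_classes_def carrier_MbdP class1[OF f1, symmetric] by (intro imageI f1(1))
    moreover have "D\<^sub>2 \<in> D_classes MbdP"
      unfolding D_classes_def carrier_MbdP class2[OF f2, symmetric] by (intro imageI f2(1))
    ultimately show "S \<in> D_classes MbdP - {?Z}" using D1Z D2Z unfolding Diff_iff insert_iff empty_iff by (elim disjE FalseE) (simp_all only: simp_thms)
  qed
  then show ?thesis using D12 by (rule conjI)
qed

end
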